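(* Let $d\ge 1$ and let $k\ge 2$ be a fixed integer. Let $p$ and $q$ be probability densities on $\mathbb{R}^d$, let $\mathcal{M}$ denote the support of $p$, and assume that almost all points of $\mathcal{M}$ lie in its interior and that $$r_{\mathcal{M}} := \inf_{0<\delta<1}\inf_{x\in\mathcal{M}} \frac{\mathrm{Vol}\big(B(x,\delta)\cap \mathcal{M}\big)}{\mathrm{Vol}\big(B(x,\delta)\big)}>0,$$ where $B(x,R)$ is the closed Euclidean ball of radius $R$ around $x$. For each $n,m$ let $X_{1:n}=(X_1,\dots,X_n)$ be an i.i.d. sample from $p$ and $Y_{1:m}=(Y_1,\dots,Y_m)$ an i.i.d. sample from $q$. Let $\alpha,\beta\in\mathbb{R}$ with $-(k-1)/2<\alpha,\beta<(k-1)/2$. Assume: if $0<\alpha<(k-1)/2$, then $p$ is bounded away from zero and uniformly continuous; if $-(k-1)/2<\alpha<0$, then $p$ is bounded; if $0<\beta<(k-1)/2$, then $q$ is bounded away from zero and uniformly continuous; if $-(k-1)/2<\beta<0$, then $q$ is bounded. Assume moreover that $D_{\alpha,\beta}(p\|q)<\infty$ and $D_{2\alpha,2\beta}(p\|q)<\infty$, and that the estimator is asymptotically unbiased for both $(\alpha,\beta)$ and $(2\alpha,2\beta)$, i.e. $\lim_{n,m\to\infty}\mathbb{E}[\widehat D_{a,b}(X_{1:n}\|Y_{1:m})]=D_{a,b}(p\|q)$ for $(a,b)\in\{(\alpha,\beta),(2\alpha,2\beta)\}$. Then $$\lim_{n,m\to\infty}\mathbb{E}\left[\left(\widehat D_{\alpha,\beta}(X_{1:n}\|Y_{1:m})-D_{\alpha,\beta}(p\|q)\right)^2\right]=0,$$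 i.e. the estimator is $L_2$ consistent.
   Context: For real $a,b$: $D_{a,b}(p\|q)=\int_{\mathcal{M}} p^{a}(x)\,q^{b}(x)\,p(x)\,dx$. For $i=1,\dots,n$, $\rho_k(i)$ is the Euclidean distance from $X_i$ to its $k$th nearest neighbor in $X_{1:n}\setminus\{X_i\}$, and $\nu_k(i)$ is the Euclidean distance from $X_i$ to its $k$th nearest neighbor in $Y_{1:m}$. The estimator is $$\widehat D_{a,b}(X_{1:n}\|Y_{1:m})=\frac{B_{k,d,a,b}}{n(n-1)^{a}m^{b}}\sum_{i=1}^n \rho_k^{-da}(i)\,\nu_k^{-db}(i),\qquad B_{k,d,a,b}=\bar c_d^{-a-b}\frac{\Gamma(k)^2}{\Gamma(k-a)\Gamma(k-b)},$$ where $\bar c_d$ is the volume of the $d$-dimensional unit ball. *)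

theory Defs
  imports "HOL-Probability.Probability"
begin

definition dsupp :: "('a \<Rightarrow> real) \<Rightarrow> 'a set" where
  "dsupp p = {x. 0 < p x}"

definition epow :: "real \<Rightarrow> real \<Rightarrow> ennreal" where
  "epow x a = (if 0 < x then ennreal (x powr a)
               else if a = 0 then 1 else if 0 < a then 0 else top)"

definition Dab :: "real \<Rightarrow> real \<Rightarrow> ('a::euclidean_space \<Rightarrow> real) \<Rightarrow> ('a \<Rightarrow> real) \<Rightarrow> ennreal" where
  "Dab a b p q = (\<integral>\<^sup>+ x. indicator (dsupp p) x * epow (p x) a * epow (q x) b * ennreal (p x) \<partial>lborel)"

definition rho_k :: "nat \<Rightarrow> nat \<Rightarrow> (nat \<Rightarrow> 'a::euclidean_space) \<Rightarrow> nat \<Rightarrow> real" where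
  "rho_k k n X i = sort [dist (X i) (X j). j \<leftarrow> [0..<n], j \<noteq> i] ! (k - 1)"

definition nu_k :: "nat \<Rightarrow> nat \<Rightarrow> (nat \<Rightarrow> 'a::euclidean_space) \<Rightarrow> 'a \<Rightarrow> real" where
  "nu_k k m Y x = sort [dist x (Y j). j \<leftarrow> [0..<m]] ! (k - 1)"

definition unit_vol :: "'a::euclidean_space itself \<Rightarrow> real" where
  "unit_vol _ = measure lborel (ball (0::'a) 1)"

definition B_const :: "'a::euclidean_space itself \<Rightarrow> nat \<Rightarrow> real \<Rightarrow> real \<Rightarrow> real" where
  "B_const T k a b = unit_vol T powr (- a - b) * Gamma (real k) ^ 2
                     / (Gamma (real k - a) * Gamma (real k - b))"

definition D_est :: "nat \<Rightarrow> real \<Rightarrow> real \<Rightarrow> nat \<Rightarrow> nat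
                      \<Rightarrow> (nat \<Rightarrow> 'a::euclidean_space) \<Rightarrow> (nat \<Rightarrow> 'a) \<Rightarrow> real" where
  "D_est k a b n m X Y =
     B_const TYPE('a) k a b / (real n * (real n - 1) powr a * real m powr b) *
     (\<Sum>i<n. rho_k k n X i powr (- real DIM('a) * a) * nu_k k m Y (X i) powr (- real DIM('a) * b))"

definition sample_space :: "('a::euclidean_space \<Rightarrow> real) \<Rightarrow> ('a \<Rightarrow> real) \<Rightarrow> nat \<Rightarrow> nat
                             \<Rightarrow> ((nat \<Rightarrow> 'a) \<times> (nat \<Rightarrow> 'a)) measure" where
  "sample_space p q n m = (PiM {..<n} (\<lambda>_. density lborel p)) \<Otimes>\<^sub>M (PiM {..<m} (\<lambda>_. density lborel q))"

definition is_density :: "('a::euclidean_space \<Rightarrow> real) \<Rightarrow> bool" where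
  "is_density p \<longleftrightarrow> p \<in> borel_measurable lborel \<and> (\<forall>x. 0 \<le> p x) \<and> (\<integral>\<^sup>+ x. ennreal (p x) \<partial>lborel) = 1"

end

theory Submission
  imports Defs
begin

text \<open>
  Write the estimator as \<open>(1 / n) \<Sum> Z i\<close> with \<open>Z i = K * G powr - \<alpha> * H powr - \<beta>\<close>, where \<open>G\<close> and \<open>H\<close> are the
  normalised volumes of the two nearest neighbour balls around the \<open>i\<close>-th sample point, and let
  \<open>0 \<le> W i \<le> Z i\<close> be obtained by replacing the two powers by step functions. By Jensen and
  \<open>(Z - W)\<^sup>2 \<le> Z\<^sup>2 - W\<^sup>2\<close>, the squared distance between the averages of \<open>Z\<close> and \<open>W\<close> is at most the
  difference of the averages of \<open>Z\<^sup>2\<close> and \<open>W\<^sup>2\<close>. Up to a constant the average of \<open>Z\<^sup>2\<close> is the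
  estimator for \<open>(2\<alpha>, 2\<beta>)\<close>, whose expectation converges by hypothesis.

  Averages of step functions are handled exactly: \<open>G > t\<close> says that a ball of volume
  \<open>t / (n - 1)\<close> contains fewer than \<open>k\<close> other points. For two distinct centres the counts are
  asymptotically independent Poisson variables with means \<open>t p(x)\<close>, \<open>t p(y)\<close>, by Lebesgue
  differentiation; hence the averages of \<open>W\<close> and \<open>W\<^sup>2\<close> converge in mean square to constants. As the step
  functions are refined, these constants tend to Gamma integrals, which the normalising constant turns
  into \<open>D(\<alpha>, \<beta>)\<close> and \<open>D(2\<alpha>, 2\<beta>)\<close>.
\<close>

section \<open>Lebesgue differentiation along a sequence of radii\<close>

text \<open>The obstacle is that the powers are unbounded, near 0 or at infinity according to the
  sign of the exponent, so convergence of the neighbour counts alone says nothing about second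
  moments. Convergence of the mean at the doubled exponents supplies the missing uniform
  integrability, in the spirit of Scheffe's lemma: the limit of E[Z^2] leaves no room for mass
  beyond the bounded minorants. Minorants are taken rather than arbitrary approximations because 0
  \<le> W \<le> Z turns the squared error into a difference of two means. The grid of the step
  functions stays fixed while both sample sizes grow and is refined only afterwards. Pairs of
  centres appear because the variance of an average is a double sum over pairs; the Gamma factors
  appear because the limiting normalised volume at a point is an Erlang variable of shape k divided
  by the density there.\<close>

lemma measurable_measure_cball:
  fixes M :: "'a::euclidean_space measure"
  assumes [simp, measurable_cong]: "sets M = sets borel" and "sigma_finite_measure M"
  shows "(\<lambda>x. emeasure M (cball x r)) \<in> borel_measurable borel"
proof -
  interpret sigma_finite_measure M by fact
  have "closed {z :: 'a \<times> 'a. dist (fst z) (snd z) \<le> r}"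
    by (intro closed_Collect_le continuous_intros)
  then have "{z :: 'a \<times> 'a. dist (fst z) (snd z) \<le> r} \<in> sets (borel \<Otimes>\<^sub>M borel)"
    unfolding borel_prod by (rule borel_closed)
  also have "sets (borel \<Otimes>\<^sub>M borel) = sets (borel \<Otimes>\<^sub>M M)"
    by (intro sets_pair_measure_cong) simp_all
  finally have "{z :: 'a \<times> 'a. dist (fst z) (snd z) \<le> r} \<in> sets (borel \<Otimes>\<^sub>M M)" .
  from measurable_emeasure_Pair[OF this] show ?thesis
    by (simp add: vimage_def cball_def)
qed

text \<open>Around each point of \<open>E\<close> there are admissible balls of arbitrarily small
  radius inside \<open>U\<close>, so they form a Vitali cover. Disjoint ones exhaust
  \<open>E\<close> up to a Lebesgue null set, which absolute continuity makes \<open>M\<close>-null,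
  and the comparison is summed over them. Infinitely many good indices suffice, not all large ones;
  this is what arguments about upper and lower limits of ball averages need.\<close>

lemma Vitali_comparison:
  fixes M N :: "'a::euclidean_space measure"
  assumes [simp, measurable_cong]: "sets M = sets borel" and N: "sets N = sets borel"
    and fin: "emeasure N (space N) \<noteq> \<infinity>" and ac: "absolutely_continuous lborel M"
    and E[measurable]: "E \<in> sets borel"
    and r: "\<And>n. 0 < r n" "r \<longlonglongrightarrow> 0"
    and le: "\<And>x. x \<in> E \<Longrightarrow>
      \<exists>\<^sub>F n in sequentially. emeasure M (cball x (r n)) \<le> emeasure N (cball x (r n))"
  shows "emeasure M E \<le> emeasure N E"
proof -
  note [simp, measurable_cong] = N
  have "emeasure M E \<le> emeasure N U" if U: "open U" "E \<subseteq> U" for U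
  proof -
    define K where "K = {(x, n). x \<in> E \<and> cball x (r n) \<subseteq> U \<and>
      emeasure M (cball x (r n)) \<le> emeasure N (cball x (r n))}"
    have fine: "\<exists>i. i \<in> K \<and> x \<in> cball (fst i) (r (snd i)) \<and> r (snd i) < d"
      if "x \<in> E" "0 < d" for x d
    proof -
      obtain e where e: "0 < e" "cball x e \<subseteq> U"
        using U \<open>x \<in> E\<close> open_contains_cball by blast
      have "\<forall>\<^sub>F n in sequentially. r n < min d e"
        using order_tendstoD(2)[OF r(2), of "min d e"] e \<open>0 < d\<close> by simp
      from frequently_eventually_frequently[OF le[OF \<open>x \<in> E\<close>] this]
      obtain n where n: "emeasure M (cball x (r n)) \<le> emeasure N (cball x (r n))" "r n < min d e"
        using frequently_ex by blast
      have "cball x (r n) \<subseteq> cball x e"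
        using n(2) by (intro subset_cball) auto
      then have "(x, n) \<in> K" using n e \<open>x \<in> E\<close> by (auto simp: K_def)
      then show ?thesis using n r(1)[of n] by (intro exI[of _ "(x, n)"]) auto
    qed
    obtain C where C: "countable C" "C \<subseteq> K"
      "pairwise (\<lambda>i j. disjnt (cball (fst i) (r (snd i))) (cball (fst j) (r (snd j)))) C"
      "negligible (E - (\<Union>i\<in>C. cball (fst i) (r (snd i))))"
      using Vitali_covering_theorem_cballs[of K "\<lambda>i. r (snd i)" E fst] fine r(1) by blast
    let ?B = "\<lambda>i. cball (fst i) (r (snd i))"
    have disj: "disjoint_family_on ?B C"
      using C(3) by (auto simp: disjoint_family_on_def pairwise_def disjnt_def)
    have UB[measurable]: "(\<Union>i\<in>C. ?B i) \<in> sets borel"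
      using C(1) by (intro sets.countable_UN') auto
    have "E - (\<Union>i\<in>C. ?B i) \<in> null_sets lborel"
      using C(4) by (simp add: negligible_iff_null_sets null_sets_completion_iff)
    then have "E - (\<Union>i\<in>C. ?B i) \<in> null_sets M"
      using ac by (auto simp: absolutely_continuous_def)
    then have "emeasure M (E - (\<Union>i\<in>C. ?B i)) = 0" by auto
    have "emeasure M E \<le> emeasure M ((\<Union>i\<in>C. ?B i) \<union> (E - (\<Union>i\<in>C. ?B i)))"
      by (intro emeasure_mono) auto
    also have "\<dots> \<le> emeasure M (\<Union>i\<in>C. ?B i) + emeasure M (E - (\<Union>i\<in>C. ?B i))"
      by (intro emeasure_subadditive) auto
    also have "\<dots> = emeasure M (\<Union>i\<in>C. ?B i)"
      using \<open>emeasure M (E - (\<Union>i\<in>C. ?B i)) = 0\<close> by simp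
    also have "\<dots> = (\<integral>\<^sup>+ i. emeasure M (?B i) \<partial>count_space C)"
      using C(1) disj by (intro emeasure_UN_countable) auto
    also have "\<dots> \<le> (\<integral>\<^sup>+ i. emeasure N (?B i) \<partial>count_space C)"
      using C(2) by (intro nn_integral_mono) (auto simp: K_def)
    also have "\<dots> = emeasure N (\<Union>i\<in>C. ?B i)"
      using C(1) disj by (intro emeasure_UN_countable[symmetric]) auto
    also have "\<dots> \<le> emeasure N U"
    proof (intro emeasure_mono UN_least)
      fix i assume "i \<in> C"
      then show "?B i \<subseteq> U" using C(2) by (cases i) (auto simp: K_def simp del: mem_cball)
    qed (use U in simp)
    finally show ?thesis .
  qed
  \<comment> \<open>Finiteness of \<open>N\<close> gives outer regularity, so \<open>U\<close> may
    shrink to \<open>E\<close>.\<close>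
  then show ?thesis
    by (subst outer_regular[OF N fin E]) (auto intro!: INF_greatest)
qed

lemma emeasure_density_le_of_le:
  fixes p :: "'a::euclidean_space \<Rightarrow> real"
  assumes [measurable]: "p \<in> borel_measurable borel" "E \<in> sets borel"
    and "\<And>x. x \<in> E \<Longrightarrow> p x \<le> s"
  shows "emeasure (density lborel p) E \<le> ennreal s * emeasure lborel E"
proof -
  have "emeasure (density lborel p) E = (\<integral>\<^sup>+x. ennreal (p x) * indicator E x \<partial>lborel)"
    by (simp add: emeasure_density)
  also have "\<dots> \<le> (\<integral>\<^sup>+x. ennreal s * indicator E x \<partial>lborel)"
    using assms(3) by (intro nn_integral_mono) (auto split: split_indicator intro: ennreal_leI)
  finally show ?thesis by (simp add: nn_integral_cmult)
qed

lemma emeasure_density_ge_of_ge: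
  fixes p :: "'a::euclidean_space \<Rightarrow> real"
  assumes [measurable]: "p \<in> borel_measurable borel" "E \<in> sets borel"
    and "\<And>x. x \<in> E \<Longrightarrow> s \<le> p x"
  shows "ennreal s * emeasure lborel E \<le> emeasure (density lborel p) E"
proof -
  have "ennreal s * emeasure lborel E = (\<integral>\<^sup>+x. ennreal s * indicator E x \<partial>lborel)"
    by (simp add: nn_integral_cmult)
  also have "\<dots> \<le> (\<integral>\<^sup>+x. ennreal (p x) * indicator E x \<partial>lborel)"
    using assms(3) by (intro nn_integral_mono) (auto split: split_indicator intro: ennreal_leI)
  finally show ?thesis by (simp add: emeasure_density)
qed

text \<open>Finiteness rules out \<open>e = top\<close>, which would satisfy the inequality for
  every positive \<open>s\<close>.\<close>

lemma null_of_two_sided_bound: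
  assumes "ennreal t * (e :: ennreal) \<le> ennreal s * e" "0 \<le> s" "s < t" "e < \<infinity>"
  shows "e = 0"
proof -
  obtain x where x: "e = ennreal x" "0 \<le> x"
    using assms(4) by (cases e) auto
  have "t * x \<le> s * x"
    using assms x by (simp add: ennreal_mult[symmetric])
  then show ?thesis using assms x by (auto simp: mult_le_cancel_right)
qed

definition ball_avg :: "('a::euclidean_space \<Rightarrow> real) \<Rightarrow> real \<Rightarrow> 'a \<Rightarrow> real" where
  "ball_avg p r x = measure (density lborel p) (cball x r) / measure lborel (cball x r)"

text \<open>Convergence fails at x only if rationals s < t separate p x from infinitely many
  averages. For fixed s < t the exceptional set is squeezed: Vitali compares the measure with
  density p to a multiple of Lebesgue measure (t in one case, s in the other), while the bound on p
  over the set gives the opposite estimate, forcing measure zero.\<close>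

lemma lebesgue_differentiation:
  fixes p :: "'a::euclidean_space \<Rightarrow> real"
  assumes p: "is_density p" and r: "\<And>n. 0 < r n" "r \<longlonglongrightarrow> 0"
  shows "AE x in lborel. (\<lambda>n. ball_avg p (r n) x) \<longlonglongrightarrow> p x"
proof -
  let ?M = "density lborel p"
  have [measurable]: "p \<in> borel_measurable borel" and p0: "\<And>x. 0 \<le> p x"
    and p1: "(\<integral>\<^sup>+ x. ennreal (p x) \<partial>lborel) = 1"
    using p by (auto simp: is_density_def)
  interpret M: prob_space ?M
    by (rule prob_spaceI) (simp add: emeasure_density p1)
  have eM: "emeasure ?M A = ennreal (measure ?M A)" for A by (rule M.emeasure_eq_measure)
  have vol: "0 < measure lborel (cball x (r n))" for x :: 'a and n
    using content_cball_pos[OF r(1)] by simp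
  have eL: "emeasure lborel (cball x (r n)) = ennreal (measure lborel (cball x (r n)))"
    for x :: 'a and n
    by (intro emeasure_eq_ennreal_measure) (metis emeasure_lborel_cball_finite less_irrefl infinity_ennreal_def)
  have [measurable]: "(\<lambda>x. measure ?M (cball x d)) \<in> borel_measurable borel" for d
    using measurable_measure_cball[of ?M d] M.sigma_finite_measure_axioms
    by (simp add: measure_def)
  have [measurable]: "(\<lambda>x::'a. measure lborel (cball x d)) \<in> borel_measurable borel" for d
    using measurable_measure_cball[OF sets_lborel sigma_finite_lborel, where r = d]
    unfolding measure_def by measurable
  have [measurable]: "(\<lambda>x. ball_avg p d x) \<in> borel_measurable borel" for d
    unfolding ball_avg_def by measurable
  have ac: "absolutely_continuous lborel ?M"
    by (intro absolutely_continuousI_density) simp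
  have up: "AE x in lborel. \<not> (p x \<le> s \<and> (\<exists>\<^sub>F n in sequentially. t \<le> ball_avg p (r n) x))"
    if st: "0 \<le> s" "s < t" for s t :: real
  proof -
    define E where "E = {x. p x \<le> s \<and> (\<exists>\<^sub>F n in sequentially. t \<le> ball_avg p (r n) x)}"
    have E[measurable]: "E \<in> sets borel"
      unfolding E_def frequently_def eventually_sequentially by measurable
    let ?N = "density lborel (\<lambda>_::'a. ennreal t)"
    have N: "emeasure ?N A = ennreal t * emeasure lborel A" if "A \<in> sets borel" for A :: "'a set"
      using that by (simp add: emeasure_density nn_integral_cmult)
    have "emeasure ?N E \<le> emeasure ?M E"
    proof (rule Vitali_comparison[where r = r])
      show "emeasure ?M (space ?M) \<noteq> \<infinity>" by simp
      show "absolutely_continuous lborel ?N" by (intro absolutely_continuousI_density) simp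
      fix x assume "x \<in> E"
      then have *: "\<exists>\<^sub>F n in sequentially. t \<le> ball_avg p (r n) x" by (simp add: E_def)
      show "\<exists>\<^sub>F n in sequentially. emeasure ?N (cball x (r n)) \<le> emeasure ?M (cball x (r n))"
        using *
      proof (rule frequently_elim1)
        fix n assume "t \<le> ball_avg p (r n) x"
        then have "t * measure lborel (cball x (r n)) \<le> measure ?M (cball x (r n))"
          using vol[of x n] by (simp add: ball_avg_def field_simps)
        then have "ennreal t * ennreal (measure lborel (cball x (r n))) \<le> ennreal (measure ?M (cball x (r n)))"
          using st by (subst ennreal_mult[symmetric]) (auto intro: ennreal_leI)
        then show "emeasure ?N (cball x (r n)) \<le> emeasure ?M (cball x (r n))"
          unfolding eM eL[symmetric] by (subst N) auto
      qed
    qed (use r E in auto)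
    moreover have Ms: "emeasure ?M E \<le> ennreal s * emeasure lborel E"
      by (rule emeasure_density_le_of_le) (measurable, simp add: E_def)
    ultimately have 1: "ennreal t * emeasure lborel E \<le> ennreal s * emeasure lborel E"
      and 2: "ennreal t * emeasure lborel E \<le> emeasure ?M E"
      by (simp_all add: N)
    \<comment> \<open>Here \<open>E\<close> has finite Lebesgue measure because the density has
      total mass 1 and t > 0.\<close>
    have "ennreal t * emeasure lborel E < \<infinity>"
      using order_le_less_trans[OF 2] unfolding eM by simp
    then have "emeasure lborel E < \<infinity>"
      using st by (auto simp: ennreal_mult_less_top)
    from null_of_two_sided_bound[OF 1 st this] have "E \<in> null_sets lborel"
      using E by (intro null_setsI) simp_all
    then show ?thesis by (rule AE_I') (auto simp: E_def)
  qed
  \<comment> \<open>In the mirrored case the comparison measure is a multiple of Lebesgue measure,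
    which need not be finite, so everything is localised to a ball. The margin 1 in
    \<open>R + 1\<close> leaves room for all balls of radius below 1 centred in
    \<open>E\<close>.\<close>
  have lo_ball: "AE x in lborel. \<not> (x \<in> ball 0 R \<and> t \<le> p x \<and>
       (\<exists>\<^sub>F n in sequentially. ball_avg p (r n) x \<le> s))"
    if st: "0 \<le> s" "s < t" for s t R :: real
  proof -
    define E where "E = {x. x \<in> ball 0 R \<and> t \<le> p x \<and>
      (\<exists>\<^sub>F n in sequentially. ball_avg p (r n) x \<le> s)}"
    have E[measurable]: "E \<in> sets borel"
      unfolding E_def frequently_def eventually_sequentially by measurable
    let ?N = "density lborel (\<lambda>x::'a. ennreal s * indicator (ball 0 (R + 1)) x)"
    have N: "emeasure ?N A = ennreal s * emeasure lborel (A \<inter> ball 0 (R + 1))"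
      if [measurable]: "A \<in> sets borel" for A :: "'a set"
    proof -
      have "emeasure ?N A = (\<integral>\<^sup>+x. ennreal s * indicator (A \<inter> ball 0 (R + 1)) x \<partial>lborel)"
        by (subst emeasure_density) (measurable, auto intro!: nn_integral_cong split: split_indicator)
      also have "\<dots> = ennreal s * emeasure lborel (A \<inter> ball 0 (R + 1))"
        by (rule nn_integral_cmult_indicator) simp
      finally show ?thesis .
    qed
    have "emeasure ?M E \<le> emeasure ?N E"
    proof (rule Vitali_comparison[where r = r])
      show "emeasure ?N (space ?N) \<noteq> \<infinity>"
        using emeasure_lborel_ball_finite[of "0::'a" "R + 1"]
        by (subst N) (simp_all add: ennreal_mult_eq_top_iff)
      show "absolutely_continuous lborel ?M" by (rule ac)
      fix x assume x: "x \<in> E"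
      then have *: "\<exists>\<^sub>F n in sequentially. ball_avg p (r n) x \<le> s" by (simp add: E_def)
      have "\<forall>\<^sub>F n in sequentially. r n < 1"
        using order_tendstoD(2)[OF r(2), of 1] by simp
      from frequently_eventually_frequently[OF * this]
      show "\<exists>\<^sub>F n in sequentially. emeasure ?M (cball x (r n)) \<le> emeasure ?N (cball x (r n))"
      proof (rule frequently_elim1)
        fix n assume n: "ball_avg p (r n) x \<le> s \<and> r n < 1"
        then have le: "measure ?M (cball x (r n)) \<le> s * measure lborel (cball x (r n))"
          using vol[of x n] by (simp add: ball_avg_def field_simps)
        have "cball x (r n) \<subseteq> ball 0 (R + 1)"
          using x n r(1)[of n] by (simp add: E_def cball_subset_ball_iff)
        then have "cball x (r n) \<inter> ball 0 (R + 1) = cball x (r n)" by blast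
        moreover have "ennreal (measure ?M (cball x (r n))) \<le> ennreal s * ennreal (measure lborel (cball x (r n)))"
          using st le by (subst ennreal_mult[symmetric]) (auto intro: ennreal_leI)
        ultimately show "emeasure ?M (cball x (r n)) \<le> emeasure ?N (cball x (r n))"
          unfolding eM eL[symmetric] by (subst N) auto
      qed
    qed (use r E in auto)
    also have "\<dots> = ennreal s * emeasure lborel (E \<inter> ball 0 (R + 1))"
      by (rule N[OF E])
    also have "E \<inter> ball 0 (R + 1) = E"
      by (auto simp: E_def)
    finally have "emeasure ?M E \<le> ennreal s * emeasure lborel E" .
    moreover have "ennreal t * emeasure lborel E \<le> emeasure ?M E"
      by (rule emeasure_density_ge_of_ge) (measurable, simp add: E_def)
    ultimately have 1: "ennreal t * emeasure lborel E \<le> ennreal s * emeasure lborel E" by simp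
    have "emeasure lborel E \<le> emeasure lborel (ball (0::'a) R)"
      by (intro emeasure_mono) (auto simp: E_def)
    also have "\<dots> < \<infinity>" by (rule emeasure_lborel_ball_finite)
    finally have "emeasure lborel E < \<infinity>" .
    from null_of_two_sided_bound[OF 1 st this] have "E \<in> null_sets lborel"
      using E by (intro null_setsI) simp_all
    then show ?thesis by (rule AE_I') (auto simp: E_def)
  qed
  have lo: "AE x in lborel. \<not> (t \<le> p x \<and> (\<exists>\<^sub>F n in sequentially. ball_avg p (r n) x \<le> s))"
    if st: "0 \<le> s" "s < t" for s t :: real
  proof -
    have "AE x in lborel. \<forall>R::nat. \<not> (x \<in> ball 0 (real R) \<and> t \<le> p x \<and>
       (\<exists>\<^sub>F n in sequentially. ball_avg p (r n) x \<le> s))"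
      unfolding AE_all_countable by (intro allI lo_ball st)
    then show ?thesis
    proof eventually_elim
      case (elim x)
      obtain R :: nat where "norm x < real R" using reals_Archimedean2 by blast
      then show ?case using elim by (metis mem_ball_0)
    qed
  qed
  have "AE x in lborel. \<forall>s t :: rat. 0 \<le> s \<longrightarrow> s < t \<longrightarrow>
      \<not> (p x \<le> of_rat s \<and> (\<exists>\<^sub>F n in sequentially. of_rat t \<le> ball_avg p (r n) x)) \<and>
      \<not> (of_rat t \<le> p x \<and> (\<exists>\<^sub>F n in sequentially. ball_avg p (r n) x \<le> of_rat s))"
    unfolding AE_all_countable
  proof (intro allI)
    fix s t :: rat
    show "AE x in lborel. 0 \<le> s \<longrightarrow> s < t \<longrightarrow>
      \<not> (p x \<le> of_rat s \<and> (\<exists>\<^sub>F n in sequentially. of_rat t \<le> ball_avg p (r n) x)) \<and>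
      \<not> (of_rat t \<le> p x \<and> (\<exists>\<^sub>F n in sequentially. ball_avg p (r n) x \<le> of_rat s))"
    proof (cases "0 \<le> s \<and> s < t")
      case True
      then have "0 \<le> (of_rat s :: real)" "(of_rat s :: real) < of_rat t"
        by (simp_all add: of_rat_less)
      from up[OF this] lo[OF this] show ?thesis by eventually_elim blast
    qed auto
  qed
  then show ?thesis
  proof eventually_elim
    case (elim x)
    have avg0: "0 \<le> ball_avg p (r n) x" for n by (simp add: ball_avg_def)
    show ?case
    proof (rule order_tendstoI)
      fix a assume "a < p x"
      show "\<forall>\<^sub>F n in sequentially. a < ball_avg p (r n) x"
      \<comment> \<open>For negative a there may be no nonnegative rational between a and p x, but
        then nonnegativity of the averages is enough.\<close>
      proof (cases "a < 0")
        case True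
        then show ?thesis using avg0 by (intro always_eventually allI) (rule order_less_le_trans)
      next
        case False
        obtain s where s: "a < of_rat s" "of_rat s < p x"
          using \<open>a < p x\<close> of_rat_dense by blast
        obtain t where t: "of_rat s < (of_rat t::real)" "of_rat t < p x"
          using s of_rat_dense by blast
        have "0 \<le> (of_rat s :: real)" using s False by linarith
        then have s0: "0 \<le> s" by simp
        have "\<not> (\<exists>\<^sub>F n in sequentially. ball_avg p (r n) x \<le> of_rat s)"
          using elim s0 t s by (auto simp: of_rat_less)
        then have "\<forall>\<^sub>F n in sequentially. of_rat s < ball_avg p (r n) x"
          by (simp add: not_frequently not_le)
        then show ?thesis
          by eventually_elim (use s in linarith)
      qed
    next
      fix a assume "p x < a"
      obtain t where t: "p x < of_rat t" "of_rat t < a"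
        using \<open>p x < a\<close> of_rat_dense by blast
      obtain s where s: "p x < of_rat s" "of_rat s < (of_rat t::real)"
        using t of_rat_dense by blast
      have "0 \<le> (of_rat s :: real)" using s p0[of x] by linarith
      then have s0: "0 \<le> s" by simp
      have "\<not> (\<exists>\<^sub>F n in sequentially. of_rat t \<le> ball_avg p (r n) x)"
        using elim s0 t s by (auto simp: of_rat_less)
      then have "\<forall>\<^sub>F n in sequentially. ball_avg p (r n) x < of_rat t"
        by (simp add: not_frequently not_le)
      then show "\<forall>\<^sub>F n in sequentially. ball_avg p (r n) x < a"
        by eventually_elim (use t in linarith)
    qed
  qed
qed

section \<open>Cell counts and their Poisson limit\<close>

lemma sum_subsets_by_card:
  fixes g :: "nat \<Rightarrow> real"
  assumes "finite I"
  shows "(\<Sum>A | A \<subseteq> I \<and> card A < k. g (card A)) = (\<Sum>a<k. real (card I choose a) * g a)"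
proof -
  have fin: "finite {A. A \<subseteq> I \<and> P A}" for P
    using assms by (simp add: finite_subset[of _ "Pow I"] subset_iff)
  have "{A. A \<subseteq> I \<and> card A < k} = (\<Union>a\<in>{..<k}. {A. A \<subseteq> I \<and> card A = a})" by auto
  then have "(\<Sum>A | A \<subseteq> I \<and> card A < k. g (card A))
      = (\<Sum>a<k. \<Sum>A | A \<subseteq> I \<and> card A = a. g (card A))"
    by (simp only:) (intro sum.UNION_disjoint, auto simp: fin)
  also have "\<dots> = (\<Sum>a<k. real (card {A. A \<subseteq> I \<and> card A = a}) * g a)"
    by (intro sum.cong) auto
  finally show ?thesis using assms by (simp add: n_subsets)
qed

text \<open>Multinomial law with cell probabilities \<open>P\<close>, \<open>Q\<close> and
  \<open>1 - P - Q\<close>: the chance that in \<open>n\<close> trials each of the first two cells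
  receives fewer than \<open>k\<close> points.\<close>

definition two_cell_prob :: "nat \<Rightarrow> nat \<Rightarrow> real \<Rightarrow> real \<Rightarrow> real" where
  "two_cell_prob k n P Q = (\<Sum>a<k. \<Sum>b<k. real (n choose a) * real ((n - a) choose b) *
     (P ^ a * Q ^ b * (1 - P - Q) ^ (n - a - b)))"

lemma prod_three_cells:
  fixes P Q R :: real
  assumes "finite I" "A \<subseteq> I" "A' \<subseteq> I - A"
  shows "(\<Prod>j\<in>I. if j \<in> A then P else if j \<in> A' then Q else R)
    = P ^ card A * Q ^ card A' * R ^ (card I - card A - card A')"
proof -
  have fin: "finite A" "finite A'" using assms by (auto intro: finite_subset)
  have I: "I = A \<union> (A' \<union> (I - A - A'))" using assms by auto
  let ?f = "\<lambda>j. if j \<in> A then P else if j \<in> A' then Q else R"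
  have "prod ?f I = prod ?f A * (prod ?f A' * prod ?f (I - A - A'))"
    using assms fin by (subst I, subst prod.union_disjoint; (subst prod.union_disjoint)?) auto
  also have "prod ?f A = P ^ card A" by simp
  also have "prod ?f A' = Q ^ card A'"
    using assms by (subst prod.cong[OF refl, where h = "\<lambda>_. Q"]) auto
  also have "prod ?f (I - A - A') = R ^ card (I - A - A')"
    by (subst prod.cong[OF refl, where h = "\<lambda>_. R"]) auto
  also have "card (I - A - A') = card I - card A - card A'"
    using assms fin by (subst card_Diff_subset; (subst card_Diff_subset)?) auto
  finally show ?thesis by (simp add: mult_ac)
qed

text \<open>The event splits into disjoint boxes, one for each pair of disjoint index sets
  prescribing which samples fall into \<open>B\<close> and which into \<open>B'\<close>. The
  probability of a box depends only on the two cardinalities, so the sum collapses to binomial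
  coefficients.\<close>

lemma (in prob_space) prob_cell_counts:
  assumes I: "finite I" and [measurable]: "B \<in> sets M" "B' \<in> sets M" and disj: "B \<inter> B' = {}"
  shows "measure (PiM I (\<lambda>_. M)) {\<omega> \<in> space (PiM I (\<lambda>_. M)).
      card {j \<in> I. \<omega> j \<in> B} < k \<and> card {j \<in> I. \<omega> j \<in> B'} < k}
    = two_cell_prob k (card I) (prob B) (prob B')"
proof -
  interpret P: finite_product_prob_space "\<lambda>_. M" I
    using I by unfold_locales
  let ?P = "PiM I (\<lambda>_. M)"
  define S where "S = Sigma {A. A \<subseteq> I \<and> card A < k} (\<lambda>A. {A'. A' \<subseteq> I - A \<and> card A' < k})"
  define Box where "Box = (\<lambda>(A, A'). PiE I (\<lambda>j. if j \<in> A then B else if j \<in> A' then B' else space M - B - B'))"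
  have fin: "finite {A. A \<subseteq> J \<and> P A}" if "finite J" for P and J :: "'i set"
    using that by (simp add: finite_subset[of _ "Pow J"] subset_iff)
  have "finite S" unfolding S_def using I by (intro finite_SigmaI fin) auto
  have Box_iff: "\<omega> \<in> Box (A, A') \<longleftrightarrow> \<omega> \<in> space ?P \<and> {j \<in> I. \<omega> j \<in> B} = A \<and> {j \<in> I. \<omega> j \<in> B'} = A'"
    if "(A, A') \<in> S" for \<omega> A A'
  proof
    assume *: "\<omega> \<in> Box (A, A')"
    have BM: "B \<subseteq> space M" "B' \<subseteq> space M" using assms(2,3)[THEN sets.sets_into_space] by auto
    have j: "\<omega> j \<in> (if j \<in> A then B else if j \<in> A' then B' else space M - B - B')" if "j \<in> I" for j
      using * that unfolding Box_def by (auto simp: PiE_iff)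
    have "\<omega> j \<in> space M" if "j \<in> I" for j
      using j[OF that] BM by (auto split: if_splits)
    moreover have "\<omega> \<in> extensional I" using * by (simp add: Box_def PiE_iff)
    ultimately have "\<omega> \<in> space ?P" by (simp add: space_PiM PiE_iff)
    moreover have A: "A \<subseteq> I" "A' \<subseteq> I" "A \<inter> A' = {}" using that by (auto simp: S_def)
    have "\<omega> j \<in> B \<longleftrightarrow> j \<in> A" "\<omega> j \<in> B' \<longleftrightarrow> j \<in> A'" if "j \<in> I" for j
      using j[OF that] A disj by (auto split: if_splits)
    with A have "{j \<in> I. \<omega> j \<in> B} = A" "{j \<in> I. \<omega> j \<in> B'} = A'" by auto
    ultimately show "\<omega> \<in> space ?P \<and> {j \<in> I. \<omega> j \<in> B} = A \<and> {j \<in> I. \<omega> j \<in> B'} = A'"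
      by simp
  next
    assume "\<omega> \<in> space ?P \<and> {j \<in> I. \<omega> j \<in> B} = A \<and> {j \<in> I. \<omega> j \<in> B'} = A'"
    then show "\<omega> \<in> Box (A, A')"
      by (auto simp: Box_def space_PiM PiE_iff)
  qed
  have eq: "{\<omega> \<in> space ?P. card {j \<in> I. \<omega> j \<in> B} < k \<and> card {j \<in> I. \<omega> j \<in> B'} < k}
    = (\<Union>s\<in>S. Box s)" (is "?E = _")
  proof (intro set_eqI iffI)
    fix \<omega> assume \<omega>: "\<omega> \<in> ?E"
    let ?s = "({j \<in> I. \<omega> j \<in> B}, {j \<in> I. \<omega> j \<in> B'})"
    have "?s \<in> S" using \<omega> disj by (auto simp: S_def)
    with \<omega> Box_iff[OF this] show "\<omega> \<in> (\<Union>s\<in>S. Box s)" by blast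
  next
    fix \<omega> assume "\<omega> \<in> (\<Union>s\<in>S. Box s)"
    then obtain A A' where s: "(A, A') \<in> S" "\<omega> \<in> Box (A, A')" by auto
    from s(2) Box_iff[OF s(1)] s(1) show "\<omega> \<in> ?E" by (auto simp: S_def)
  qed
  have BoxM: "Box s \<in> sets ?P" for s
    unfolding Box_def using I by (cases s) (auto intro!: sets_PiM_I_finite)
  have "disjoint_family_on Box S"
    unfolding disjoint_family_on_def using Box_iff by (auto 0 3)
  then have "measure ?P ?E = (\<Sum>s\<in>S. measure ?P (Box s))"
    unfolding eq using \<open>finite S\<close> BoxM by (intro P.finite_measure_finite_Union) auto
  also have "\<dots> = (\<Sum>(A, A')\<in>S. prob B ^ card A * prob B' ^ card A' *
      (1 - prob B - prob B') ^ (card I - card A - card A'))"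
  proof (intro sum.cong refl, clarify)
    fix A A' assume s: "(A, A') \<in> S"
    have "measure ?P (Box (A, A')) = (\<Prod>j\<in>I. prob (if j \<in> A then B else if j \<in> A' then B' else space M - B - B'))"
      unfolding Box_def prod.case using I
      by (intro P.prob_times) auto
    also have "\<dots> = (\<Prod>j\<in>I. if j \<in> A then prob B else if j \<in> A' then prob B' else prob (space M - B - B'))"
      by (intro prod.cong) auto
    also have "prob (space M - B - B') = 1 - prob B - prob B'"
    proof -
      have "space M - B - B' = space M - (B \<union> B')" by auto
      then show ?thesis
        using disj by (simp add: prob_compl finite_measure_Union)
    qed
    also have "(\<Prod>j\<in>I. if j \<in> A then prob B else if j \<in> A' then prob B' else 1 - prob B - prob B')
      = prob B ^ card A * prob B' ^ card A' * (1 - prob B - prob B') ^ (card I - card A - card A')"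
      using s I by (intro prod_three_cells) (auto simp: S_def)
    finally show "measure ?P (Box (A, A')) =
      prob B ^ card A * prob B' ^ card A' * (1 - prob B - prob B') ^ (card I - card A - card A')" .
  qed
  also have "\<dots> = (\<Sum>A | A \<subseteq> I \<and> card A < k. \<Sum>A' | A' \<subseteq> I - A \<and> card A' < k.
      prob B ^ card A * prob B' ^ card A' * (1 - prob B - prob B') ^ (card I - card A - card A'))"
    unfolding S_def using I by (intro sum.Sigma[symmetric] ballI fin) auto
  also have "\<dots> = (\<Sum>A | A \<subseteq> I \<and> card A < k. \<Sum>b<k. real ((card I - card A) choose b) *
      (prob B ^ card A * prob B' ^ b * (1 - prob B - prob B') ^ (card I - card A - b)))"
  proof (intro sum.cong refl)
    fix A assume "A \<in> {A. A \<subseteq> I \<and> card A < k}"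
    then have "finite A" "card (I - A) = card I - card A"
      using I by (auto simp: card_Diff_subset finite_subset)
    then show "(\<Sum>A' | A' \<subseteq> I - A \<and> card A' < k.
        prob B ^ card A * prob B' ^ card A' * (1 - prob B - prob B') ^ (card I - card A - card A'))
      = (\<Sum>b<k. real ((card I - card A) choose b) *
      (prob B ^ card A * prob B' ^ b * (1 - prob B - prob B') ^ (card I - card A - b)))"
      using I sum_subsets_by_card[of "I - A", where k = k and g =
        "\<lambda>b. prob B ^ card A * prob B' ^ b * (1 - prob B - prob B') ^ (card I - card A - b)"]
      by simp
  qed
  also have "\<dots> = two_cell_prob k (card I) (prob B) (prob B')"
    unfolding two_cell_prob_def
    using sum_subsets_by_card[OF I, where k = k and g = "\<lambda>a. \<Sum>b<k. real ((card I - a) choose b) *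
      (prob B ^ a * prob B' ^ b * (1 - prob B - prob B') ^ (card I - a - b))"]
    by (simp add: sum_distrib_left mult.assoc)
  finally show ?thesis .
qed

text \<open>By the absorption identities, the quotient for \<open>Suc a\<close> is the quotient for
  \<open>a\<close> times \<open>(1 - a / n) / Suc a\<close>.\<close>

lemma binomial_over_power_tendsto:
  "(\<lambda>n. real (n choose a) / real n ^ a) \<longlonglongrightarrow> 1 / fact a"
proof (induction a)
  case (Suc a)
  have "(\<lambda>n. 1 - real a / real n) \<longlonglongrightarrow> 1 - 0"
    by (intro tendsto_intros lim_const_over_n)
  from tendsto_mult[OF Suc this]
  have "(\<lambda>n. real (n choose a) / real n ^ a * (1 - real a / real n) / real (Suc a))
      \<longlonglongrightarrow> 1 / fact a * (1 - 0) / real (Suc a)"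
    by (intro tendsto_divide) auto
  also have "1 / fact a * (1 - 0) / real (Suc a) = 1 / fact (Suc a)" by (simp add: field_simps)
  finally show ?case
  proof (rule Lim_transform_eventually)
    show "\<forall>\<^sub>F n in sequentially. real (n choose a) / real n ^ a * (1 - real a / real n) / real (Suc a)
        = real (n choose Suc a) / real n ^ Suc a"
      using eventually_gt_at_top[of a]
    proof eventually_elim
      case (elim n)
      have "Suc a * (n choose Suc a) = (n - a) * (n choose a)"
        by (simp only: binomial_absorption binomial_absorb_comp)
      then have "real (Suc a) * real (n choose Suc a) = (real n - real a) * real (n choose a)"
        using elim by (metis of_nat_diff of_nat_mult less_imp_le)
      then have 1: "real (n choose Suc a) = (real n - real a) * real (n choose a) / real (Suc a)"
        by (simp add: field_simps del: of_nat_Suc)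
      have 2: "1 - real a / real n = (real n - real a) / real n"
        using elim by (simp add: field_simps)
      show ?case unfolding 1 2 by (simp add: mult_ac del: of_nat_Suc)
    qed
  qed
qed simp

text \<open>Only the rate of \<open>n * Q n\<close> is known, so the power is squeezed: exp (- Q /
  (1 - Q)) \<le> 1 - Q \<le> exp (- Q), raised to the power n. The vanishing of \<open>Q\<close> is
  recorded as well, for later shifts of the number of trials.\<close>

lemma one_minus_power_tendsto_exp:
  fixes Q :: "nat \<Rightarrow> real"
  assumes Q: "\<And>n. 0 \<le> Q n" and lim: "(\<lambda>n. real n * Q n) \<longlonglongrightarrow> \<mu>"
  shows "(\<lambda>n. (1 - Q n) ^ n) \<longlonglongrightarrow> exp (- \<mu>)" "Q \<longlonglongrightarrow> 0"
proof -
  have "(\<lambda>n. real n * Q n * (1 / real n)) \<longlonglongrightarrow> \<mu> * 0"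
    by (intro tendsto_mult lim lim_const_over_n)
  moreover have "\<forall>\<^sub>F n in sequentially. real n * Q n * (1 / real n) = Q n"
    using eventually_gt_at_top[of 0] by eventually_elim simp
  ultimately have "Q \<longlonglongrightarrow> \<mu> * 0"
    by (rule Lim_transform_eventually)
  then show Q0: "Q \<longlonglongrightarrow> 0" by simp
  then have ev: "\<forall>\<^sub>F n in sequentially. Q n < 1"
    by (rule order_tendstoD) simp
  have "(\<lambda>n. exp (- (real n * Q n / (1 - Q n)))) \<longlonglongrightarrow> exp (- (\<mu> / (1 - 0)))"
    by (intro tendsto_intros lim Q0) simp
  then have lower: "(\<lambda>n. exp (- (real n * Q n / (1 - Q n)))) \<longlonglongrightarrow> exp (- \<mu>)" by simp
  have upper: "(\<lambda>n. exp (- (real n * Q n))) \<longlonglongrightarrow> exp (- \<mu>)"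
    by (intro tendsto_intros lim)
  show "(\<lambda>n. (1 - Q n) ^ n) \<longlonglongrightarrow> exp (- \<mu>)"
  proof (rule real_tendsto_sandwich[OF _ _ lower upper])
    show "\<forall>\<^sub>F n in sequentially. exp (- (real n * Q n / (1 - Q n))) \<le> (1 - Q n) ^ n"
      using ev
    proof eventually_elim
      case (elim n)
      have "1 / (1 - Q n) = 1 + Q n / (1 - Q n)" using elim by (simp add: field_simps)
      also have "\<dots> \<le> exp (Q n / (1 - Q n))" by (rule exp_ge_add_one_self)
      finally have "exp (- (Q n / (1 - Q n))) \<le> 1 - Q n"
        using elim by (simp add: exp_minus field_simps)
      then have "exp (- (Q n / (1 - Q n))) ^ n \<le> (1 - Q n) ^ n"
        by (intro power_mono) auto
      then show ?case by (simp add: exp_of_nat_mult[symmetric])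
    qed
    show "\<forall>\<^sub>F n in sequentially. (1 - Q n) ^ n \<le> exp (- (real n * Q n))"
      using ev
    proof eventually_elim
      case (elim n)
      have "1 - Q n \<le> exp (- Q n)" using exp_ge_add_one_self[of "- Q n"] by simp
      then have "(1 - Q n) ^ n \<le> exp (- Q n) ^ n"
        using elim by (intro power_mono) auto
      then show ?case by (simp add: exp_of_nat_mult[symmetric])
    qed
  qed
qed

text \<open>Probability that a Poisson variable of mean \<open>l\<close> is strictly below
  \<open>k\<close>, that is, its distribution function at \<open>k - 1\<close>.\<close>

definition poisson_cdf :: "nat \<Rightarrow> real \<Rightarrow> real" where
  "poisson_cdf k l = (\<Sum>a<k. l ^ a * exp (- l) / fact a)"

text \<open>Asymptotic independence arises because the third cell contributes exp (- (l + l')),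
  which factorises, while the coupling of the two binomial coefficients through \<open>n - a\<close>
  disappears in the limit.\<close>

lemma two_cell_prob_tendsto:
  fixes P Q :: "nat \<Rightarrow> real"
  assumes P: "\<And>n. 0 \<le> P n" and Q: "\<And>n. 0 \<le> Q n"
    and limP: "(\<lambda>n. real n * P n) \<longlonglongrightarrow> l" and limQ: "(\<lambda>n. real n * Q n) \<longlonglongrightarrow> l'"
  shows "(\<lambda>n. two_cell_prob k n (P n) (Q n)) \<longlonglongrightarrow> poisson_cdf k l * poisson_cdf k l'"
proof -
  have sum_lim: "(\<lambda>n. real n * (P n + Q n)) \<longlonglongrightarrow> l + l'"
    using tendsto_add[OF limP limQ] by (simp add: algebra_simps)
  have pw: "(\<lambda>n. (1 - (P n + Q n)) ^ n) \<longlonglongrightarrow> exp (- (l + l'))" and z: "(\<lambda>n. P n + Q n) \<longlonglongrightarrow> 0"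
    using one_minus_power_tendsto_exp[OF _ sum_lim] P Q by (auto intro: add_nonneg_nonneg)
  have ev: "\<forall>\<^sub>F n in sequentially. P n + Q n < 1"
    using z by (rule order_tendstoD) simp
  have term_lim: "(\<lambda>n. real (n choose a) * real ((n - a) choose b) *
      (P n ^ a * Q n ^ b * (1 - P n - Q n) ^ (n - a - b)))
      \<longlonglongrightarrow> (l ^ a * exp (- l) / fact a) * (l' ^ b * exp (- l') / fact b)" for a b
  proof -
    have shift: "filterlim (\<lambda>n. n - a) sequentially sequentially"
      by (rule filterlim_minus_const_nat_at_top)
    have b1: "(\<lambda>n. real ((n - a) choose b) / real (n - a) ^ b) \<longlonglongrightarrow> 1 / fact b"
      by (rule filterlim_compose[OF binomial_over_power_tendsto shift])
    have b2: "(\<lambda>n. (1 - real a / real n) ^ b) \<longlonglongrightarrow> (1 - 0) ^ b"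
      by (intro tendsto_intros lim_const_over_n)
    have b3: "(\<lambda>n. (1 - (P n + Q n)) ^ n / (1 - (P n + Q n)) ^ (a + b))
        \<longlonglongrightarrow> exp (- (l + l')) / (1 - 0) ^ (a + b)"
      by (intro tendsto_divide pw tendsto_power tendsto_diff tendsto_const z) simp
    \<comment> \<open>The summand is regrouped so that every power of \<open>n\<close> sits in a
      convergent factor; \<open>(1 - real a / real n) ^ b\<close> exchanges the normalisation by
      \<open>n - a\<close> for one by \<open>n\<close>.\<close>
    have "(\<lambda>n. real (n choose a) / real n ^ a *
        (real ((n - a) choose b) / real (n - a) ^ b * (1 - real a / real n) ^ b) *
        ((real n * P n) ^ a * (real n * Q n) ^ b * ((1 - (P n + Q n)) ^ n / (1 - (P n + Q n)) ^ (a + b))))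
        \<longlonglongrightarrow> 1 / fact a * (1 / fact b * (1 - 0) ^ b) *
        (l ^ a * l' ^ b * (exp (- (l + l')) / (1 - 0) ^ (a + b)))"
      by (rule tendsto_mult[OF tendsto_mult[OF binomial_over_power_tendsto tendsto_mult[OF b1 b2]]
            tendsto_mult[OF tendsto_mult[OF tendsto_power[OF limP] tendsto_power[OF limQ]] b3]])
    also have "1 / fact a * (1 / fact b * (1 - 0) ^ b) *
        (l ^ a * l' ^ b * (exp (- (l + l')) / (1 - 0) ^ (a + b)))
        = (l ^ a * exp (- l) / fact a) * (l' ^ b * exp (- l') / fact b)"
      by (simp add: exp_add[of "- l" "- l'", simplified])
    finally show ?thesis
    proof (rule Lim_transform_eventually)
      show "\<forall>\<^sub>F n in sequentially. real (n choose a) / real n ^ a *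
        (real ((n - a) choose b) / real (n - a) ^ b * (1 - real a / real n) ^ b) *
        ((real n * P n) ^ a * (real n * Q n) ^ b * ((1 - (P n + Q n)) ^ n / (1 - (P n + Q n)) ^ (a + b)))
        = real (n choose a) * real ((n - a) choose b) *
          (P n ^ a * Q n ^ b * (1 - P n - Q n) ^ (n - a - b))"
        using ev eventually_gt_at_top[of "a + b"]
      proof eventually_elim
        case (elim n)
        have 1: "(1 - (P n + Q n)) ^ n / (1 - (P n + Q n)) ^ (a + b) = (1 - P n - Q n) ^ (n - a - b)"
          using elim by (simp add: power_diff diff_diff_eq)
        have 2: "1 - real a / real n = real (n - a) / real n"
          using elim by (simp add: field_simps of_nat_diff)
        have 3: "real (n - a) ^ b \<noteq> 0" "real n \<noteq> 0" using elim by auto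
        show ?case unfolding 1 2 using 3
          by (simp add: power_mult_distrib power_divide)
      qed
    qed
  qed
  have "(\<lambda>n. two_cell_prob k n (P n) (Q n)) \<longlonglongrightarrow>
    (\<Sum>a<k. \<Sum>b<k. (l ^ a * exp (- l) / fact a) * (l' ^ b * exp (- l') / fact b))"
    unfolding two_cell_prob_def by (intro tendsto_sum term_lim)
  then show ?thesis by (simp add: poisson_cdf_def sum_product)
qed

section \<open>Asymptotic independence at two sample points\<close>

text \<open>A real sum of indicators instead of a cardinality makes measurability in the sample
  immediate. In terms of order statistics, the condition says that the \<open>k\<close>th smallest
  distance from \<open>x\<close> exceeds \<open>r\<close>.\<close>

definition few :: "nat \<Rightarrow> nat set \<Rightarrow> (nat \<Rightarrow> 'a::metric_space) \<Rightarrow> 'a \<Rightarrow> real \<Rightarrow> bool" where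
  "few k J X x r \<longleftrightarrow> (\<Sum>j\<in>J. if dist x (X j) \<le> r then 1 else 0 :: real) < real k"

lemma few_iff_card:
  assumes "finite J"
  shows "few k J X x r \<longleftrightarrow> card {j\<in>J. X j \<in> cball x r} < k"
proof -
  have "(\<Sum>j\<in>J. if dist x (X j) \<le> r then 1 else 0 :: real) = real (card {j\<in>J. X j \<in> cball x r})"
    using assms by (simp add: sum.If_cases Int_def)
  then show ?thesis by (simp add: few_def)
qed

lemma few_neg:
  assumes "r < 0" "0 < k"
  shows "few k J X x r"
proof -
  have "\<not> dist x (X j) \<le> r" for j
    using assms(1) zero_le_dist[of x "X j"] by linarith
  then show ?thesis using assms(2) by (simp add: few_def)
qed

text \<open>For large enough samples this indicates that the \<open>k\<close>th neighbour distances
  of the \<open>i\<close>-th point of \<open>X\<close> exceed \<open>r\<close> within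
  \<open>X\<close> and \<open>s\<close> within \<open>Y\<close>; the point is left out of its own
  count.\<close>

definition hit :: "nat \<Rightarrow> nat \<Rightarrow> nat \<Rightarrow> real \<Rightarrow> real \<Rightarrow> nat \<Rightarrow>
    (nat \<Rightarrow> 'a::metric_space) \<times> (nat \<Rightarrow> 'a) \<Rightarrow> real" where
  "hit k n m r s i = (\<lambda>(X, Y). if few k ({..<n} - {i}) X (X i) r \<and> few k {..<m} Y (X i) s then 1 else 0)"

text \<open>With radius -1 the condition on a sample point is vacuous, so expectations of one indicator
  are the special case of expectations of a product of two.\<close>
lemma hit_neg: "0 < k \<Longrightarrow> hit k n m (-1) (-1) i w = 1"
  by (auto simp: hit_def few_neg split: prod.split)

text \<open>Distance between the joint void probabilities at two points and their Poisson limit; when the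
  balls may meet, or one may contain the other centre, the trivial bound 1 is used.\<close>
definition dev :: "'a::metric_space measure \<Rightarrow> nat \<Rightarrow> nat \<Rightarrow> real \<Rightarrow> real \<Rightarrow> ('a \<Rightarrow> real) \<Rightarrow> ('a \<Rightarrow> real) \<Rightarrow>
    'a \<times> 'a \<Rightarrow> real" where
  "dev \<mu> k n r r' l l' = (\<lambda>(x, y). if dist x y \<le> max r 0 + max r' 0 then 1
     else \<bar>two_cell_prob k n (measure \<mu> (cball x r)) (measure \<mu> (cball y r')) - l x * l' y\<bar>)"

lemma measurable_few[measurable]:
  fixes J :: "nat set" and f :: "'b \<Rightarrow> nat \<Rightarrow> 'a::euclidean_space"
  assumes [measurable]: "\<And>j. j \<in> J \<Longrightarrow> (\<lambda>w. f w j) \<in> borel_measurable S" "g \<in> borel_measurable S"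
  shows "Measurable.pred S (\<lambda>w. few k J (f w) (g w) r)"
  unfolding few_def by measurable

lemma poisson_cdf_bounds:
  assumes "0 < k" "0 \<le> l"
  shows "0 \<le> poisson_cdf k l" "poisson_cdf k l \<le> 1"
proof -
  obtain k' where k: "k = Suc k'" using assms gr0_conv_Suc by blast
  \<comment> \<open>Fewer than \<open>k\<close> arrivals by time \<open>l\<close> means that the
    \<open>k\<close>th arrival comes after \<open>l\<close>; the Erlang index counts from 0.\<close>
  have "poisson_cdf k l = 1 - erlang_CDF k' 1 l"
    using assms by (simp add: poisson_cdf_def erlang_CDF_def k lessThan_Suc_atMost)
  then show "poisson_cdf k l \<le> 1" by simp
  show "0 \<le> poisson_cdf k l" using assms by (simp add: poisson_cdf_def sum_nonneg)
qed

lemma poisson_cdf_zero: "0 < k \<Longrightarrow> poisson_cdf k 0 = 1"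
  by (cases k) (simp_all add: poisson_cdf_def lessThan_Suc_eq_insert_0 sum.reindex)

lemma poisson_cdf_measurable[measurable]: "poisson_cdf k \<in> borel_measurable borel"
  unfolding poisson_cdf_def[abs_def] by measurable

text \<open>The distance condition makes the closed balls disjoint, hence two cells of a multinomial
  trial. Clipping the radii at 0 keeps the condition meaningful for the dummy radius -1, whose ball
  is empty.\<close>

lemma prob_few_two_cells:
  fixes M :: "'a::euclidean_space measure"
  assumes M: "prob_space M" and "sets M = sets borel" and "finite J" and d: "dist x y > max r 0 + max r' 0"
  shows "measure (PiM J (\<lambda>_. M)) {\<omega> \<in> space (PiM J (\<lambda>_. M)). few k J \<omega> x r \<and> few k J \<omega> y r'}
    = two_cell_prob k (card J) (measure M (cball x r)) (measure M (cball y r'))"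
proof -
  interpret prob_space M by fact
  have "cball x r \<inter> cball y r' = {}"
  proof (rule ccontr)
    assume "cball x r \<inter> cball y r' \<noteq> {}"
    then obtain z where "dist x z \<le> r" "dist y z \<le> r'" by auto
    then show False using dist_triangle2[of x y z] d by (auto simp: max_def split: if_splits)
  qed
  then show ?thesis
    unfolding few_iff_card[OF assms(3)] using assms(2,3) by (intro prob_cell_counts) auto
qed

lemma measurable_prob_cball:
  fixes M :: "'a::euclidean_space measure"
  assumes "sets M = sets borel" "prob_space M"
  shows "(\<lambda>x. measure M (cball x r)) \<in> borel_measurable borel"
proof -
  interpret prob_space M by fact
  show ?thesis
    using measurable_measure_cball[OF assms(1), of r] sigma_finite_measure_axioms
    by (simp add: measure_def)
qed

section \<open>Conditioning on a pair of sample points\<close>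

locale two_sample = M: prob_space M + N: prob_space N
  for M N :: "'a::euclidean_space measure" +
  assumes sets_M[simp, measurable_cong]: "sets M = sets borel"
    and sets_N[simp, measurable_cong]: "sets N = sets borel"
begin

abbreviation S :: "nat \<Rightarrow> nat \<Rightarrow> ((nat \<Rightarrow> 'a) \<times> (nat \<Rightarrow> 'a)) measure" where
  "S n m \<equiv> PiM {..<n} (\<lambda>_. M) \<Otimes>\<^sub>M PiM {..<m} (\<lambda>_. N)"

lemma space_MN[simp]: "space M = UNIV" "space N = UNIV"
  using sets_eq_imp_space_eq[OF sets_M] sets_eq_imp_space_eq[OF sets_N] by simp_all

lemma prob_space_S: "prob_space (S n m)"
proof -
  interpret PX: product_prob_space "\<lambda>_. M" "{..<n}" ..
  interpret PY: product_prob_space "\<lambda>_. N" "{..<m}" ..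
  interpret P: pair_prob_space "PiM {..<n} (\<lambda>_. M)" "PiM {..<m} (\<lambda>_. N)" ..
  show ?thesis by (rule P.prob_space_axioms)
qed

lemma measurable_hit[measurable]: "i < n \<Longrightarrow> hit k n m r s i \<in> borel_measurable (S n m)"
  unfolding hit_def by measurable

text \<open>Conditional probability of the event about the \<open>X\<close> sample, given that
  points \<open>i\<close> and \<open>i'\<close> sit at \<open>x\<close> and \<open>y\<close>. Both
  are put back into the configuration because each may count as a neighbour of the other.\<close>

definition restX :: "nat \<Rightarrow> nat \<Rightarrow> real \<Rightarrow> real \<Rightarrow> nat \<Rightarrow> nat \<Rightarrow> 'a \<times> 'a \<Rightarrow> ennreal" where
  "restX k n r r' i i' = (\<lambda>(x, y). \<integral>\<^sup>+ z.
     (if few k ({..<n} - {i}) (z(i' := y, i := x)) x r \<and> few k ({..<n} - {i'}) (z(i' := y, i := x)) y r'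
      then 1 else 0) \<partial>PiM ({..<n} - {i, i'}) (\<lambda>_. M))"

definition restY :: "nat \<Rightarrow> nat \<Rightarrow> real \<Rightarrow> real \<Rightarrow> 'a \<times> 'a \<Rightarrow> ennreal" where
  "restY k m s s' = (\<lambda>(x, y). \<integral>\<^sup>+ Y.
     (if few k {..<m} Y x s \<and> few k {..<m} Y y s' then 1 else 0) \<partial>PiM {..<m} (\<lambda>_. N))"

lemma restY_measurable[measurable]: "restY k m s s' \<in> borel_measurable (borel \<Otimes>\<^sub>M borel)"
proof -
  interpret PY: product_prob_space "\<lambda>_. N" "{..<m}" ..
  show ?thesis unfolding restY_def by measurable
qed

lemma restX_measurable[measurable]:
  assumes "i < n" "i' < n" "i \<noteq> i'"
  shows "restX k n r r' i i' \<in> borel_measurable (borel \<Otimes>\<^sub>M borel)"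
proof -
  interpret PX: product_prob_space "\<lambda>_. M" "{..<n} - {i, i'}" ..
  have [measurable]: "(\<lambda>w. ((snd w)(i' := snd (fst w), i := fst (fst w))) j)
      \<in> borel_measurable ((borel \<Otimes>\<^sub>M borel) \<Otimes>\<^sub>M PiM ({..<n} - {i, i'}) (\<lambda>_. M))"
    if "j \<in> {..<n}" for j
    using that by (cases "j = i"; cases "j = i'") (simp_all, measurable)
  have "(\<lambda>w. \<integral>\<^sup>+ z. (if few k ({..<n} - {i}) (z(i' := snd w, i := fst w)) (fst w) r
        \<and> few k ({..<n} - {i'}) (z(i' := snd w, i := fst w)) (snd w) r' then 1 else 0)
      \<partial>PiM ({..<n} - {i, i'}) (\<lambda>_. M)) \<in> borel_measurable (borel \<Otimes>\<^sub>M borel)"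
  proof (rule PX.borel_measurable_nn_integral, unfold split_beta')
    show "(\<lambda>w. if few k ({..<n} - {i}) ((snd w)(i' := snd (fst w), i := fst (fst w))) (fst (fst w)) r
        \<and> few k ({..<n} - {i'}) ((snd w)(i' := snd (fst w), i := fst (fst w))) (snd (fst w)) r' then 1 else 0)
      \<in> borel_measurable ((borel \<Otimes>\<^sub>M borel) \<Otimes>\<^sub>M PiM ({..<n} - {i, i'}) (\<lambda>_. M))"
      by (intro measurable_If measurable_const pred_intros_logic measurable_few[THEN predE] ) auto
  qed
  then show ?thesis by (simp add: restX_def split_beta')
qed

text \<open>Given the two centres, the events about \<open>X\<close> and about \<open>Y\<close> are
  independent, so the \<open>Y\<close> integral comes out as a factor. Fubini then peels the
  coordinates \<open>i\<close> and \<open>i'\<close> off the product measure and leaves the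
  remaining points to \<open>restX\<close>.\<close>

lemma nn_integral_hit_hit:
  assumes i: "i < n" "i' < n" "i \<noteq> i'"
  shows "(\<integral>\<^sup>+ w. ennreal (hit k n m r s i w * hit k n m r' s' i' w) \<partial>S n m)
    = (\<integral>\<^sup>+ w. restX k n r r' i i' w * restY k m s s' w \<partial>(M \<Otimes>\<^sub>M M))"
proof -
  interpret PX: product_prob_space "\<lambda>_. M" "{..<n}" ..
  interpret PY: product_prob_space "\<lambda>_. N" "{..<m}" ..
  let ?R = "{..<n} - {i, i'}"
  interpret PR: product_prob_space "\<lambda>_. M" ?R ..
  define FX where "FX X \<longleftrightarrow> few k ({..<n} - {i}) X (X i) r \<and> few k ({..<n} - {i'}) X (X i') r'" for X :: "nat \<Rightarrow> 'a"
  have FX[measurable]: "Measurable.pred (PiM {..<n} (\<lambda>_. M)) FX"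
  proof -
    have [measurable]: "i \<in> {..<n}" "i' \<in> {..<n}" using i by auto
    show ?thesis unfolding FX_def by measurable
  qed
  have I: "{..<n} = insert i (insert i' ?R)" using i by auto
  have "(\<integral>\<^sup>+ w. ennreal (hit k n m r s i w * hit k n m r' s' i' w) \<partial>S n m)
    = (\<integral>\<^sup>+ X. \<integral>\<^sup>+ Y. ennreal (hit k n m r s i (X, Y) * hit k n m r' s' i' (X, Y))
        \<partial>PiM {..<m} (\<lambda>_. N) \<partial>PiM {..<n} (\<lambda>_. M))"
    using i by (intro PY.nn_integral_fst[symmetric]) measurable
  also have "\<dots> = (\<integral>\<^sup>+ X. (if FX X then 1 else 0) * restY k m s s' (X i, X i') \<partial>PiM {..<n} (\<lambda>_. M))"
  proof (intro nn_integral_cong)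
    fix X assume "X \<in> space (PiM {..<n} (\<lambda>_. M))"
    have "(\<integral>\<^sup>+ Y. ennreal (hit k n m r s i (X, Y) * hit k n m r' s' i' (X, Y)) \<partial>PiM {..<m} (\<lambda>_. N))
      = (\<integral>\<^sup>+ Y. (if FX X then 1 else 0) *
         (if few k {..<m} Y (X i) s \<and> few k {..<m} Y (X i') s' then 1 else 0) \<partial>PiM {..<m} (\<lambda>_. N))"
      by (intro nn_integral_cong) (auto simp: hit_def FX_def)
    also have "\<dots> = (if FX X then 1 else 0) * restY k m s s' (X i, X i')"
      unfolding restY_def prod.case by (intro nn_integral_cmult) measurable
    finally show "(\<integral>\<^sup>+ Y. ennreal (hit k n m r s i (X, Y) * hit k n m r' s' i' (X, Y)) \<partial>PiM {..<m} (\<lambda>_. N))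
      = (if FX X then 1 else 0) * restY k m s s' (X i, X i')" .
  qed
  also have "\<dots> = (\<integral>\<^sup>+ x. \<integral>\<^sup>+ X. (if FX (X(i := x)) then 1 else 0) * restY k m s s' (x, X i')
      \<partial>PiM (insert i' ?R) (\<lambda>_. M) \<partial>M)"
  proof -
    have [measurable]: "Measurable.pred (PiM (insert i (insert i' ?R)) (\<lambda>_. M)) FX"
      using FX I by simp
    show ?thesis
      using i by (subst I, subst PX.product_nn_integral_insert_rev)
        (simp_all del: insert_Diff_single insert_Diff1, measurable)
  qed
  also have "\<dots> = (\<integral>\<^sup>+ x. \<integral>\<^sup>+ y. \<integral>\<^sup>+ z. (if FX (z(i' := y, i := x)) then 1 else 0) * restY k m s s' (x, y)
      \<partial>PiM ?R (\<lambda>_. M) \<partial>M \<partial>M)"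
  proof (intro nn_integral_cong)
    fix x
    have [measurable]: "(\<lambda>X. X(i := x)) \<in> measurable (PiM (insert i' ?R) (\<lambda>_. M)) (PiM {..<n} (\<lambda>_. M))"
      using i by (intro measurable_fun_upd[where J = "insert i' ?R"]) auto
    show "(\<integral>\<^sup>+ X. (if FX (X(i := x)) then 1 else 0) * restY k m s s' (x, X i') \<partial>PiM (insert i' ?R) (\<lambda>_. M))
      = (\<integral>\<^sup>+ y. \<integral>\<^sup>+ z. (if FX (z(i' := y, i := x)) then 1 else 0) * restY k m s s' (x, y)
      \<partial>PiM ?R (\<lambda>_. M) \<partial>M)"
      using i by (subst PX.product_nn_integral_insert_rev) (simp_all del: insert_Diff_single insert_Diff1, measurable)
  qed
  also have "\<dots> = (\<integral>\<^sup>+ x. \<integral>\<^sup>+ y. restX k n r r' i i' (x, y) * restY k m s s' (x, y) \<partial>M \<partial>M)"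
  proof (intro nn_integral_cong)
    fix x y
    have [measurable]: "(\<lambda>z. z(i' := y, i := x)) \<in> measurable (PiM ?R (\<lambda>_. M)) (PiM {..<n} (\<lambda>_. M))"
      using i by (intro measurable_fun_upd[where J = "insert i' ?R"] measurable_fun_upd[where J = ?R]) auto
    have "(\<integral>\<^sup>+ z. (if FX (z(i' := y, i := x)) then 1 else 0) * restY k m s s' (x, y) \<partial>PiM ?R (\<lambda>_. M))
      = (\<integral>\<^sup>+ z. (if FX (z(i' := y, i := x)) then 1 else 0) \<partial>PiM ?R (\<lambda>_. M)) * restY k m s s' (x, y)"
      by (intro nn_integral_multc) measurable
    also have "(\<integral>\<^sup>+ z. (if FX (z(i' := y, i := x)) then 1 else 0) \<partial>PiM ?R (\<lambda>_. M)) = restX k n r r' i i' (x, y)"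
      using i by (simp add: restX_def FX_def)
    finally show "(\<integral>\<^sup>+ z. (if FX (z(i' := y, i := x)) then 1 else 0) * restY k m s s' (x, y) \<partial>PiM ?R (\<lambda>_. M))
      = restX k n r r' i i' (x, y) * restY k m s s' (x, y)" .
  qed
  also have "\<dots> = (\<integral>\<^sup>+ w. restX k n r r' i i' w * restY k m s s' w \<partial>(M \<Otimes>\<^sub>M M))"
    using i by (intro M.nn_integral_fst) measurable
  finally show ?thesis .
qed

lemma restY_eq:
  assumes "dist x y > max s 0 + max s' 0"
  shows "restY k m s s' (x, y) = ennreal (two_cell_prob k m (N.prob (cball x s)) (N.prob (cball y s')))"
proof -
  interpret PY: product_prob_space "\<lambda>_. N" "{..<m}" ..
  have "restY k m s s' (x, y) = (\<integral>\<^sup>+ Y. indicator {Y \<in> space (PiM {..<m} (\<lambda>_. N)).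
      few k {..<m} Y x s \<and> few k {..<m} Y y s'} Y \<partial>PiM {..<m} (\<lambda>_. N))"
    unfolding restY_def prod.case by (intro nn_integral_cong) auto
  also have "\<dots> = emeasure (PiM {..<m} (\<lambda>_. N)) {Y \<in> space (PiM {..<m} (\<lambda>_. N)).
      few k {..<m} Y x s \<and> few k {..<m} Y y s'}"
    by (intro nn_integral_indicator) measurable
  finally show ?thesis
    using prob_few_two_cells[OF N.prob_space_axioms sets_N _ assms, of "{..<m}" k] by (simp add: PY.emeasure_eq_measure)
qed

text \<open>For distant centres neither ball contains the other centre, so only the remaining
  \<open>n - 2\<close> points are counted. Because both radii are clipped at 0, this holds even when
  one of them is negative.\<close>

lemma restX_eq:
  assumes i: "i < n" "i' < n" "i \<noteq> i'" and d: "dist x y > max r 0 + max r' 0"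
  shows "restX k n r r' i i' (x, y)
    = ennreal (two_cell_prob k (n - 2) (M.prob (cball x r)) (M.prob (cball y r')))"
proof -
  let ?R = "{..<n} - {i, i'}"
  interpret PX: product_prob_space "\<lambda>_. M" ?R ..
  have far: "\<not> dist x y \<le> r" "\<not> dist y x \<le> r'"
    using d max.cobounded1[of r 0] max.cobounded2[of 0 r] max.cobounded1[of r' 0] max.cobounded2[of 0 r']
    unfolding dist_commute[of y x] by linarith+
  have 1: "few k ({..<n} - {i}) (z(i' := y, i := x)) x r \<longleftrightarrow> few k ?R z x r" for z
  proof -
    have "(\<Sum>j\<in>{..<n} - {i}. if dist x ((z(i' := y, i := x)) j) \<le> r then 1 else 0 :: real)
      = (\<Sum>j\<in>?R. if dist x (z j) \<le> r then 1 else 0)"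
      using i far by (intro sum.mono_neutral_cong_right) auto
    then show ?thesis by (simp add: few_def)
  qed
  have 2: "few k ({..<n} - {i'}) (z(i' := y, i := x)) y r' \<longleftrightarrow> few k ?R z y r'" for z
  proof -
    have "(\<Sum>j\<in>{..<n} - {i'}. if dist y ((z(i' := y, i := x)) j) \<le> r' then 1 else 0 :: real)
      = (\<Sum>j\<in>?R. if dist y (z j) \<le> r' then 1 else 0)"
      using i far by (intro sum.mono_neutral_cong_right) auto
    then show ?thesis by (simp add: few_def)
  qed
  have "restX k n r r' i i' (x, y) = (\<integral>\<^sup>+ z. indicator {z \<in> space (PiM ?R (\<lambda>_. M)).
      few k ?R z x r \<and> few k ?R z y r'} z \<partial>PiM ?R (\<lambda>_. M))"
    unfolding restX_def prod.case 1 2 by (intro nn_integral_cong) auto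
  also have "\<dots> = emeasure (PiM ?R (\<lambda>_. M)) {z \<in> space (PiM ?R (\<lambda>_. M)).
      few k ?R z x r \<and> few k ?R z y r'}"
    by (intro nn_integral_indicator) measurable
  also have "\<dots> = ennreal (two_cell_prob k (card ?R) (M.prob (cball x r)) (M.prob (cball y r')))"
    using prob_few_two_cells[OF M.prob_space_axioms sets_M _ d, of ?R k] by (simp add: PX.emeasure_eq_measure)
  also have "card ?R = n - 2"
    using i by (subst card_Diff_subset) auto
  finally show ?thesis .
qed

lemma restX_le_1: "restX k n r r' i i' w \<le> 1"
proof -
  let ?R = "{..<n} - {i, i'}"
  interpret PX: product_prob_space "\<lambda>_. M" ?R ..
  have "restX k n r r' i i' w \<le> (\<integral>\<^sup>+ z. 1 \<partial>PiM ?R (\<lambda>_. M))"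
    unfolding restX_def split_beta by (intro nn_integral_mono) auto
  then show ?thesis by (simp add: PX.emeasure_space_1)
qed

lemma restY_le_1: "restY k m s s' w \<le> 1"
proof -
  interpret PY: product_prob_space "\<lambda>_. N" "{..<m}" ..
  have "restY k m s s' w \<le> (\<integral>\<^sup>+ z. 1 \<partial>PiM {..<m} (\<lambda>_. N))"
    unfolding restY_def split_beta by (intro nn_integral_mono) auto
  then show ?thesis by (simp add: PY.emeasure_space_1)
qed

lemma pair_prob_space_MM: "pair_prob_space M M" ..

end

lemma two_cell_prob_measurable:
  "f \<in> borel_measurable R \<Longrightarrow> g \<in> borel_measurable R \<Longrightarrow>
    (\<lambda>w. two_cell_prob k n (f w) (g w)) \<in> borel_measurable R"
  unfolding two_cell_prob_def
  by (intro borel_measurable_sum borel_measurable_times borel_measurable_power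
      borel_measurable_diff borel_measurable_const)

lemma dev_measurable[measurable]:
  fixes \<mu> :: "'a::euclidean_space measure"
  assumes [measurable]: "l \<in> borel_measurable borel" "l' \<in> borel_measurable borel"
    and "\<And>r. (\<lambda>x. measure \<mu> (cball x r)) \<in> borel_measurable borel"
  shows "dev \<mu> k n r r' l l' \<in> borel_measurable (borel \<Otimes>\<^sub>M borel)"
proof -
  have [measurable]: "(\<lambda>w. measure \<mu> (cball (fst w) r)) \<in> borel_measurable (borel \<Otimes>\<^sub>M borel)"
    "(\<lambda>w. measure \<mu> (cball (snd w) r)) \<in> borel_measurable (borel \<Otimes>\<^sub>M borel)" for r
    by (rule measurable_compose[OF measurable_fst assms(3)],
        rule measurable_compose[OF measurable_snd assms(3)])
  have [measurable]: "Measurable.pred (borel \<Otimes>\<^sub>M borel) (\<lambda>w::'a \<times> 'a. dist (fst w) (snd w) \<le> c)" for c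
    by measurable
  have "(\<lambda>w. two_cell_prob k n (measure \<mu> (cball (fst w) r)) (measure \<mu> (cball (snd w) r')))
      \<in> borel_measurable (borel \<Otimes>\<^sub>M borel)"
    by (intro two_cell_prob_measurable) measurable
  moreover have "(\<lambda>w. l (fst w) * l' (snd w)) \<in> borel_measurable (borel \<Otimes>\<^sub>M borel)"
    by measurable
  ultimately show ?thesis unfolding dev_def split_beta'
    by (intro measurable_If borel_measurable_abs borel_measurable_diff) simp_all
qed

lemma abs_diff_unit_interval_le_1:
  fixes a b :: real
  assumes "0 \<le> a" "a \<le> 1" "0 \<le> b" "b \<le> 1"
  shows "\<bar>a - b\<bar> \<le> 1"
  using assms by linarith

lemma mult_unit_interval:
  fixes a b :: real
  assumes "0 \<le> a" "a \<le> 1" "0 \<le> b" "b \<le> 1"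
  shows "0 \<le> a * b" "a * b \<le> 1"
  using assms by (auto intro: mult_le_one)

text \<open>In the far branch \<open>two_cell_prob\<close> is recognised as the probability of an
  event for \<open>n\<close> independent points; its formula does not display the bound by
  1.\<close>

lemma dev_bounds:
  fixes \<mu> :: "'a::euclidean_space measure"
  assumes \<mu>: "prob_space \<mu>" "sets \<mu> = sets borel"
    and l: "\<And>x. 0 \<le> l x" "\<And>x. l x \<le> 1" and l': "\<And>x. 0 \<le> l' x" "\<And>x. l' x \<le> 1"
  shows "0 \<le> dev \<mu> k n r r' l l' w" "dev \<mu> k n r r' l l' w \<le> 1"
proof -
  interpret prob_space \<mu> by fact
  interpret P: product_prob_space "\<lambda>_. \<mu>" "{..<n}" ..
  obtain x y where w: "w = (x, y)" by (cases w)
  show "0 \<le> dev \<mu> k n r r' l l' w" by (simp add: dev_def w)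
  show "dev \<mu> k n r r' l l' w \<le> 1"
  proof (cases "dist x y \<le> max r 0 + max r' 0")
    case False
    then have "two_cell_prob k n (prob (cball x r)) (prob (cball y r')) \<in> {0..1}"
      using prob_few_two_cells[OF \<mu>, of "{..<n}" r r' x y k, symmetric] by (auto simp: not_le)
    then show ?thesis
      using False l l' by (auto simp: dev_def w intro!: abs_diff_unit_interval_le_1 mult_unit_interval)
  qed (simp add: dev_def w)
qed

context two_sample
begin

lemma dev_integrable:
  assumes \<mu>: "prob_space \<mu>" "sets \<mu> = sets borel"
    and [measurable]: "l \<in> borel_measurable borel" "l' \<in> borel_measurable borel"
    and l: "\<And>x. 0 \<le> l x" "\<And>x. l x \<le> 1" and l': "\<And>x. 0 \<le> l' x" "\<And>x. l' x \<le> 1"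
  shows "integrable (M \<Otimes>\<^sub>M M) (dev \<mu> k n r r' l l')"
proof -
  interpret P: pair_prob_space M M by (rule pair_prob_space_MM)
  have [measurable]: "(\<lambda>x. measure \<mu> (cball x r)) \<in> borel_measurable borel" for r
    by (rule measurable_prob_cball[OF \<mu>(2,1)])
  show ?thesis
    using dev_bounds[OF \<mu> l l'] by (intro P.P.integrable_const_bound[where B = 1]) auto
qed

text \<open>After conditioning, the expectation is an integral over the pair of centres, and so is
  the product of the two integrals, by independence of the centres. For numbers in [0, 1] one has
  |ab - cd| \<le> |a - c| + |b - d|, so the error separates into one term for the \<open>X\<close>
  sample and one for the \<open>Y\<close> sample; this is what permits a joint limit without
  relating the sample sizes.\<close>

lemma pair_bound:
  assumes i: "i < n" "i' < n" "i \<noteq> i'"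
    and [measurable]: "l \<in> borel_measurable borel" "l' \<in> borel_measurable borel"
      "h \<in> borel_measurable borel" "h' \<in> borel_measurable borel"
    and l: "\<And>x. 0 \<le> l x" "\<And>x. l x \<le> 1" and l': "\<And>x. 0 \<le> l' x" "\<And>x. l' x \<le> 1"
    and h: "\<And>x. 0 \<le> h x" "\<And>x. h x \<le> 1" and h': "\<And>x. 0 \<le> h' x" "\<And>x. h' x \<le> 1"
  shows "\<bar>(\<integral>w. hit k n m r s i w * hit k n m r' s' i' w \<partial>S n m)
      - (\<integral>x. l x * h x \<partial>M) * (\<integral>x. l' x * h' x \<partial>M)\<bar>
    \<le> (\<integral>w. dev M k (n - 2) r r' l l' w \<partial>(M \<Otimes>\<^sub>M M)) + (\<integral>w. dev N k m s s' h h' w \<partial>(M \<Otimes>\<^sub>M M))"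
proof -
  interpret P: pair_prob_space M M by (rule pair_prob_space_MM)
  define a where "a w = enn2real (restX k n r r' i i' w)" for w
  define b where "b w = enn2real (restY k m s s' w)" for w
  have a: "restX k n r r' i i' w = ennreal (a w)" "0 \<le> a w" "a w \<le> 1" for w
  proof -
    have "restX k n r r' i i' w < top"
      using restX_le_1 by (rule order_le_less_trans) simp
    then show *: "restX k n r r' i i' w = ennreal (a w)" "0 \<le> a w" by (simp_all add: a_def)
    show "a w \<le> 1" using restX_le_1[of k n r r' i i' w] by (simp add: *)
  qed
  have b: "restY k m s s' w = ennreal (b w)" "0 \<le> b w" "b w \<le> 1" for w
  proof -
    have "restY k m s s' w < top"
      using restY_le_1 by (rule order_le_less_trans) simp
    then show *: "restY k m s s' w = ennreal (b w)" "0 \<le> b w" by (simp_all add: b_def)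
    show "b w \<le> 1" using restY_le_1[of k m s s' w] by (simp add: *)
  qed
  have [measurable]: "a \<in> borel_measurable (borel \<Otimes>\<^sub>M borel)" "b \<in> borel_measurable (borel \<Otimes>\<^sub>M borel)"
    unfolding a_def b_def using i by measurable
  have "(\<integral>w. hit k n m r s i w * hit k n m r' s' i' w \<partial>S n m)
    = enn2real (\<integral>\<^sup>+w. ennreal (hit k n m r s i w * hit k n m r' s' i' w) \<partial>S n m)"
    using i by (intro integral_eq_nn_integral) (measurable, auto simp: hit_def split: prod.split)
  also have "(\<integral>\<^sup>+w. ennreal (hit k n m r s i w * hit k n m r' s' i' w) \<partial>S n m)
    = (\<integral>\<^sup>+w. ennreal (a w * b w) \<partial>(M \<Otimes>\<^sub>M M))"
    unfolding nn_integral_hit_hit[OF i] by (intro nn_integral_cong) (simp add: a b ennreal_mult)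
  also have "enn2real \<dots> = (\<integral>w. a w * b w \<partial>(M \<Otimes>\<^sub>M M))"
    by (intro integral_eq_nn_integral[symmetric]) (measurable, simp add: a b)
  finally have E: "(\<integral>w. hit k n m r s i w * hit k n m r' s' i' w \<partial>S n m) = (\<integral>w. a w * b w \<partial>(M \<Otimes>\<^sub>M M))" .
  let ?g = "\<lambda>w. (l (fst w) * l' (snd w)) * (h (fst w) * h' (snd w))"
  have int_g: "integrable (M \<Otimes>\<^sub>M M) ?g"
    using l l' h h' by (intro P.P.integrable_const_bound[where B = 1])
      (auto intro!: AE_I2 mult_unit_interval simp: abs_of_nonneg)
  have int_ab: "integrable (M \<Otimes>\<^sub>M M) (\<lambda>w. a w * b w)"
    using a b by (intro P.P.integrable_const_bound[where B = 1])
      (auto intro!: AE_I2 mult_unit_interval simp: abs_of_nonneg)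
  have "(\<integral>w. ?g w \<partial>(M \<Otimes>\<^sub>M M)) = (\<integral>x. \<integral>y. ?g (x, y) \<partial>M \<partial>M)"
    using int_g by (rule P.integral_fst'[symmetric])
  also have "\<dots> = (\<integral>x. \<integral>y. (l x * h x) * (l' y * h' y) \<partial>M \<partial>M)"
    by (simp add: mult_ac)
  also have "\<dots> = (\<integral>x. l x * h x \<partial>M) * (\<integral>x. l' x * h' x \<partial>M)" by simp
  finally have G: "(\<integral>x. l x * h x \<partial>M) * (\<integral>x. l' x * h' x \<partial>M) = (\<integral>w. ?g w \<partial>(M \<Otimes>\<^sub>M M))" ..
  have devX: "\<bar>a w - l (fst w) * l' (snd w)\<bar> \<le> dev M k (n - 2) r r' l l' w" for w
  proof (cases "dist (fst w) (snd w) \<le> max r 0 + max r' 0")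
    case True
    then show ?thesis using l l' a[of w]
      by (auto simp: dev_def split_beta intro!: abs_diff_unit_interval_le_1 mult_unit_interval)
  next
    case False
    then have far: "max r 0 + max r' 0 < dist (fst w) (snd w)" by simp
    have "0 \<le> two_cell_prob k (n - 2) (M.prob (cball (fst w) r)) (M.prob (cball (snd w) r'))"
      using prob_few_two_cells[OF M.prob_space_axioms sets_M _ far, of "{..<n-2}" k, symmetric] by simp
    with restX_eq[OF i far] False show ?thesis by (simp add: dev_def a_def split_beta)
  qed
  have devY: "\<bar>b w - h (fst w) * h' (snd w)\<bar> \<le> dev N k m s s' h h' w" for w
  proof (cases "dist (fst w) (snd w) \<le> max s 0 + max s' 0")
    case True
    then show ?thesis using h h' b[of w]
      by (auto simp: dev_def split_beta intro!: abs_diff_unit_interval_le_1 mult_unit_interval)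
  next
    case False
    then have far: "max s 0 + max s' 0 < dist (fst w) (snd w)" by simp
    have "0 \<le> two_cell_prob k m (N.prob (cball (fst w) s)) (N.prob (cball (snd w) s'))"
      using prob_few_two_cells[OF N.prob_space_axioms sets_N _ far, of "{..<m}" k, symmetric] by simp
    with restY_eq[OF far] False show ?thesis by (simp add: dev_def b_def split_beta)
  qed
  have iX: "integrable (M \<Otimes>\<^sub>M M) (dev M k (n - 2) r r' l l')"
    using l l' by (intro dev_integrable) (simp_all add: M.prob_space_axioms)
  have iY: "integrable (M \<Otimes>\<^sub>M M) (dev N k m s s' h h')"
    using h h' by (intro dev_integrable) (simp_all add: N.prob_space_axioms)
  have "\<bar>(\<integral>w. a w * b w \<partial>(M \<Otimes>\<^sub>M M)) - (\<integral>w. ?g w \<partial>(M \<Otimes>\<^sub>M M))\<bar>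
    = \<bar>\<integral>w. a w * b w - ?g w \<partial>(M \<Otimes>\<^sub>M M)\<bar>"
    using int_g int_ab by simp
  also have "\<dots> \<le> (\<integral>w. \<bar>a w * b w - ?g w\<bar> \<partial>(M \<Otimes>\<^sub>M M))"
    by (rule integral_abs_bound)
  also have "\<dots> \<le> (\<integral>w. dev M k (n - 2) r r' l l' w + dev N k m s s' h h' w \<partial>(M \<Otimes>\<^sub>M M))"
  proof (intro integral_mono)
    fix w
    have "\<bar>a w * b w - ?g w\<bar> \<le> \<bar>a w - l (fst w) * l' (snd w)\<bar> + \<bar>b w - h (fst w) * h' (snd w)\<bar>"
    proof -
      let ?c = "l (fst w) * l' (snd w)" and ?d = "h (fst w) * h' (snd w)"
      have "a w * b w - ?c * ?d = (a w - ?c) * b w + ?c * (b w - ?d)" by (simp add: algebra_simps)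
      then have "\<bar>a w * b w - ?c * ?d\<bar> \<le> \<bar>a w - ?c\<bar> * \<bar>b w\<bar> + \<bar>?c\<bar> * \<bar>b w - ?d\<bar>"
        by (metis abs_mult abs_triangle_ineq)
      also have "\<dots> \<le> \<bar>a w - ?c\<bar> * 1 + 1 * \<bar>b w - ?d\<bar>"
        using b l l' mult_unit_interval[of "l (fst w)" "l' (snd w)"]
        by (intro add_mono mult_left_mono mult_right_mono) auto
      finally show ?thesis by simp
    qed
    then show "\<bar>a w * b w - ?g w\<bar> \<le> dev M k (n - 2) r r' l l' w + dev N k m s s' h h' w"
      using devX[of w] devY[of w] by linarith
  qed (use iX iY int_g int_ab in auto)
  also have "\<dots> = (\<integral>w. dev M k (n - 2) r r' l l' w \<partial>(M \<Otimes>\<^sub>M M)) + (\<integral>w. dev N k m s s' h h' w \<partial>(M \<Otimes>\<^sub>M M))"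
    using iX iY by simp
  finally show ?thesis unfolding E G .
qed

end

section \<open>Mean-square convergence of threshold frequencies\<close>

definition hit_frac :: "nat \<Rightarrow> nat \<Rightarrow> nat \<Rightarrow> real \<Rightarrow> real \<Rightarrow> 
    (nat \<Rightarrow> 'a::metric_space) \<times> (nat \<Rightarrow> 'a) \<Rightarrow> real" where
  "hit_frac k n m r s w = (\<Sum>i<n. hit k n m r s i w) / real n"

lemma hit_bounds: "0 \<le> hit k n m r s i w" "hit k n m r s i w \<le> 1"
  by (auto simp: hit_def split: prod.split)

lemma hit_frac_bounds: "0 \<le> hit_frac k n m r s w" "hit_frac k n m r s w \<le> 1"
proof -
  show "0 \<le> hit_frac k n m r s w" by (simp add: hit_frac_def sum_nonneg hit_bounds)
  have "(\<Sum>i<n. hit k n m r s i w) \<le> (\<Sum>i<n. 1)"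
    by (intro sum_mono hit_bounds)
  then have "(\<Sum>i<n. hit k n m r s i w) \<le> real n" by simp
  then show "hit_frac k n m r s w \<le> 1" by (auto simp: hit_frac_def divide_le_eq_1)
qed

context two_sample
begin

lemma AE_fst: "AE x in M. Q x \<Longrightarrow> AE w in M \<Otimes>\<^sub>M M. Q (fst w)"
proof -
  assume Q: "AE x in M. Q x"
  interpret P: pair_prob_space M M by (rule pair_prob_space_MM)
  have "distr (M \<Otimes>\<^sub>M M) M fst = M"
    by (simp add: M.distr_pair_fst)
  with Q have "AE x in distr (M \<Otimes>\<^sub>M M) M fst. Q x" by (simp only:)
  then show ?thesis by (rule AE_distrD[OF measurable_fst])
qed

lemma AE_snd: "AE x in M. Q x \<Longrightarrow> AE w in M \<Otimes>\<^sub>M M. Q (snd w)"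
proof -
  assume Q: "AE x in M. Q x"
  interpret P: pair_prob_space M M by (rule pair_prob_space_MM)
  have "distr (M \<Otimes>\<^sub>M M) M snd = M"
  proof (intro measure_eqI)
    fix A assume "A \<in> sets (distr (M \<Otimes>\<^sub>M M) M snd)"
    then have A: "A \<in> sets M" by simp
    then have "emeasure (distr (M \<Otimes>\<^sub>M M) M snd) A = emeasure (M \<Otimes>\<^sub>M M) (space M \<times> A)"
      by (auto simp: emeasure_distr space_pair_measure intro!: arg_cong2[where f = emeasure])
    also have "\<dots> = emeasure M (space M) * emeasure M A"
      by (rule M.emeasure_pair_measure_Times[OF sets.top A])
    finally show "emeasure (distr (M \<Otimes>\<^sub>M M) M snd) A = emeasure M A"
      unfolding M.emeasure_space_1 by simp
  qed simp
  with Q have "AE x in distr (M \<Otimes>\<^sub>M M) M snd. Q x" by (simp only:)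
  then show ?thesis by (rule AE_distrD[OF measurable_snd])
qed

lemma AE_distinct:
  assumes "\<And>x. emeasure M {x} = 0"
  shows "AE w in M \<Otimes>\<^sub>M M. fst w \<noteq> snd w"
proof -
  interpret P: pair_prob_space M M by (rule pair_prob_space_MM)
  show ?thesis
  proof (rule P.AE_pair_measure)
  show "{w \<in> space (M \<Otimes>\<^sub>M M). fst w \<noteq> snd w} \<in> sets (M \<Otimes>\<^sub>M M)" by measurable
  have "AE y in M. x \<noteq> y" for x
    by (rule AE_I'[of "{x}"]) (auto simp: assms null_sets_def)
  then show "AE x in M. AE y in M. fst (x, y) \<noteq> snd (x, y)" by simp
  qed
qed

text \<open>Dominated convergence with the constant bound 1. Almost every pair of centres is
  distinct since \<open>M\<close> has no atoms, so the radii eventually select the far branch, where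
  the Poisson limit applies. Radii are only asked to be eventually below each positive number, which
  admits the constant -1.\<close>

lemma dev_tendsto:
  assumes \<mu>: "prob_space \<mu>" "sets \<mu> = sets borel" and k: "0 < k"
    and atomless: "\<And>x. emeasure M {x} = 0"
    and [measurable]: "lam \<in> borel_measurable borel" "lam' \<in> borel_measurable borel"
    and lam: "\<And>x. 0 \<le> lam x" "\<And>x. 0 \<le> lam' x"
    and r: "\<And>e. 0 < e \<Longrightarrow> \<forall>\<^sub>F n in sequentially. r n < e"
    and r': "\<And>e. 0 < e \<Longrightarrow> \<forall>\<^sub>F n in sequentially. r' n < e"
    and lim: "AE x in M. (\<lambda>n. real n * measure \<mu> (cball x (r n))) \<longlonglongrightarrow> lam x"
    and lim': "AE x in M. (\<lambda>n. real n * measure \<mu> (cball x (r' n))) \<longlonglongrightarrow> lam' x"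
  shows "(\<lambda>n. \<integral>w. dev \<mu> k (n - c) (r n) (r' n) (\<lambda>x. poisson_cdf k (lam x))
      (\<lambda>x. poisson_cdf k (lam' x)) w \<partial>(M \<Otimes>\<^sub>M M)) \<longlonglongrightarrow> 0"
proof -
  interpret P: pair_prob_space M M by (rule pair_prob_space_MM)
  let ?l = "\<lambda>x. poisson_cdf k (lam x)" and ?l' = "\<lambda>x. poisson_cdf k (lam' x)"
  have b: "0 \<le> dev \<mu> k n r r' ?l ?l' w" "dev \<mu> k n r r' ?l ?l' w \<le> 1" for n r r' w
    using poisson_cdf_bounds[OF k] lam by (intro dev_bounds[OF \<mu>]; simp)+
  have m: "dev \<mu> k n r r' ?l ?l' \<in> borel_measurable (M \<Otimes>\<^sub>M M)" for n r r'
  proof -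
    have "dev \<mu> k n r r' ?l ?l' \<in> borel_measurable (borel \<Otimes>\<^sub>M borel)"
      by (intro dev_measurable measurable_prob_cball[OF \<mu>(2,1)]) measurable
    then show ?thesis by simp
  qed
  \<comment> \<open>Replacing \<open>n\<close> trials by \<open>n - c\<close> costs \<open>c\<close>
    times the mass of a ball, which vanishes.\<close>
  have rate: "(\<lambda>N. real N * measure \<mu> (cball x (\<rho> (N + c)))) \<longlonglongrightarrow> l"
    if "(\<lambda>n. real n * measure \<mu> (cball x (\<rho> n))) \<longlonglongrightarrow> l" for x \<rho> l
  proof -
    have z: "(\<lambda>n. measure \<mu> (cball x (\<rho> n))) \<longlonglongrightarrow> 0"
      using that by (rule one_minus_power_tendsto_exp(2)[rotated]) simp
    have "(\<lambda>n. real n * measure \<mu> (cball x (\<rho> n)) - real c * measure \<mu> (cball x (\<rho> n))) \<longlonglongrightarrow> l - real c * 0"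
      by (intro tendsto_diff that tendsto_mult tendsto_const z)
    from LIMSEQ_ignore_initial_segment[OF this, of c] show ?thesis
      by (simp add: algebra_simps)
  qed
  have "(\<lambda>n. \<integral>w. dev \<mu> k (n - c) (r n) (r' n) ?l ?l' w \<partial>(M \<Otimes>\<^sub>M M)) \<longlonglongrightarrow> (\<integral>w. 0 \<partial>(M \<Otimes>\<^sub>M M))"
  proof (rule integral_dominated_convergence[where w = "\<lambda>_. 1"])
    show "AE w in M \<Otimes>\<^sub>M M. (\<lambda>n. dev \<mu> k (n - c) (r n) (r' n) ?l ?l' w) \<longlonglongrightarrow> 0"
      using AE_fst[OF lim] AE_snd[OF lim'] AE_distinct[OF atomless]
    proof eventually_elim
      case (elim w)
      obtain x y where w: "w = (x, y)" by (cases w)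
      have d: "0 < dist x y / 2" using elim w by simp
      have "(\<lambda>N. two_cell_prob k N (measure \<mu> (cball x (r (N + c)))) (measure \<mu> (cball y (r' (N + c)))))
          \<longlonglongrightarrow> ?l x * ?l' y"
        using elim w by (intro two_cell_prob_tendsto rate) simp_all
      then have "(\<lambda>N. \<bar>two_cell_prob k (N + c - c) (measure \<mu> (cball x (r (N + c))))
          (measure \<mu> (cball y (r' (N + c)))) - ?l x * ?l' y\<bar>) \<longlonglongrightarrow> 0"
        by (intro tendsto_rabs_zero) (simp add: LIM_zero)
      then have *: "(\<lambda>n. \<bar>two_cell_prob k (n - c) (measure \<mu> (cball x (r n)))
          (measure \<mu> (cball y (r' n))) - ?l x * ?l' y\<bar>) \<longlonglongrightarrow> 0"
        by (rule LIMSEQ_offset)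
      have "\<forall>\<^sub>F n in sequentially. \<bar>two_cell_prob k (n - c) (measure \<mu> (cball x (r n)))
          (measure \<mu> (cball y (r' n))) - ?l x * ?l' y\<bar> = dev \<mu> k (n - c) (r n) (r' n) ?l ?l' w"
        using r[OF d] r'[OF d]
      proof eventually_elim
        case (elim n)
        then have "max (r n) 0 + max (r' n) 0 < dist x y" using d by (auto simp: max_def)
        then show ?case by (simp add: dev_def w)
      qed
      with * show ?case by (rule Lim_transform_eventually)
    qed
  qed (use b m in \<open>auto intro: P.P.integrable_const\<close>)
  then show ?thesis by simp
qed

lemma hit_frac_measurable[measurable]: "hit_frac k n m r s \<in> borel_measurable (S n m)"
  unfolding hit_frac_def by (intro borel_measurable_divide borel_measurable_sum measurable_hit borel_measurable_const) simp

text \<open>Expand the square: the diagonal adds at most 1 / n, off-diagonal pairs are at most l^2 +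
  e each, and the cross term loses at most 2 * l * e' \<le> 2 * e'.\<close>

lemma hit_frac_variance_bound:
  assumes n: "2 \<le> n" and l: "0 \<le> l" "l \<le> 1" and e: "0 \<le> e"
    and pairs: "\<And>i i'. i < n \<Longrightarrow> i' < n \<Longrightarrow> i \<noteq> i' \<Longrightarrow>
      \<bar>(\<integral>w. hit k n m r s i w * hit k n m r s i' w \<partial>S n m) - l * l\<bar> \<le> e"
    and singles: "\<And>i. i < n \<Longrightarrow> \<bar>(\<integral>w. hit k n m r s i w \<partial>S n m) - l\<bar> \<le> e'"
  shows "(\<integral>w. (hit_frac k n m r s w - l)\<^sup>2 \<partial>S n m) \<le> 1 / real n + e + 2 * e'"
proof -
  interpret prob_space "S n m" by (rule prob_space_S)
  let ?h = "\<lambda>i w. hit k n m r s i w"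
  have habs: "\<bar>?h i w\<bar> \<le> 1" "\<bar>?h i w * ?h j w\<bar> \<le> 1" for i j w
    by (auto simp: hit_def split: prod.split)
  have int1: "integrable (S n m) (?h i)" if "i < n" for i
    using that habs by (intro integrable_const_bound[where B = 1] AE_I2 measurable_hit) simp_all
  have int2: "integrable (S n m) (\<lambda>w. ?h i w * ?h j w)" if "i < n" "j < n" for i j
    using that habs by (intro integrable_const_bound[where B = 1] AE_I2 borel_measurable_times measurable_hit) simp_all
  have le1: "(\<integral>w. ?h i w * ?h i w \<partial>S n m) \<le> 1" if "i < n" for i
  proof -
    have "(\<integral>w. ?h i w * ?h i w \<partial>S n m) \<le> (\<integral>w. 1 \<partial>S n m)"
      using that int2 habs[THEN abs_le_D1] by (intro integral_mono) auto
    then show ?thesis by (simp add: prob_space)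
  qed
  have n0: "0 < real n" using n by simp
  define A where "A = (\<Sum>i<n. \<Sum>j<n. \<integral>w. ?h i w * ?h j w \<partial>S n m)"
  define B where "B = (\<Sum>i<n. \<integral>w. ?h i w \<partial>S n m)"
  have sq: "(hit_frac k n m r s w - l)\<^sup>2
      = (\<Sum>i<n. \<Sum>j<n. ?h i w * ?h j w) / (real n)\<^sup>2 - 2 * l / real n * (\<Sum>i<n. ?h i w) + l\<^sup>2" for w
    by (simp add: hit_frac_def sum_product[symmetric] power2_diff[of "_ / real n"] power_divide)
      (simp add: power2_eq_square)
  have "(\<integral>w. (hit_frac k n m r s w - l)\<^sup>2 \<partial>S n m) = A / (real n)\<^sup>2 - 2 * l / real n * B + l\<^sup>2"
  proof -
    have i1: "integrable (S n m) (\<lambda>w. \<Sum>i<n. ?h i w)"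
      by (intro Bochner_Integration.integrable_sum int1) simp
    have i2: "integrable (S n m) (\<lambda>w. \<Sum>i<n. \<Sum>j<n. ?h i w * ?h j w)"
      by (intro Bochner_Integration.integrable_sum int2) simp_all
    have A: "(\<integral>w. (\<Sum>i<n. \<Sum>j<n. ?h i w * ?h j w) \<partial>S n m) = A"
      unfolding A_def using int2
      by (subst Bochner_Integration.integral_sum) (auto intro!: sum.cong Bochner_Integration.integrable_sum Bochner_Integration.integral_sum)
    have B: "(\<integral>w. (\<Sum>i<n. ?h i w) \<partial>S n m) = B"
      unfolding B_def using int1 by (intro Bochner_Integration.integral_sum) simp
    show ?thesis
      unfolding sq using i1 i2 by (simp add: A B prob_space del: times_divide_eq_left times_divide_eq_right)
  qed
  also have "\<dots> \<le> 1 / real n + e + 2 * e'"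
  proof -
    have "A \<le> (\<Sum>i<n. \<Sum>j<n. (if i = j then 1 else 0) + (l * l + e))"
      unfolding A_def
    proof (intro sum_mono)
      fix i j assume ij: "i \<in> {..<n}" "j \<in> {..<n}"
      show "(\<integral>w. ?h i w * ?h j w \<partial>S n m) \<le> (if i = j then 1 else 0) + (l * l + e)"
      proof (cases "i = j")
        case True
        then show ?thesis using le1[of i] ij l e by (simp add: add_increasing2)
      next
        case False
        then show ?thesis using pairs[of i j] ij by auto
      qed
    qed
    also have "\<dots> = real n + (real n)\<^sup>2 * (l * l + e)"
      by (simp add: sum.distrib power2_eq_square algebra_simps)
    finally have "A / (real n)\<^sup>2 \<le> (real n + (real n)\<^sup>2 * (l * l + e)) / (real n)\<^sup>2"
      by (intro divide_right_mono) auto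
    also have "\<dots> = 1 / real n + (l * l + e)"
      using n0 by (simp add: power2_eq_square field_simps)
    finally have 1: "A / (real n)\<^sup>2 \<le> 1 / real n + (l * l + e)" .
    have "(\<Sum>i<n. l - e') \<le> B"
      unfolding B_def
    proof (intro sum_mono)
      fix i assume "i \<in> {..<n}"
      then show "l - e' \<le> (\<integral>w. ?h i w \<partial>S n m)" using singles[of i] by auto
    qed
    then have "2 * l / real n * (real n * (l - e')) \<le> 2 * l / real n * B"
      using l n0 by (intro mult_left_mono) auto
    then have 2: "2 * l * (l - e') \<le> 2 * l / real n * B" using n0 by simp
    have "0 \<le> e'" using singles[of 0] n by auto
    then have "l * e' \<le> e'" using l by (simp add: mult_left_le_one_le)
    then show ?thesis using 1 2 by (simp add: power2_eq_square algebra_simps)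
  qed
  finally show ?thesis .
qed

lemma hit_frac_tendsto_L2:
  assumes k: "0 < k" and atomless: "\<And>x. emeasure M {x} = 0"
    and [measurable]: "lam \<in> borel_measurable borel" "kap \<in> borel_measurable borel"
    and lam: "\<And>x. 0 \<le> lam x" and kap: "\<And>x. 0 \<le> kap x"
    and r: "\<And>e. 0 < e \<Longrightarrow> \<forall>\<^sub>F n in sequentially. r n < e"
    and s: "\<And>e. 0 < e \<Longrightarrow> \<forall>\<^sub>F m in sequentially. s m < e"
    and lim_r: "AE x in M. (\<lambda>n. real n * M.prob (cball x (r n))) \<longlonglongrightarrow> lam x"
    and lim_s: "AE x in M. (\<lambda>m. real m * N.prob (cball x (s m))) \<longlonglongrightarrow> kap x"
  defines "l \<equiv> (\<integral>x. poisson_cdf k (lam x) * poisson_cdf k (kap x) \<partial>M)"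
  shows "((\<lambda>(n, m). \<integral>w. (hit_frac k n m (r n) (s m) w - l)\<^sup>2 \<partial>S n m) \<longlongrightarrow> 0)
    (sequentially \<times>\<^sub>F sequentially)"
proof -
  let ?lam = "\<lambda>x. poisson_cdf k (lam x)" and ?kap = "\<lambda>x. poisson_cdf k (kap x)"
  note pb = poisson_cdf_bounds[OF k]
  define dX where "dX r' g n = (\<integral>w. dev M k (n - 2) (r n) (r' n) ?lam g w \<partial>(M \<Otimes>\<^sub>M M))" for r' g n
  define dY where "dY s' g m = (\<integral>w. dev N k m (s m) (s' m) ?kap g w \<partial>(M \<Otimes>\<^sub>M M))" for s' g m
  \<comment> \<open>The dummy radius -1 fits \<open>dev_tendsto\<close> with limiting mean 0, and
    \<open>poisson_cdf k 0 = 1\<close>.\<close>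
  have triv: "\<forall>\<^sub>F n in sequentially. (-1::real) < e" if "0 < e" for e :: real using that by simp
  have neg: "(\<lambda>n. real n * measure \<mu> (cball x (- 1))) \<longlonglongrightarrow> 0" for \<mu> :: "'a measure" and x by simp
  have X: "dX r ?lam \<longlonglongrightarrow> 0" "dX (\<lambda>_. -1) (\<lambda>_. 1) \<longlonglongrightarrow> 0"
  proof -
    show "dX r ?lam \<longlonglongrightarrow> 0" unfolding dX_def
      by (intro dev_tendsto M.prob_space_axioms sets_M k atomless lam r lim_r) measurable
    have "(\<lambda>n. \<integral>w. dev M k (n - 2) (r n) (-1) ?lam (\<lambda>x. poisson_cdf k 0) w \<partial>(M \<Otimes>\<^sub>M M)) \<longlonglongrightarrow> 0"
      by (rule dev_tendsto[OF M.prob_space_axioms sets_M k atomless _ _ lam _ r triv lim_r])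
        (simp_all add: neg)
    then show "dX (\<lambda>_. -1) (\<lambda>_. 1) \<longlonglongrightarrow> 0" unfolding dX_def using k by (simp add: poisson_cdf_zero)
  qed
  have Y: "dY s ?kap \<longlonglongrightarrow> 0" "dY (\<lambda>_. -1) (\<lambda>_. 1) \<longlonglongrightarrow> 0"
  proof -
    show "dY s ?kap \<longlonglongrightarrow> 0" unfolding dY_def
      using dev_tendsto[OF N.prob_space_axioms sets_N k atomless _ _ kap kap s s lim_s lim_s, of 0] by simp
    have "(\<lambda>n. \<integral>w. dev N k (n - 0) (s n) (-1) ?kap (\<lambda>x. poisson_cdf k 0) w \<partial>(M \<Otimes>\<^sub>M M)) \<longlonglongrightarrow> 0"
      by (rule dev_tendsto[OF N.prob_space_axioms sets_N k atomless _ _ kap _ s triv lim_s])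
        (simp_all add: neg)
    then show "dY (\<lambda>_. -1) (\<lambda>_. 1) \<longlonglongrightarrow> 0" unfolding dY_def using k by (simp add: poisson_cdf_zero)
  qed
  have ll: "\<bar>?lam x * ?kap x\<bar> \<le> 1" "0 \<le> ?lam x * ?kap x" for x
    using mult_unit_interval[OF pb(1) pb(2) pb(1) pb(2), OF lam lam kap kap] by simp_all
  have l01: "0 \<le> l" "l \<le> 1"
  proof -
    show "0 \<le> l" unfolding l_def by (intro integral_nonneg_AE AE_I2 ll)
    have "l \<le> (\<integral>x. 1 \<partial>M)" unfolding l_def
      using ll(1)[THEN abs_le_D1] by (intro integral_mono M.integrable_const_bound[where B = 1]) (auto simp: ll)
    then show "l \<le> 1" using M.prob_space by simp
  qed
  have main: "(\<integral>w. (hit_frac k n m (r n) (s m) w - l)\<^sup>2 \<partial>S n m)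
      \<le> 1 / real n + (dX r ?lam n + dY s ?kap m) + 2 * (dX (\<lambda>_. -1) (\<lambda>_. 1) n + dY (\<lambda>_. -1) (\<lambda>_. 1) m)"
    if n: "2 \<le> n" for n m
  proof (rule hit_frac_variance_bound[OF n l01])
    show "0 \<le> dX r ?lam n + dY s ?kap m"
      unfolding dX_def dY_def using lam kap pb
      by (intro add_nonneg_nonneg integral_nonneg_AE AE_I2 dev_bounds M.prob_space_axioms
          N.prob_space_axioms sets_M sets_N) auto
  next
    fix i i' assume i: "i < n" "i' < n" "i \<noteq> i'"
    show "\<bar>(\<integral>w. hit k n m (r n) (s m) i w * hit k n m (r n) (s m) i' w \<partial>S n m) - l * l\<bar>
        \<le> dX r ?lam n + dY s ?kap m"
      unfolding dX_def dY_def l_def using lam kap pb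
      by (intro pair_bound i) auto
  next
    fix i assume i: "i < n"
    \<comment> \<open>Some other index, which exists since \<open>2 \<le> n\<close>; at radius -1
      its indicator and its limiting factors are all 1.\<close>
    define i' where "i' = (if i = 0 then 1 else 0 :: nat)"
    have i': "i' < n" "i \<noteq> i'" using n by (auto simp: i'_def)
    have "\<bar>(\<integral>w. hit k n m (r n) (s m) i w * hit k n m (-1) (-1) i' w \<partial>S n m)
        - (\<integral>x. ?lam x * ?kap x \<partial>M) * (\<integral>x. 1 * 1 \<partial>M)\<bar>
        \<le> dX (\<lambda>_. -1) (\<lambda>_. 1) n + dY (\<lambda>_. -1) (\<lambda>_. 1) m"
      unfolding dX_def dY_def using lam kap pb
      by (intro pair_bound i i') auto
    then show "\<bar>(\<integral>w. hit k n m (r n) (s m) i w \<partial>S n m) - l\<bar>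
        \<le> dX (\<lambda>_. -1) (\<lambda>_. 1) n + dY (\<lambda>_. -1) (\<lambda>_. 1) m"
      using k M.prob_space by (simp add: hit_neg l_def)
  qed
  show ?thesis
  proof (rule Lim_null_comparison)
    have "\<forall>\<^sub>F nm in sequentially \<times>\<^sub>F sequentially. 2 \<le> fst nm"
      using filterlim_fst eventually_ge_at_top[of 2] by (rule eventually_compose_filterlim[rotated])
    then show "\<forall>\<^sub>F nm in sequentially \<times>\<^sub>F sequentially.
      norm (case nm of (n, m) \<Rightarrow> \<integral>w. (hit_frac k n m (r n) (s m) w - l)\<^sup>2 \<partial>S n m)
      \<le> 1 / real (fst nm) + (dX r ?lam (fst nm) + dY s ?kap (snd nm))
        + 2 * (dX (\<lambda>_. -1) (\<lambda>_. 1) (fst nm) + dY (\<lambda>_. -1) (\<lambda>_. 1) (snd nm))"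
    proof eventually_elim
      case (elim nm)
      have "0 \<le> (\<integral>w. (hit_frac k (fst nm) (snd nm) (r (fst nm)) (s (snd nm)) w - l)\<^sup>2 \<partial>S (fst nm) (snd nm))"
        by simp
      with main[OF elim, of "snd nm"] show ?case by (simp add: split_beta)
    qed
    have "((\<lambda>nm. 1 / real (fst nm) + (dX r ?lam (fst nm) + dY s ?kap (snd nm))
        + 2 * (dX (\<lambda>_. -1) (\<lambda>_. 1) (fst nm) + dY (\<lambda>_. -1) (\<lambda>_. 1) (snd nm)))
        \<longlongrightarrow> 0 + (0 + 0) + 2 * (0 + 0)) (sequentially \<times>\<^sub>F sequentially)"
      by (intro tendsto_add tendsto_mult tendsto_const
          filterlim_compose[OF X(1) filterlim_fst] filterlim_compose[OF X(2) filterlim_fst]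
          filterlim_compose[OF Y(1) filterlim_snd] filterlim_compose[OF Y(2) filterlim_snd]
          filterlim_compose[OF lim_const_over_n[of 1] filterlim_fst])
    then show "((\<lambda>nm. 1 / real (fst nm) + (dX r ?lam (fst nm) + dY s ?kap (snd nm))
        + 2 * (dX (\<lambda>_. -1) (\<lambda>_. 1) (fst nm) + dY (\<lambda>_. -1) (\<lambda>_. 1) (snd nm)))
        \<longlongrightarrow> 0) (sequentially \<times>\<^sub>F sequentially)" by simp
  qed
qed

end

section \<open>Step function minorants of powers\<close>

text \<open>A condition inherited by smaller indices holds exactly on an initial segment, so the sum
  telescopes to the coefficient at the cut. The cut \<open>L\<close> is fixed before
  \<open>c\<close>, so that one cell index can serve all exponents.\<close>

lemma telescope_threshold:
  assumes P: "\<And>i::nat. P (Suc i) \<Longrightarrow> P i"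
  shows "\<exists>L\<le>n. (\<forall>i\<in>{1..n}. P i \<longleftrightarrow> i \<le> L) \<and> (\<forall>c :: nat \<Rightarrow> real. c 0 = 0 \<longrightarrow>
    (\<Sum>i = 1..n. (c i - c (i - 1)) * (if P i then 1 else 0)) = c L)"
proof (induction n)
  case 0
  then show ?case by simp
next
  case (Suc n)
  then obtain L where L: "L \<le> n" "\<forall>i\<in>{1..n}. P i \<longleftrightarrow> i \<le> L"
    "\<And>c :: nat \<Rightarrow> real. c 0 = 0 \<Longrightarrow> (\<Sum>i = 1..n. (c i - c (i - 1)) * (if P i then 1 else 0)) = c L"
    by blast
  show ?case
  proof (cases "P (Suc n)")
    case True
    then have "n = 0 \<or> n \<le> L" using P[of n] L(2) by (cases n) auto
    with L(1) have "L = n" by auto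
    with L True show ?thesis
      by (intro exI[of _ "Suc n"]) (auto simp: le_Suc_eq)
  next
    case False
    with L show ?thesis
      by (intro exI[of _ L]) (auto simp: le_Suc_eq)
  qed
qed

text \<open>\<open>step a j\<close> is a minorant of \<open>g powr - a\<close>, constant on the cells \<open>(i / j, (i + 1) / j]\<close> for
  \<open>1 \<le> i < j\<^sup>2\<close> and on \<open>(j, \<infinity>)\<close>, with values \<open>lvl a j i\<close>. It is written as a combination of
  indicators of half-lines because those are the events expressible by neighbour counts.\<close>
definition lvl :: "real \<Rightarrow> nat \<Rightarrow> nat \<Rightarrow> real" where
  "lvl a j i = (if i = 0 then 0
     else if i < j * j then min ((real i / real j) powr - a) ((real (i + 1) / real j) powr - a)
     else if 0 < a then 0 else real j powr - a)"

definition step :: "real \<Rightarrow> nat \<Rightarrow> real \<Rightarrow> real" where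
  "step a j g = (\<Sum>i = 1..j * j. (lvl a j i - lvl a j (i - 1)) * (if real i / real j < g then 1 else 0))"

text \<open>\<open>L\<close> is the index of the cell containing \<open>g\<close>: 0 for everything
  up to \<open>1 / j\<close>, and \<open>j * j\<close> for everything beyond \<open>j\<close>. It
  does not depend on the exponent.\<close>

lemma step_cases:
  assumes j: "0 < j"
  shows "\<exists>L\<le>j * j. (\<forall>a. step a j g = lvl a j L) \<and> (0 < L \<longrightarrow> real L / real j < g) \<and>
    (L < j * j \<longrightarrow> g \<le> real (L + 1) / real j)"
proof -
  have mono: "real (Suc i) / real j < g \<Longrightarrow> real i / real j < g" for i
    using divide_right_mono[of "real i" "real (Suc i)" "real j"] by simp
  obtain L where L: "L \<le> j * j" "\<forall>i\<in>{1..j * j}. (real i / real j < g) \<longleftrightarrow> i \<le> L"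
    "\<And>c :: nat \<Rightarrow> real. c 0 = 0 \<Longrightarrow>
      (\<Sum>i = 1..j * j. (c i - c (i - 1)) * (if real i / real j < g then 1 else 0)) = c L"
    using telescope_threshold[of "\<lambda>i. real i / real j < g" "j * j"] mono by blast
  have "0 < L \<longrightarrow> real L / real j < g" using L(1,2) by auto
  moreover have "L < j * j \<longrightarrow> g \<le> real (L + 1) / real j"
    using L(2)[rule_format, of "L + 1"] by (simp add: not_less)
  moreover have "\<forall>a. step a j g = lvl a j L" unfolding step_def by (intro allI L(3)) (simp add: lvl_def)
  ultimately show ?thesis using L(1) by (intro exI[of _ L] conjI)
qed

lemma lvl_nonneg: "0 \<le> lvl a j i"
  by (simp add: lvl_def)

lemma step_nonneg:
  assumes "0 < j"
  shows "0 \<le> step a j g"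
  using step_cases[OF assms, of g] by (elim exE conjE) (simp add: lvl_nonneg)

text \<open>Squaring commutes with \<open>min\<close> on nonnegative numbers and doubles the
  exponent of \<open>powr\<close>. Hence squares of step functions are again step functions on the
  same grid, now for the doubled exponent, and can be set against the estimator at doubled
  exponents.\<close>

lemma lvl_square: "(lvl a j i)\<^sup>2 = lvl (2 * a) j i"
proof -
  have sq: "(x powr - a)\<^sup>2 = x powr - (2 * a)" for x :: real
    by (cases "x = 0") (simp_all add: power2_eq_square powr_add[symmetric])
  have "(min x y)\<^sup>2 = min (x\<^sup>2) (y\<^sup>2)" if "0 \<le> x" "0 \<le> y" for x y :: real
    using that by (auto simp: min_def power2_le_iff_abs_le abs_le_square_iff[symmetric])
  then show ?thesis by (simp add: lvl_def sq)
qed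

lemma step_square:
  assumes "0 < j"
  shows "(step a j g)\<^sup>2 = step (2 * a) j g"
  using step_cases[OF assms, of g] by (elim exE conjE) (simp add: lvl_square)

text \<open>On an inner cell the power is monotone, so the smaller of the two end values is a lower
  bound whatever the sign of the exponent. On the unbounded cell the bound is 0 for a decreasing
  power and the value at \<open>j\<close> otherwise.\<close>

lemma step_le:
  assumes j: "0 < j" and g: "0 < g"
  shows "step a j g \<le> g powr - a"
proof -
  obtain L where L: "L \<le> j * j" "step a j g = lvl a j L" "0 < L \<longrightarrow> real L / real j < g"
    "L < j * j \<longrightarrow> g \<le> real (L + 1) / real j"
    using step_cases[OF j, of g] by (elim exE conjE allE[of _ a]) (rule that)
  consider "L = 0" | "0 < L" "L < j * j" | "L = j * j" "0 < L" using L(1) by linarith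
  then show ?thesis
  proof cases
    case 1
    then show ?thesis using L by (simp add: lvl_def)
  next
    case 2
    have lo: "0 \<le> real L / real j" "real L / real j \<le> g" using L(3) 2 by auto
    have hi: "g \<le> real (L + 1) / real j" using L(4) 2 by auto
    show ?thesis
    proof (cases "0 \<le> a")
      case True
      then have "(real (L + 1) / real j) powr - a \<le> g powr - a"
        using g hi by (intro powr_mono2') auto
      then show ?thesis using 2 L(2) by (simp add: lvl_def min_le_iff_disj)
    next
      case False
      then have "(real L / real j) powr - a \<le> g powr - a"
        using lo by (intro powr_mono2) auto
      then show ?thesis using 2 L(2) by (simp add: lvl_def min_le_iff_disj)
    qed
  next
    case 3
    then have "real j < g" using L(3) j by simp
    then show ?thesis using 3 L(2) powr_mono2[of "- a" "real j" g] by (simp add: lvl_def)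
  qed
qed

text \<open>For large \<open>j\<close> the point lies in an inner cell, whose end points are within
  \<open>1 / j\<close> of \<open>g\<close>. Monotonicity bounds the smaller end value below by the
  power at \<open>g + 1 / j\<close> or at \<open>g - 1 / j\<close>, according to the sign of the
  exponent.\<close>

lemma step_tendsto:
  assumes g: "0 < g"
  shows "(\<lambda>j. step a j g) \<longlonglongrightarrow> g powr - a"
proof (rule real_tendsto_sandwich)
  let ?lo = "\<lambda>j. min ((g + 1 / real j) powr - a) ((g - 1 / real j) powr - a)"
  show "\<forall>\<^sub>F j in sequentially. step a j g \<le> g powr - a"
    using eventually_gt_at_top[of 0] by eventually_elim (intro step_le g)
  have z: "(\<lambda>j. 1 / real j) \<longlonglongrightarrow> 0" by (rule lim_const_over_n)
  have "?lo \<longlonglongrightarrow> min ((g + 0) powr - a) ((g - 0) powr - a)"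
    using g by (intro tendsto_min tendsto_powr tendsto_add tendsto_diff tendsto_const z) auto
  then show "?lo \<longlonglongrightarrow> g powr - a" by simp
  show "\<forall>\<^sub>F j in sequentially. ?lo j \<le> step a j g"
    using eventually_gt_at_top[of 0] order_tendstoD(2)[OF z g]
      eventually_gt_at_top[of "nat \<lceil>g\<rceil>"]
  proof eventually_elim
    case (elim j)
    have gj: "g < real j" using elim(3) by linarith
    obtain L where L: "L \<le> j * j" "step a j g = lvl a j L" "0 < L \<longrightarrow> real L / real j < g"
      "L < j * j \<longrightarrow> g \<le> real (L + 1) / real j"
      using step_cases[OF elim(1), of g] by (elim exE conjE allE[of _ a]) (rule that)
    have "L \<noteq> 0"
    proof
      assume "L = 0"
      then have "g \<le> 1 / real j" using L(4) elim(1) by simp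
      with elim(2) show False by simp
    qed
    moreover have "L \<noteq> j * j"
    proof
      assume "L = j * j"
      then have "real j < g" using L(3) elim(1) by simp
      with gj show False by simp
    qed
    ultimately have L': "0 < L" "L < j * j" using L(1) by auto
    have lo: "real L / real j < g" and hi: "g \<le> real (L + 1) / real j" using L L' by auto
    have split: "real (L + 1) / real j = real L / real j + 1 / real j" by (simp add: add_divide_distrib)
    have pos: "0 < g - 1 / real j" using elim(2) by simp
    show ?case
    proof (cases "0 \<le> a")
      case True
      have "(g + 1 / real j) powr - a \<le> (real (L + 1) / real j) powr - a"
        using True g hi lo split by (intro powr_mono2') auto
      moreover have "(real (L + 1) / real j) powr - a \<le> (real L / real j) powr - a"
        using True L'(1) elim(1) split by (intro powr_mono2') auto
      ultimately show ?thesis using L(2) L' by (auto simp: lvl_def min_le_iff_disj)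
    next
      case False
      have "(g - 1 / real j) powr - a \<le> (real L / real j) powr - a"
        using False pos hi split by (intro powr_mono2) auto
      moreover have "(real L / real j) powr - a \<le> (real (L + 1) / real j) powr - a"
        using False split by (intro powr_mono2) auto
      ultimately show ?thesis using L(2) L' by (auto simp: lvl_def min_le_iff_disj)
    qed
  qed
qed auto

section \<open>Erlang integrals and limits of averaged step functions\<close>

abbreviation erl :: "nat \<Rightarrow> real measure" where
  "erl k \<equiv> density lborel (\<lambda>x. ennreal (erlang_density (k - 1) 1 x))"

lemma prob_space_erl: "prob_space (erl k)"
  by (rule prob_space_erlang_density) simp

lemma AE_erl_pos: "AE x in erl k. 0 < x"
proof -
  have "AE x in lborel. x \<noteq> (0::real)" by (rule AE_lborel_singleton)
  then show ?thesis by (subst AE_density) (auto simp: erlang_density_def elim!: eventually_mono)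
qed

text \<open>For positive \<open>k\<close>, \<open>erl k\<close> is the Gamma distribution of shape
  \<open>k\<close> and rate 1, the law of the \<open>k\<close>th arrival in a Poisson process of
  unit rate. It exceeds \<open>t\<close> when there are fewer than \<open>k\<close> arrivals by time
  \<open>t\<close>.\<close>

lemma erl_tail:
  assumes "0 < k" "0 \<le> t"
  shows "measure (erl k) {t<..} = poisson_cdf k t"
proof -
  interpret prob_space "erl k" by (rule prob_space_erl)
  have 1: "0 \<le> erlang_CDF (k - 1) 1 t" by simp
  have "measure (erl k) {..t} = erlang_CDF (k - 1) 1 t"
    using emeasure_erlang_density[of 1 "k - 1" t] 1 by (simp add: measure_def)
  moreover have "measure (erl k) {t<..} = 1 - measure (erl k) {..t}"
    using prob_compl[of "{..t}"] by (simp add: Compl_eq_Diff_UNIV[symmetric] Compl_atMost)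
  moreover have "{..k - 1} = {..<k}" using assms by auto
  ultimately show ?thesis
    using assms by (simp add: erlang_CDF_def poisson_cdf_def)
qed

text \<open>Multiplying the Erlang density by the power moves the exponent in Euler's integral from
  \<open>k - 1\<close> to \<open>k - a - 1\<close>; convergence at 0 is the condition
  \<open>a < real k\<close>.\<close>

lemma erl_power_integral:
  assumes k: "0 < k" and a: "a < real k"
  shows "integrable (erl k) (\<lambda>x. x powr - a)"
    and "(\<integral>x. x powr - a \<partial>erl k) = Gamma (real k - a) / Gamma (real k)"
proof -
  have Gk: "Gamma (real k) = fact (k - 1)" using Gamma_fact[of "k - 1", where 'a = real] k by simp
  have "(\<integral>\<^sup>+x. ennreal (x powr - a) \<partial>erl k)
    = (\<integral>\<^sup>+x. ennreal (erlang_density (k - 1) 1 x) * ennreal (x powr - a) \<partial>lborel)"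
    by (subst nn_integral_density) auto
  also have "\<dots> = (\<integral>\<^sup>+x. ennreal (1 / fact (k - 1)) *
      ennreal (indicator {0..} x * x powr (real k - a - 1) / exp x) \<partial>lborel)"
  proof (intro nn_integral_cong_AE)
    have "AE x in lborel. x \<noteq> (0::real)" by (rule AE_lborel_singleton)
    then show "AE x in lborel. ennreal (erlang_density (k - 1) 1 x) * ennreal (x powr - a)
      = ennreal (1 / fact (k - 1)) * ennreal (indicator {0..} x * x powr (real k - a - 1) / exp x)"
    proof eventually_elim
      case (elim x)
      show ?case
      proof (cases "0 < x")
        case True
        have "x ^ (k - 1) * x powr - a = x powr (real (k - 1) + - a)"
          using True by (subst powr_add) (simp add: powr_realpow)
        also have "real (k - 1) + - a = real k - a - 1" using k by simp
        finally have "erlang_density (k - 1) 1 x * x powr - a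
            = 1 / fact (k - 1) * (indicator {0..} x * x powr (real k - a - 1) / exp x)"
          using True by (simp add: erlang_density_def exp_minus field_simps)
        then show ?thesis using True by (simp add: ennreal_mult[symmetric])
      next
        case False
        with elim show ?thesis by (simp add: erlang_density_def)
      qed
    qed
  qed
  also have "\<dots> = ennreal (1 / fact (k - 1)) * ennreal (Gamma (real k - a))"
    using a by (subst nn_integral_cmult) (auto simp: Gamma_conv_nn_integral_real)
  also have "\<dots> = ennreal (Gamma (real k - a) / Gamma (real k))"
    unfolding Gk using a by (subst ennreal_mult[symmetric]) (auto simp: less_imp_le Gamma_real_pos)
  finally have nn: "(\<integral>\<^sup>+x. ennreal (x powr - a) \<partial>erl k) = ennreal (Gamma (real k - a) / Gamma (real k))" .
  show "integrable (erl k) (\<lambda>x. x powr - a)"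
    using nn by (intro integrableI_nonneg) auto
  have "0 \<le> Gamma (real k - a) / Gamma (real k)"
    using a k by (intro divide_nonneg_nonneg less_imp_le Gamma_real_pos) auto
  then show "(\<integral>x. x powr - a \<partial>erl k) = Gamma (real k - a) / Gamma (real k)"
  proof -
    have "(\<integral>x. x powr - a \<partial>erl k) = enn2real (\<integral>\<^sup>+x. ennreal (x powr - a) \<partial>erl k)"
      by (rule integral_eq_nn_integral) auto
    also have "\<dots> = Gamma (real k - a) / Gamma (real k)"
      unfolding nn using \<open>0 \<le> Gamma (real k - a) / Gamma (real k)\<close> by (rule enn2real_ennreal)
    finally show ?thesis .
  qed
qed

text \<open>Limiting conditional expectation of \<open>step a j\<close> of the normalised volume at
  a point of density \<open>l\<close>: each threshold indicator is replaced by the limiting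
  probability that a ball of that normalised volume holds fewer than \<open>k\<close>
  points.\<close>

definition step_hat :: "nat \<Rightarrow> real \<Rightarrow> nat \<Rightarrow> real \<Rightarrow> real" where
  "step_hat k a j l = (\<Sum>i = 1..j * j. (lvl a j i - lvl a j (i - 1)) * poisson_cdf k (l * (real i / real j)))"

lemma step_hat_measurable[measurable]: "step_hat k a j \<in> borel_measurable borel"
  unfolding step_hat_def[abs_def] by measurable

lemma step_measurable[measurable]: "step a j \<in> borel_measurable borel"
  unfolding step_def[abs_def] by measurable

text \<open>An Erlang variable divided by \<open>l\<close> exceeds \<open>t\<close> with probability
  \<open>poisson_cdf k (l * t)\<close>; this quotient is the limit law of the normalised volume at
  density \<open>l\<close>.\<close>

lemma step_hat_eq_integral:
  assumes k: "0 < k" and l: "0 < l"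
  shows "step_hat k a j l = (\<integral>x. step a j (x / l) \<partial>erl k)"
proof -
  interpret prob_space "erl k" by (rule prob_space_erl)
  have ind: "(if real i / real j < x / l then 1 else 0 :: real) = indicator {l * (real i / real j)<..} x" for i x
    using l by (auto simp: indicator_def field_simps)
  have ii: "integrable (erl k) (indicator {c<..} :: real \<Rightarrow> real)" for c
    by (intro integrable_const_bound[where B = 1]) auto
  have "(\<integral>x. step a j (x / l) \<partial>erl k)
    = (\<Sum>i = 1..j * j. (lvl a j i - lvl a j (i - 1)) * measure (erl k) {l * (real i / real j)<..})"
    unfolding step_def ind
    by (subst Bochner_Integration.integral_sum) (auto simp: ii simp del: One_nat_def)
  also have "\<dots> = step_hat k a j l"
    unfolding step_hat_def using k l by (intro sum.cong refl, subst erl_tail) auto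
  finally show ?thesis ..
qed

text \<open>Unlike \<open>powr\<close>, this takes the value 1 at \<open>l = 0\<close> when the exponent is 0.\<close>
definition pw :: "real \<Rightarrow> real \<Rightarrow> real" where
  "pw a l = (if a = 0 then 1 else l powr a)"

lemma pw_nonneg[simp]: "0 \<le> pw a l" by (simp add: pw_def)

lemma pw_measurable[measurable]: "pw a \<in> borel_measurable borel"
  unfolding pw_def[abs_def] by (cases "a = 0") simp_all

text \<open>At density 0 every threshold is exceeded with limiting probability 1, so the sum
  telescopes to the level of the unbounded cell.\<close>

lemma step_hat_zero:
  assumes "0 < k" "0 < j"
  shows "step_hat k a j 0 = (if 0 < a then 0 else real j powr - a)"
proof -
  have "step_hat k a j 0 = (\<Sum>i = 1..j * j. lvl a j i - lvl a j (i - 1))"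
    using assms by (simp add: step_hat_def poisson_cdf_zero)
  also have "\<dots> = lvl a j (j * j) - lvl a j 0"
  proof -
    have "(\<Sum>i = 1..n. lvl a j i - lvl a j (i - 1)) = lvl a j n - lvl a j 0" for n
      by (induction n) auto
    then show ?thesis .
  qed
  finally show ?thesis using assms by (simp add: lvl_def)
qed

text \<open>Dominated convergence under the Erlang law, with the power itself as majorant by
  \<open>step_le\<close>; rescaling by \<open>l\<close> produces the factor \<open>l powr a\<close>.
  Density 0 with a nonnegative exponent is included because \<open>q\<close> may vanish on part of
  the support of \<open>p\<close>.\<close>

lemma step_hat_bounds:
  assumes k: "0 < k" and j: "0 < j" and a: "a < real k" and l: "0 < l \<or> (l = 0 \<and> 0 \<le> a)"
  shows "0 \<le> step_hat k a j l" "step_hat k a j l \<le> pw a l * (Gamma (real k - a) / Gamma (real k))"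
    and step_hat_tendsto: "(\<lambda>j. step_hat k a j l) \<longlonglongrightarrow> pw a l * (Gamma (real k - a) / Gamma (real k))"
proof -
  have G: "0 < Gamma (real k)" using k by (simp add: Gamma_real_pos)
  have "0 \<le> step_hat k a j l \<and> step_hat k a j l \<le> pw a l * (Gamma (real k - a) / Gamma (real k)) \<and>
    (\<lambda>j. step_hat k a j l) \<longlonglongrightarrow> pw a l * (Gamma (real k - a) / Gamma (real k))"
  proof (cases "l = 0")
    case True
    \<comment> \<open>For positive \<open>a\<close> both sides are 0; for \<open>a = 0\<close> both
      are 1, the case in which \<open>pw\<close> departs from \<open>powr\<close>.\<close>
    have v: "step_hat k a i l = pw a 0" if "0 < i" for i
      using True l that k by (auto simp: step_hat_zero pw_def)
    have e: "pw a l * (Gamma (real k - a) / Gamma (real k)) = pw a 0"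
      using True l G by (auto simp: pw_def)
    have "(\<lambda>j. step_hat k a j l) \<longlonglongrightarrow> pw a 0"
      by (rule tendsto_eventually) (use v in \<open>auto intro: eventually_mono[OF eventually_gt_at_top[of 0]]\<close>)
    then show ?thesis unfolding e using v[OF j] by simp
  next
    case False
    then have l: "0 < l" using l by simp
    interpret prob_space "erl k" by (rule prob_space_erl)
    let ?f = "\<lambda>x. (x / l) powr - a"
    have f: "?f x = l powr a * x powr - a" if "0 < x" for x
      using l that by (simp add: powr_divide powr_minus field_simps)
    have AEf: "AE x in erl k. ?f x = l powr a * x powr - a"
      using AE_erl_pos by eventually_elim (rule f)
    have int: "integrable (erl k) ?f"
      using integrable_mult_right[OF erl_power_integral(1)[OF k a], of "l powr a"]
      by (rule integrable_cong_AE_imp) (use AEf in \<open>auto elim!: eventually_mono\<close>)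
    have val: "(\<integral>x. ?f x \<partial>erl k) = pw a l * (Gamma (real k - a) / Gamma (real k))"
    proof -
      have "(\<integral>x. ?f x \<partial>erl k) = (\<integral>x. l powr a * x powr - a \<partial>erl k)"
        by (intro integral_cong_AE AEf) auto
      also have "\<dots> = l powr a * (Gamma (real k - a) / Gamma (real k))"
        by (simp only: integral_mult_right_zero erl_power_integral(2)[OF k a])
      also have "l powr a = pw a l" using l by (simp add: pw_def)
      finally show ?thesis .
    qed
    have dom: "AE x in erl k. norm (step a j (x / l)) \<le> ?f x" if "0 < j" for j
      using AE_erl_pos
    proof eventually_elim
      case (elim x)
      then show ?case using that l step_nonneg[of j a "x / l"] step_le[of j "x / l" a] by simp
    qed
    have int_s: "integrable (erl k) (\<lambda>x. step a j (x / l))"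
    proof (rule Bochner_Integration.integrable_bound[OF int])
      show "AE x in erl k. norm (step a j (x / l)) \<le> norm (?f x)"
        using dom[OF j] by eventually_elim simp
    qed simp
    have 1: "0 \<le> (\<integral>x. step a j (x / l) \<partial>erl k)"
      using j by (intro integral_nonneg_AE AE_I2 step_nonneg)
    have 2: "(\<integral>x. step a j (x / l) \<partial>erl k) \<le> (\<integral>x. ?f x \<partial>erl k)"
      using dom[OF j] by (intro integral_mono_AE int_s int) (auto elim!: eventually_mono)
    \<comment> \<open>The shift keeps the grid parameter positive, as \<open>dom\<close>
      requires.\<close>
    have 3: "(\<lambda>j. \<integral>x. step a (Suc j) (x / l) \<partial>erl k) \<longlonglongrightarrow> (\<integral>x. ?f x \<partial>erl k)"
    proof (rule integral_dominated_convergence[where w = ?f])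
      show "AE x in erl k. (\<lambda>j. step a (Suc j) (x / l)) \<longlonglongrightarrow> ?f x"
        using AE_erl_pos by eventually_elim (use l in \<open>auto intro!: LIMSEQ_Suc step_tendsto\<close>)
    qed (use int dom in auto)
    show ?thesis
      unfolding step_hat_eq_integral[OF k l]
      using 1 2 LIMSEQ_imp_Suc[OF 3] unfolding val by (intro conjI)
  qed
  then show "0 \<le> step_hat k a j l" "step_hat k a j l \<le> pw a l * (Gamma (real k - a) / Gamma (real k))"
    "(\<lambda>j. step_hat k a j l) \<longlonglongrightarrow> pw a l * (Gamma (real k - a) / Gamma (real k))" by auto
qed

section \<open>The estimator in terms of neighbour counts\<close>

text \<open>In the sorted list the entries at most \<open>r\<close> occupy an initial segment, and
  \<open>k - 1\<close> is the zero-based position of the \<open>k\<close>th entry. The count itself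
  is unaffected by sorting, as a comparison of multisets shows.\<close>

lemma sort_nth_greater_iff:
  fixes xs :: "'b::linorder list"
  assumes "1 \<le> k" "k \<le> length xs"
  shows "r < sort xs ! (k - 1) \<longleftrightarrow> length (filter (\<lambda>y. y \<le> r) xs) < k"
proof -
  let ?ys = "sort xs"
  have len: "length (filter (\<lambda>y. y \<le> r) xs) = card {i. i < length ?ys \<and> ?ys ! i \<le> r}"
  proof -
    have "length (filter (\<lambda>y. y \<le> r) xs) = size (filter_mset (\<lambda>y. y \<le> r) (mset xs))"
      by (metis mset_filter size_mset)
    also have "\<dots> = length (filter (\<lambda>y. y \<le> r) ?ys)"
      by (metis mset_filter mset_sort size_mset)
    finally show ?thesis by (simp add: length_filter_conv_card)
  qed
  have mono: "?ys ! i \<le> ?ys ! j" if "i \<le> j" "j < length xs" for i j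
    using that by (intro sorted_nth_mono) auto
  show ?thesis
  proof
    assume "r < ?ys ! (k - 1)"
    then have "{i. i < length ?ys \<and> ?ys ! i \<le> r} \<subseteq> {..<k - 1}"
      using mono[of "k - 1"] by (auto simp: not_le[symmetric]) (meson le_less_trans not_le order_trans)
    then have "card {i. i < length ?ys \<and> ?ys ! i \<le> r} \<le> card {..<k - 1}"
      by (intro card_mono) auto
    then show "length (filter (\<lambda>y. y \<le> r) xs) < k" using assms by (simp add: len)
  next
    assume lt: "length (filter (\<lambda>y. y \<le> r) xs) < k"
    show "r < ?ys ! (k - 1)"
    proof (rule ccontr)
      assume "\<not> r < ?ys ! (k - 1)"
      then have le: "?ys ! (k - 1) \<le> r" by simp
      have "{..<k} \<subseteq> {i. i < length ?ys \<and> ?ys ! i \<le> r}"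
      proof
        fix i assume "i \<in> {..<k}"
        then have "i \<le> k - 1" "i < length xs" "k - 1 < length xs" using assms by auto
        then show "i \<in> {i. i < length ?ys \<and> ?ys ! i \<le> r}"
          using order_trans[OF mono le] by simp
      qed
      then have "card {..<k} \<le> card {i. i < length ?ys \<and> ?ys ! i \<le> r}"
        by (intro card_mono) auto
      then show False using lt by (simp add: len)
    qed
  qed
qed

lemma list_comp_filter: "concat (map (\<lambda>j. if P j then [f j] else []) xs) = map f (filter P xs)"
  by (induction xs) auto

lemma length_filter_map_upt:
  "length (filter Q (map f (filter P [0..<n]))) = card {j \<in> {j. j < n \<and> P j}. Q (f j)}"
proof -
  have "length (filter Q (map f (filter P [0..<n]))) = length (filter (\<lambda>j. P j \<and> Q (f j)) [0..<n])"
    by (simp add: filter_map comp_def conj_commute)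
  also have "\<dots> = card {j. j < n \<and> P j \<and> Q (f j)}"
    by (simp add: length_filter_conv_card conj_comms cong: conj_cong)
  finally show ?thesis by (simp add: conj_assoc)
qed

text \<open>The centre is excluded, leaving \<open>n - 1\<close> distances; hence
  \<open>k < n\<close> here, against \<open>k \<le> m\<close> for the other sample.\<close>

lemma rho_k_greater_iff:
  assumes "1 \<le> k" "k < n" "i < n"
  shows "r < rho_k k n X i \<longleftrightarrow> few k ({..<n} - {i}) X (X i) r"
proof -
  have "length (map (\<lambda>j. dist (X i) (X j)) (filter (\<lambda>j. j \<noteq> i) [0..<n])) = card ({..<n} - {i})"
    using length_filter_map_upt[of "\<lambda>_. True" "\<lambda>j. dist (X i) (X j)" "\<lambda>j. j \<noteq> i" n]
    by (simp add: set_diff_eq)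
  then have len: "k \<le> length (map (\<lambda>j. dist (X i) (X j)) (filter (\<lambda>j. j \<noteq> i) [0..<n]))"
    using assms by simp
  have "{j \<in> {j. j < n \<and> j \<noteq> i}. dist (X i) (X j) \<le> r} = {j \<in> {..<n} - {i}. X j \<in> cball (X i) r}" by auto
  then show ?thesis
    unfolding rho_k_def list_comp_filter sort_nth_greater_iff[OF assms(1) len] length_filter_map_upt
    by (subst few_iff_card) auto
qed

lemma nu_k_greater_iff:
  assumes "1 \<le> k" "k \<le> m"
  shows "r < nu_k k m Y x \<longleftrightarrow> few k {..<m} Y x r"
proof -
  have len: "k \<le> length (map (\<lambda>j. dist x (Y j)) [0..<m])" using assms by simp
  have "length (filter (\<lambda>y. y \<le> r) (map (\<lambda>j. dist x (Y j)) [0..<m])) = card {j \<in> {..<m}. Y j \<in> cball x r}"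
    using length_filter_map_upt[of "\<lambda>y. y \<le> r" "\<lambda>j. dist x (Y j)" "\<lambda>_. True" m] by (simp add: lessThan_def)
  then show ?thesis
    unfolding nu_k_def sort_nth_greater_iff[OF assms(1) len] by (subst few_iff_card) auto
qed

lemma rho_k_nonneg:
  assumes "1 \<le> k" "k < n" "i < n"
  shows "0 \<le> rho_k k n X i"
proof (rule dense_le)
  fix r :: real assume "r < 0"
  then show "r \<le> rho_k k n X i"
    using rho_k_greater_iff[OF assms, of r X] few_neg[of r k "{..<n} - {i}" X "X i"] assms by simp
qed

lemma nu_k_nonneg:
  assumes "1 \<le> k" "k \<le> m"
  shows "0 \<le> nu_k k m Y x"
proof (rule dense_le)
  fix r :: real assume "r < 0"
  then show "r \<le> nu_k k m Y x"
    using nu_k_greater_iff[OF assms, of r Y x] few_neg[of r k "{..<m}" Y x] assms by simp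
qed

section \<open>Radii of prescribed volume and the normalised estimator\<close>

text \<open>The radius of the ball of volume \<open>t / (N + 1)\<close>.\<close>
definition rad :: "'a::euclidean_space itself \<Rightarrow> real \<Rightarrow> nat \<Rightarrow> real" where
  "rad T t N = (t / (unit_vol T * real (N + 1))) powr (1 / real DIM('a))"

lemma unit_vol_pos: "0 < unit_vol TYPE('a::euclidean_space)"
  unfolding unit_vol_def by (simp add: content_ball_pos)

lemma measure_cball_unit_vol:
  "0 \<le> r \<Longrightarrow> measure lborel (cball (x::'a::euclidean_space) r) = unit_vol TYPE('a) * r ^ DIM('a)"
  unfolding unit_vol_def by (simp add: content_cball content_ball)

lemma rad_pos: "0 < t \<Longrightarrow> 0 < rad TYPE('a::euclidean_space) t N"
  using unit_vol_pos[where 'a='a] by (simp add: rad_def)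

lemma rad_power:
  "0 < t \<Longrightarrow> rad TYPE('a::euclidean_space) t N ^ DIM('a) = t / (unit_vol TYPE('a) * real (N + 1))"
  using unit_vol_pos[where 'a='a] by (simp add: rad_def powr_realpow[symmetric] powr_powr del: of_nat_Suc)

lemma rad_less_iff:
  assumes t: "0 < t" and x: "0 \<le> x"
  shows "rad TYPE('a::euclidean_space) t N < x \<longleftrightarrow> t < unit_vol TYPE('a) * real (N + 1) * x ^ DIM('a)"
proof -
  have "rad TYPE('a) t N < x \<longleftrightarrow> rad TYPE('a) t N ^ DIM('a) < x ^ DIM('a)"
    using x rad_pos[OF t, where 'a='a, of N] power_mono_iff[of x "rad TYPE('a) t N" "DIM('a)"]
    by (simp add: not_le[symmetric])
  also have "\<dots> \<longleftrightarrow> t < unit_vol TYPE('a) * real (N + 1) * x ^ DIM('a)"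
    unfolding rad_power[OF t] using unit_vol_pos[where 'a='a] by (simp add: pos_divide_less_eq mult_ac)
  finally show ?thesis .
qed

lemma rad_tendsto: "0 < t \<Longrightarrow> rad TYPE('a::euclidean_space) t \<longlonglongrightarrow> 0"
proof -
  assume t: "0 < t"
  have "(\<lambda>N. t / unit_vol TYPE('a) / real N) \<longlonglongrightarrow> 0" by (rule lim_const_over_n)
  from LIMSEQ_ignore_initial_segment[OF this, of 1]
  have "(\<lambda>N. t / (unit_vol TYPE('a) * real (N + 1))) \<longlonglongrightarrow> 0" by (simp add: divide_divide_eq_left)
  from tendsto_powr2[OF this tendsto_const[of "1 / real DIM('a)"]]
  show ?thesis using t unit_vol_pos[where 'a='a] unfolding rad_def[abs_def] by simp
qed

lemma rad_shift_eventually_less: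
  assumes "0 < t" "0 < e"
  shows "\<forall>\<^sub>F n in sequentially. rad TYPE('a::euclidean_space) t (n - c) < e"
  using filterlim_compose[OF rad_tendsto[OF assms(1), where 'a='a] filterlim_minus_const_nat_at_top] assms(2)
  by (rule order_tendstoD)

text \<open>The ball mass times \<open>N + 1\<close> is \<open>t\<close> times a ball average, so
  Lebesgue differentiation gives the rate. The offset \<open>c\<close> separates the sample size
  \<open>n\<close> from the index \<open>N = n - c\<close>: \<open>c = 2\<close> serves the
  \<open>X\<close> sample, with ball volume \<open>t / (n - 1)\<close>, and \<open>c = 1\<close> the
  \<open>Y\<close> sample, with volume \<open>t / m\<close>.\<close>

lemma ball_mass_rate:
  fixes p :: "'a::euclidean_space \<Rightarrow> real"
  assumes p: "is_density p" and t: "0 < t"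
  shows "AE x in lborel. (\<lambda>n. real n * measure (density lborel p) (cball x (rad TYPE('a) t (n - c)))) \<longlonglongrightarrow> p x * t"
  using lebesgue_differentiation[OF p rad_pos[OF t, where 'a='a] rad_tendsto[OF t, where 'a='a]]
proof eventually_elim
  case (elim x)
  let ?m = "\<lambda>N. measure (density lborel p) (cball x (rad TYPE('a) t N))"
  have eq: "ball_avg p (rad TYPE('a) t N) x * t = real (N + 1) * ?m N" for N
  proof -
    have "measure lborel (cball x (rad TYPE('a) t N)) = t / real (N + 1)"
      using measure_cball_unit_vol[of "rad TYPE('a) t N" x] rad_power[OF t, where 'a='a, of N]
        rad_pos[OF t, where 'a='a, of N] unit_vol_pos[where 'a='a]
      by (simp del: of_nat_Suc)
    then show ?thesis using t by (simp add: ball_avg_def del: of_nat_Suc)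
  qed
  have 1: "(\<lambda>N. real (N + 1) * ?m N) \<longlonglongrightarrow> p x * t"
    unfolding eq[symmetric] by (intro tendsto_mult elim tendsto_const)
  \<comment> \<open>This leads to the factor \<open>(N + c) / (N + 1)\<close>, which passes from
    \<open>N + 1\<close> to the sample size.\<close>
  have "(\<lambda>N. 1 + (real c - 1) / real N) \<longlonglongrightarrow> 1 + 0" by (intro tendsto_intros lim_const_over_n)
  from LIMSEQ_ignore_initial_segment[OF this, of 1]
  have "(\<lambda>N. 1 + (real c - 1) / real (N + 1)) \<longlonglongrightarrow> 1" by simp
  from tendsto_mult[OF 1 this]
  have "(\<lambda>N. real (N + 1) * ?m N * (1 + (real c - 1) / real (N + 1))) \<longlonglongrightarrow> p x * t" by simp
  also have "(\<lambda>N. real (N + 1) * ?m N * (1 + (real c - 1) / real (N + 1))) = (\<lambda>N. real (N + c) * ?m (N + c - c))"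
    by (intro ext) (simp add: field_simps del: of_nat_Suc, simp add: algebra_simps)
  finally show ?case by (rule LIMSEQ_offset)
qed

definition Gval :: "nat \<Rightarrow> nat \<Rightarrow> (nat \<Rightarrow> 'a::euclidean_space) \<Rightarrow> nat \<Rightarrow> real" where
  "Gval k n X i = unit_vol TYPE('a) * (real n - 1) * rho_k k n X i ^ DIM('a)"

definition Hval :: "nat \<Rightarrow> nat \<Rightarrow> (nat \<Rightarrow> 'a::euclidean_space) \<Rightarrow> 'a \<Rightarrow> real" where
  "Hval k m Y x = unit_vol TYPE('a) * real m * nu_k k m Y x ^ DIM('a)"

lemma hit_eq_thresholds:
  fixes X Y :: "nat \<Rightarrow> 'a::euclidean_space"
  assumes k: "1 \<le> k" and n: "k < n" "k \<le> m" and i: "i < n" and s: "0 < s" and t: "0 < t"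
  shows "hit k n m (rad TYPE('a) s (n - 2)) (rad TYPE('a) t (m - 1)) i (X, Y)
    = (if s < Gval k n X i then 1 else 0) * (if t < Hval k m Y (X i) then 1 else 0)"
proof -
  have n1: "real (n - 2 + 1) = real n - 1" "real (m - 1 + 1) = real m" using k n by auto
  have "few k ({..<n} - {i}) X (X i) (rad TYPE('a) s (n - 2)) \<longleftrightarrow> s < Gval k n X i"
    using rad_less_iff[OF s rho_k_nonneg[OF k n(1) i], of "n - 2" X]
    unfolding rho_k_greater_iff[OF k n(1) i] n1 Gval_def .
  moreover have "few k {..<m} Y (X i) (rad TYPE('a) t (m - 1)) \<longleftrightarrow> t < Hval k m Y (X i)"
    using rad_less_iff[OF t nu_k_nonneg[OF k n(2)], of "m - 1" Y "X i"]
    unfolding nu_k_greater_iff[OF k n(2)] n1 Hval_def .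
  ultimately show ?thesis by (simp add: hit_def)
qed

text \<open>Written through \<open>hit_frac\<close>, so that it is a fixed finite combination of
  frequencies: measurability, a bound uniform in the sample sizes and the mean-square limit are
  inherited term by term. For \<open>k < n\<close>, \<open>k \<le> m\<close> and positive
  \<open>j\<close> it is the average of products of step functions.\<close>

definition step_est :: "nat \<Rightarrow> real \<Rightarrow> real \<Rightarrow> nat \<Rightarrow> nat \<Rightarrow> nat \<Rightarrow>
    (nat \<Rightarrow> 'a::euclidean_space) \<times> (nat \<Rightarrow> 'a) \<Rightarrow> real" where
  "step_est k a b j n m w = (\<Sum>(i, i')\<in>{1..j * j} \<times> {1..j * j}.
     ((lvl a j i - lvl a j (i - 1)) * (lvl b j i' - lvl b j (i' - 1))) *
     hit_frac k n m (rad TYPE('a) (real i / real j) (n - 2)) (rad TYPE('a) (real i' / real j) (m - 1)) w)"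

lemma step_est_eq:
  fixes X Y :: "nat \<Rightarrow> 'a::euclidean_space"
  assumes k: "1 \<le> k" and n: "k < n" "k \<le> m" and j: "0 < j"
  shows "step_est k a b j n m (X, Y)
    = (\<Sum>l<n. step a j (Gval k n X l) * step b j (Hval k m Y (X l))) / real n"
proof -
  let ?I = "{1..j * j}"
  let ?c = "\<lambda>a i. lvl a j i - lvl a j (i - 1)"
  have "step_est k a b j n m (X, Y) = (\<Sum>(i, i')\<in>?I \<times> ?I. \<Sum>l<n. (?c a i * ?c b i') *
     ((if real i / real j < Gval k n X l then 1 else 0) * (if real i' / real j < Hval k m Y (X l) then 1 else 0)) / real n)"
    unfolding step_est_def hit_frac_def
  proof (intro sum.cong refl, clarify)
    fix i i' assume "i \<in> ?I" "i' \<in> ?I"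
    then have "0 < real i / real j" "0 < real i' / real j" using j by auto
    note h = hit_eq_thresholds[OF k n _ this, of _ X Y]
    show "(?c a i * ?c b i') * ((\<Sum>l<n. hit k n m (rad TYPE('a) (real i / real j) (n - 2))
        (rad TYPE('a) (real i' / real j) (m - 1)) l (X, Y)) / real n)
      = (\<Sum>l<n. (?c a i * ?c b i') * ((if real i / real j < Gval k n X l then 1 else 0) *
          (if real i' / real j < Hval k m Y (X l) then 1 else 0)) / real n)"
      unfolding sum_divide_distrib[symmetric] sum_distrib_left[symmetric] using h by simp
  qed
  also have "\<dots> = (\<Sum>l<n. \<Sum>(i, i')\<in>?I \<times> ?I. (?c a i * ?c b i') *
     ((if real i / real j < Gval k n X l then 1 else 0) * (if real i' / real j < Hval k m Y (X l) then 1 else 0)) / real n)"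
    unfolding split_beta by (rule sum.swap)
  also have "\<dots> = (\<Sum>l<n. step a j (Gval k n X l) * step b j (Hval k m Y (X l)) / real n)"
    unfolding step_def sum_product sum_divide_distrib sum.cartesian_product
    by (intro sum.cong refl) (auto simp: mult_ac)
  finally show ?thesis by (simp add: sum_divide_distrib)
qed

text \<open>What remains of \<open>B_const\<close> once the powers of the unit ball volume are
  absorbed into \<open>Gval\<close> and \<open>Hval\<close>.\<close>

definition K_const :: "nat \<Rightarrow> real \<Rightarrow> real \<Rightarrow> real" where
  "K_const k a b = Gamma (real k) ^ 2 / (Gamma (real k - a) * Gamma (real k - b))"

lemma powr_normalised:
  fixes x c y :: real
  assumes "0 < c" "0 \<le> y" "0 \<le> x" "0 < d"
  shows "(c * y * x ^ d) powr - a = c powr - a * y powr - a * x powr (- real d * a)"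
proof -
  have "(x ^ d) powr - a = x powr (- real d * a)"
  \<comment> \<open>At 0 both sides vanish, since \<open>0 powr e = 0\<close> for every
    \<open>e\<close>, including \<open>e = 0\<close>.\<close>
  proof (cases "x = 0")
    case False
    then show ?thesis using assms by (simp add: powr_realpow[symmetric] powr_powr)
  qed (use assms in simp)
  then show ?thesis using assms by (simp add: powr_mult)
qed

lemma D_est_eq:
  fixes X Y :: "nat \<Rightarrow> 'a::euclidean_space"
  assumes k: "1 \<le> k" and n: "k < n" "k \<le> m"
  shows "D_est k a b n m X Y
    = K_const k a b * ((\<Sum>l<n. Gval k n X l powr - a * Hval k m Y (X l) powr - b) / real n)"
proof -
  let ?c = "unit_vol TYPE('a)"
  have c: "0 < ?c" by (rule unit_vol_pos)
  have "(\<Sum>l<n. Gval k n X l powr - a * Hval k m Y (X l) powr - b)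
    = (\<Sum>l<n. (?c powr (- a - b) * (real n - 1) powr - a * real m powr - b) *
       (rho_k k n X l powr (- real DIM('a) * a) * nu_k k m Y (X l) powr (- real DIM('a) * b)))"
  proof (intro sum.cong refl)
    fix l assume "l \<in> {..<n}"
    then have l: "l < n" by simp
    have "?c powr (- a - b) = ?c powr - a * ?c powr - b"
      by (simp add: powr_add[symmetric])
    then show "Gval k n X l powr - a * Hval k m Y (X l) powr - b
      = (?c powr (- a - b) * (real n - 1) powr - a * real m powr - b) *
       (rho_k k n X l powr (- real DIM('a) * a) * nu_k k m Y (X l) powr (- real DIM('a) * b))"
      using powr_normalised[OF c _ rho_k_nonneg[OF k n(1) l, of X], of "real n - 1" "DIM('a)" a]
        powr_normalised[OF c _ nu_k_nonneg[OF k n(2), of Y "X l"], of "real m" "DIM('a)" b] k n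
      by (simp add: Gval_def Hval_def mult_ac)
  qed
  then show ?thesis
    by (simp add: D_est_def B_const_def K_const_def sum_distrib_left[symmetric] powr_minus divide_inverse mult_ac)
qed

text \<open>Since \<open>0 \<le> step \<le> powr\<close>, the squared error of one summand is at most the difference of the squares;
  the latter is the summand of the estimator with doubled exponents.\<close>
lemma step_est_error:
  fixes X Y :: "nat \<Rightarrow> 'a::euclidean_space"
  assumes k: "1 \<le> k" and n: "k < n" "k \<le> m" and j: "0 < j"
    and K: "0 \<le> K_const k a b" "0 < K_const k (2 * a) (2 * b)"
  shows "(D_est k a b n m X Y - K_const k a b * step_est k a b j n m (X, Y))\<^sup>2
    \<le> (K_const k a b)\<^sup>2 / K_const k (2 * a) (2 * b) * D_est k (2 * a) (2 * b) n m X Y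
      - (K_const k a b)\<^sup>2 * step_est k (2 * a) (2 * b) j n m (X, Y)"
proof -
  have n0: "0 < real n" using n by simp
  define z where "z l = Gval k n X l powr - a * Hval k m Y (X l) powr - b" for l
  define u where "u l = step a j (Gval k n X l) * step b j (Hval k m Y (X l))" for l
  \<comment> \<open>Coincident points give volume 0. No positive threshold lies below 0 and
    \<open>0 powr - e\<close> is 0, so the minorant property survives there.\<close>
  have step_le': "step e j g \<le> g powr - e" if "0 \<le> g" for e g
  proof (cases "g = 0")
    case True
    have "step e j 0 = 0" by (auto simp: step_def divide_less_0_iff intro!: sum.neutral)
    then show ?thesis using True by simp
  next
    case False
    then show ?thesis using that j by (intro step_le) auto
  qed
  have G: "0 \<le> Gval k n X l" if "l < n" for l
    using rho_k_nonneg[OF k n(1) that, of X] n unit_vol_pos[where 'a='a] by (simp add: Gval_def)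
  have H: "0 \<le> Hval k m Y (X l)" for l
    using nu_k_nonneg[OF k n(2), of Y "X l"] unit_vol_pos[where 'a='a] by (simp add: Hval_def)
  have uz: "0 \<le> u l" "u l \<le> z l" if "l < n" for l
    unfolding u_def z_def using j G[OF that] H
    by (auto intro!: mult_nonneg_nonneg step_nonneg mult_mono step_le')
  have z2: "(z l)\<^sup>2 = Gval k n X l powr - (2 * a) * Hval k m Y (X l) powr - (2 * b)" for l
  proof -
    have "(x powr - e)\<^sup>2 = x powr - (2 * e)" for x e :: real
      by (cases "x = 0") (simp_all add: power2_eq_square powr_add[symmetric])
    then show ?thesis by (simp add: z_def power_mult_distrib)
  qed
  have u2: "(u l)\<^sup>2 = step (2 * a) j (Gval k n X l) * step (2 * b) j (Hval k m Y (X l))" for l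
    using j by (simp add: u_def power_mult_distrib step_square)
  have "(D_est k a b n m X Y - K_const k a b * step_est k a b j n m (X, Y))\<^sup>2
    = (K_const k a b)\<^sup>2 * ((\<Sum>l<n. z l - u l) / real n)\<^sup>2"
    unfolding D_est_eq[OF k n] step_est_eq[OF k n j] z_def[symmetric] u_def[symmetric]
      power_mult_distrib[symmetric] by (simp add: sum_subtractf diff_divide_distrib right_diff_distrib)
  also have "\<dots> \<le> (K_const k a b)\<^sup>2 * ((\<Sum>l<n. (z l)\<^sup>2 - (u l)\<^sup>2) / real n)"
  proof (intro mult_left_mono)
    have "(\<Sum>l<n. z l - u l)\<^sup>2 \<le> real n * (\<Sum>l<n. (z l - u l)\<^sup>2)"
      using Cauchy_Schwarz_ineq_sum[of "\<lambda>_. 1" "\<lambda>l. z l - u l" "{..<n}"] by simp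
    also have "\<dots> \<le> real n * (\<Sum>l<n. (z l)\<^sup>2 - (u l)\<^sup>2)"
    proof (intro mult_left_mono sum_mono)
      fix l assume "l \<in> {..<n}"
      then have "u l * u l \<le> u l * z l" using uz[of l] by (intro mult_left_mono) auto
      then show "(z l - u l)\<^sup>2 \<le> (z l)\<^sup>2 - (u l)\<^sup>2" by (simp add: power2_eq_square algebra_simps)
    qed simp
    finally show "((\<Sum>l<n. z l - u l) / real n)\<^sup>2 \<le> (\<Sum>l<n. (z l)\<^sup>2 - (u l)\<^sup>2) / real n"
      using n0 by (simp add: power_divide power2_eq_square field_simps)
  qed simp
  also have "\<dots> = (K_const k a b)\<^sup>2 / K_const k (2 * a) (2 * b) * D_est k (2 * a) (2 * b) n m X Y
      - (K_const k a b)\<^sup>2 * step_est k (2 * a) (2 * b) j n m (X, Y)"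
    unfolding D_est_eq[OF k n] step_est_eq[OF k n j] z2[symmetric] u2[symmetric] using K(2)
    by (simp add: sum_subtractf diff_divide_distrib right_diff_distrib)
  finally show ?thesis .
qed

section \<open>Consistency\<close>

text \<open>Nonnegativity of the variance.\<close>

lemma integral_square_ge_square_integral:
  assumes "prob_space R" and f: "integrable R f" and f2: "integrable R (\<lambda>w. (f w)\<^sup>2)"
  shows "(\<integral>w. f w \<partial>R)\<^sup>2 \<le> (\<integral>w. (f w)\<^sup>2 \<partial>R :: real)"
proof -
  interpret prob_space R by fact
  let ?m = "\<integral>w. f w \<partial>R"
  have "0 \<le> (\<integral>w. (f w - ?m)\<^sup>2 \<partial>R)" by simp
  also have "\<dots> = (\<integral>w. (f w)\<^sup>2 \<partial>R) - ?m\<^sup>2"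
    by (rule variance_eq[OF f f2])
  finally show ?thesis by simp
qed

text \<open>The probability space changes with \<open>z\<close>, so |E f - l| \<le> sqrt (E (f -
  l)^2) is proved on each space separately before passing to the limit. The uniform bound on
  \<open>f\<close> supplies integrability.\<close>

lemma mean_tendsto_of_L2:
  fixes f :: "'b \<Rightarrow> 'w \<Rightarrow> real"
  assumes R: "\<And>z. prob_space (R z)" and f: "\<And>z. f z \<in> borel_measurable (R z)" "\<And>z w. \<bar>f z w\<bar> \<le> B"
    and lim: "((\<lambda>z. \<integral>w. (f z w - l)\<^sup>2 \<partial>R z) \<longlongrightarrow> 0) F"
  shows "((\<lambda>z. \<integral>w. f z w \<partial>R z) \<longlongrightarrow> l) F"
proof -
  have bound: "\<bar>(\<integral>w. f z w \<partial>R z) - l\<bar> \<le> sqrt (\<integral>w. (f z w - l)\<^sup>2 \<partial>R z)" for z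
  proof -
    interpret prob_space "R z" by (rule R)
    have i1: "integrable (R z) (f z)"
      using f by (intro integrable_const_bound[where B = B]) auto
    have i2: "integrable (R z) (\<lambda>w. (f z w - l)\<^sup>2)"
    proof (intro integrable_const_bound[where B = "(B + \<bar>l\<bar>)\<^sup>2"] AE_I2)
      fix w
      have "\<bar>f z w - l\<bar> \<le> B + \<bar>l\<bar>" using f(2)[of z w] by linarith
      then show "norm ((f z w - l)\<^sup>2) \<le> (B + \<bar>l\<bar>)\<^sup>2"
        using power_mono[of "\<bar>f z w - l\<bar>" "B + \<bar>l\<bar>" 2] by simp
    qed (use f in measurable)
    have "(\<integral>w. f z w - l \<partial>R z)\<^sup>2 \<le> (\<integral>w. (f z w - l)\<^sup>2 \<partial>R z)"
      using i1 i2 by (intro integral_square_ge_square_integral prob_space_axioms) auto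
    moreover have "(\<integral>w. f z w - l \<partial>R z) = (\<integral>w. f z w \<partial>R z) - l"
      using i1 by (simp add: prob_space)
    ultimately show ?thesis by (metis real_sqrt_abs real_sqrt_le_mono)
  qed
  have "((\<lambda>z. (\<integral>w. f z w \<partial>R z) - l) \<longlongrightarrow> 0) F"
  proof (rule Lim_null_comparison)
    show "\<forall>\<^sub>F z in F. norm ((\<integral>w. f z w \<partial>R z) - l) \<le> sqrt (\<integral>w. (f z w - l)\<^sup>2 \<partial>R z)"
      using bound by (intro always_eventually) auto
    show "((\<lambda>z. sqrt (\<integral>w. (f z w - l)\<^sup>2 \<partial>R z)) \<longlongrightarrow> 0) F"
      using tendsto_real_sqrt[OF lim] by simp
  qed
  then show ?thesis by (simp add: LIM_zero_iff)
qed

text \<open>Cauchy-Schwarz over the finite index set bounds the squared error of the combination by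
  the sum of the squared coefficients times the sum of the individual squared errors.\<close>

lemma linear_combination_L2:
  fixes f :: "'i \<Rightarrow> 'b \<Rightarrow> 'w \<Rightarrow> real"
  assumes I: "finite I" and R: "\<And>z. prob_space (R z)"
    and f: "\<And>i z. i \<in> I \<Longrightarrow> f i z \<in> borel_measurable (R z)" "\<And>i z w. i \<in> I \<Longrightarrow> \<bar>f i z w\<bar> \<le> B"
    and lim: "\<And>i. i \<in> I \<Longrightarrow> ((\<lambda>z. \<integral>w. (f i z w - l i)\<^sup>2 \<partial>R z) \<longlongrightarrow> 0) F"
  shows "((\<lambda>z. \<integral>w. ((\<Sum>i\<in>I. c i * f i z w) - (\<Sum>i\<in>I. c i * l i))\<^sup>2 \<partial>R z) \<longlongrightarrow> 0) F"
proof -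
  have bound: "(\<integral>w. ((\<Sum>i\<in>I. c i * f i z w) - (\<Sum>i\<in>I. c i * l i))\<^sup>2 \<partial>R z)
      \<le> (\<Sum>i\<in>I. (c i)\<^sup>2) * (\<Sum>i\<in>I. \<integral>w. (f i z w - l i)\<^sup>2 \<partial>R z)" for z
  proof -
    interpret prob_space "R z" by (rule R)
    have i2: "integrable (R z) (\<lambda>w. (f i z w - l i)\<^sup>2)" if "i \<in> I" for i
    proof (intro integrable_const_bound[where B = "(B + \<bar>l i\<bar>)\<^sup>2"] AE_I2)
      fix w
      have "\<bar>f i z w - l i\<bar> \<le> B + \<bar>l i\<bar>" using f(2)[OF that, of z w] by linarith
      then show "norm ((f i z w - l i)\<^sup>2) \<le> (B + \<bar>l i\<bar>)\<^sup>2"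
        using power_mono[of "\<bar>f i z w - l i\<bar>" "B + \<bar>l i\<bar>" 2] by simp
    qed (use f that in measurable)
    have pt: "((\<Sum>i\<in>I. c i * f i z w) - (\<Sum>i\<in>I. c i * l i))\<^sup>2
        \<le> (\<Sum>i\<in>I. (c i)\<^sup>2) * (\<Sum>i\<in>I. (f i z w - l i)\<^sup>2)" for w
      using Cauchy_Schwarz_ineq_sum[of c "\<lambda>i. f i z w - l i" I]
      by (simp add: sum_subtractf right_diff_distrib)
    have "(\<integral>w. ((\<Sum>i\<in>I. c i * f i z w) - (\<Sum>i\<in>I. c i * l i))\<^sup>2 \<partial>R z)
        \<le> (\<integral>w. (\<Sum>i\<in>I. (c i)\<^sup>2) * (\<Sum>i\<in>I. (f i z w - l i)\<^sup>2) \<partial>R z)"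
    proof (rule integral_mono')
      show "integrable (R z) (\<lambda>w. (\<Sum>i\<in>I. (c i)\<^sup>2) * (\<Sum>i\<in>I. (f i z w - l i)\<^sup>2))"
        using i2 by (intro integrable_mult_right Bochner_Integration.integrable_sum)
    qed (use pt in \<open>auto intro!: mult_nonneg_nonneg sum_nonneg\<close>)
    also have "\<dots> = (\<Sum>i\<in>I. (c i)\<^sup>2) * (\<Sum>i\<in>I. \<integral>w. (f i z w - l i)\<^sup>2 \<partial>R z)"
      using i2 by (subst integral_mult_right_zero, subst Bochner_Integration.integral_sum) auto
    finally show ?thesis .
  qed
  show ?thesis
  proof (rule Lim_null_comparison)
    show "\<forall>\<^sub>F z in F. norm (\<integral>w. ((\<Sum>i\<in>I. c i * f i z w) - (\<Sum>i\<in>I. c i * l i))\<^sup>2 \<partial>R z)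
        \<le> (\<Sum>i\<in>I. (c i)\<^sup>2) * (\<Sum>i\<in>I. \<integral>w. (f i z w - l i)\<^sup>2 \<partial>R z)"
      using bound by (intro always_eventually) auto
    have "((\<lambda>z. (\<Sum>i\<in>I. (c i)\<^sup>2) * (\<Sum>i\<in>I. \<integral>w. (f i z w - l i)\<^sup>2 \<partial>R z))
        \<longlongrightarrow> (\<Sum>i\<in>I. (c i)\<^sup>2) * (\<Sum>i\<in>I. 0)) F"
      by (intro tendsto_mult tendsto_const tendsto_sum lim)
    then show "((\<lambda>z. (\<Sum>i\<in>I. (c i)\<^sup>2) * (\<Sum>i\<in>I. \<integral>w. (f i z w - l i)\<^sup>2 \<partial>R z)) \<longlongrightarrow> 0) F"
      by simp
  qed
qed

section \<open>Limits of the step estimators\<close>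

definition step_lim :: "nat \<Rightarrow> real \<Rightarrow> real \<Rightarrow> nat \<Rightarrow> ('a::euclidean_space \<Rightarrow> real) \<Rightarrow> ('a \<Rightarrow> real) \<Rightarrow> real" where
  "step_lim k a b j p q = (\<integral>x. step_hat k a j (p x) * step_hat k b j (q x) \<partial>density lborel p)"

lemma prob_space_density: "is_density p \<Longrightarrow> prob_space (density lborel p)"
  by (rule prob_spaceI) (auto simp: is_density_def emeasure_density)

lemma two_sample_density:
  "is_density p \<Longrightarrow> is_density q \<Longrightarrow> two_sample (density lborel p) (density lborel q)"
  by (simp add: two_sample_def two_sample_axioms_def prob_space_density)

lemma density_AE_of_lborel:
  fixes p :: "'a::euclidean_space \<Rightarrow> real"
  assumes "is_density p" "AE x in lborel. P x"
  shows "AE x in density lborel p. P x"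
  using assms(2) assms(1) by (subst AE_density) (auto simp: is_density_def elim!: eventually_mono)

lemma density_atomless:
  fixes p :: "'a::euclidean_space \<Rightarrow> real"
  assumes "is_density p"
  shows "emeasure (density lborel p) {x} = 0"
proof -
  have "AE y in density lborel p. y \<notin> {x}"
    using assms AE_lborel_singleton[of x] by (intro density_AE_of_lborel) auto
  then show ?thesis by (subst (asm) AE_iff_null_sets[symmetric]) auto
qed

text \<open>The coefficients are those of \<open>step_est\<close>, so convergence can be checked for
  one pair of thresholds at a time.\<close>

lemma step_lim_eq_sum:
  fixes p q :: "'a::euclidean_space \<Rightarrow> real"
  assumes k: "0 < k" and p: "is_density p" and q: "is_density q"
  shows "step_lim k a b j p q = (\<Sum>(i, i')\<in>{1..j * j} \<times> {1..j * j}.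
     ((lvl a j i - lvl a j (i - 1)) * (lvl b j i' - lvl b j (i' - 1))) *
     (\<integral>x. poisson_cdf k (p x * (real i / real j)) * poisson_cdf k (q x * (real i' / real j)) \<partial>density lborel p))"
proof -
  interpret M: prob_space "density lborel p" using p by (rule prob_space_density)
  have [measurable]: "p \<in> borel_measurable borel" "q \<in> borel_measurable borel"
    and pos: "\<And>x. 0 \<le> p x" "\<And>x. 0 \<le> q x" using p q by (auto simp: is_density_def)
  let ?f = "\<lambda>i i' x. poisson_cdf k (p x * (real i / real j)) * poisson_cdf k (q x * (real i' / real j))"
  have int: "integrable (density lborel p) (?f i i')" for i i'
  proof (intro M.integrable_const_bound[where B = 1] AE_I2)
    fix x
    have "0 \<le> p x * (real i / real j)" "0 \<le> q x * (real i' / real j)" using pos by auto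
    note b = poisson_cdf_bounds[OF k this(1)] poisson_cdf_bounds[OF k this(2)]
    show "norm (?f i i' x) \<le> 1" using mult_unit_interval[OF b] by simp
  qed simp
  have "step_lim k a b j p q = (\<integral>x. (\<Sum>(i, i')\<in>{1..j * j} \<times> {1..j * j}.
     ((lvl a j i - lvl a j (i - 1)) * (lvl b j i' - lvl b j (i' - 1))) * ?f i i' x) \<partial>density lborel p)"
    unfolding step_lim_def step_hat_def sum_product sum.cartesian_product
    by (intro Bochner_Integration.integral_cong refl sum.cong) (auto simp: mult_ac)
  also have "\<dots> = (\<Sum>(i, i')\<in>{1..j * j} \<times> {1..j * j}.
     ((lvl a j i - lvl a j (i - 1)) * (lvl b j i' - lvl b j (i' - 1))) * (\<integral>x. ?f i i' x \<partial>density lborel p))"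
    using int by (simp add: split_beta Bochner_Integration.integral_sum)
  finally show ?thesis .
qed

lemma step_est_measurable:
  fixes p q :: "'a::euclidean_space \<Rightarrow> real"
  assumes "is_density p" "is_density q"
  shows "step_est k a b j n m \<in> borel_measurable (sample_space p q n m)"
proof -
  interpret two_sample "density lborel p" "density lborel q"
    using assms by (rule two_sample_density)
  show ?thesis
    unfolding step_est_def[abs_def] sample_space_def split_beta
    by (intro borel_measurable_sum borel_measurable_times borel_measurable_const hit_frac_measurable)
qed

lemma step_est_bounded: "\<exists>B. \<forall>n m w. \<bar>step_est k a b j n m w\<bar> \<le> B"
proof (intro exI allI)
  fix n m and w :: "(nat \<Rightarrow> 'a) \<times> (nat \<Rightarrow> 'a)"
  let ?c = "\<lambda>i i'. (lvl a j i - lvl a j (i - 1)) * (lvl b j i' - lvl b j (i' - 1))"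
  show "\<bar>step_est k a b j n m w\<bar> \<le> (\<Sum>(i, i')\<in>{1..j * j} \<times> {1..j * j}. \<bar>?c i i'\<bar>)"
    unfolding step_est_def
  proof (rule order_trans[OF sum_abs], rule sum_mono, clarify)
    fix i i'
    show "\<bar>?c i i' * hit_frac k n m (rad TYPE('a) (real i / real j) (n - 2))
        (rad TYPE('a) (real i' / real j) (m - 1)) w\<bar> \<le> \<bar>?c i i'\<bar>"
      unfolding abs_mult[of "?c i i'"]
      by (rule mult_right_le_one_le) (simp_all add: hit_frac_bounds)
  qed
qed

lemma prob_space_sample:
  assumes "is_density p" "is_density q"
  shows "prob_space (sample_space p q n m)"
  using two_sample.prob_space_S[OF two_sample_density[OF assms]] by (simp add: sample_space_def)

lemma step_est_tendsto_L2:
  fixes p q :: "'a::euclidean_space \<Rightarrow> real"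
  assumes k: "0 < k" and p: "is_density p" and q: "is_density q" and j: "0 < j"
  shows "((\<lambda>z. \<integral>w. (step_est k a b j (fst z) (snd z) w - step_lim k a b j p q)\<^sup>2
      \<partial>sample_space p q (fst z) (snd z)) \<longlongrightarrow> 0) (sequentially \<times>\<^sub>F sequentially)"
proof -
  interpret two_sample "density lborel p" "density lborel q"
    using p q by (rule two_sample_density)
  have [measurable]: "p \<in> borel_measurable borel" "q \<in> borel_measurable borel"
    and pos: "\<And>x. 0 \<le> p x" "\<And>x. 0 \<le> q x" using p q by (auto simp: is_density_def)
  have lim: "((\<lambda>z. \<integral>w. (hit_frac k (fst z) (snd z) (rad TYPE('a) (real i / real j) (fst z - 2))
        (rad TYPE('a) (real i' / real j) (snd z - 1)) w -
      (\<integral>x. poisson_cdf k (p x * (real i / real j)) * poisson_cdf k (q x * (real i' / real j))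
        \<partial>density lborel p))\<^sup>2 \<partial>S (fst z) (snd z)) \<longlongrightarrow> 0) (sequentially \<times>\<^sub>F sequentially)"
    if "0 < i" "0 < i'" for i i'
  proof -
    have t: "0 < real i / real j" "0 < real i' / real j" using that j by auto
    have "((\<lambda>(n, m). \<integral>w. (hit_frac k n m (rad TYPE('a) (real i / real j) (n - 2))
        (rad TYPE('a) (real i' / real j) (m - 1)) w -
      (\<integral>x. poisson_cdf k (p x * (real i / real j)) * poisson_cdf k (q x * (real i' / real j))
        \<partial>density lborel p))\<^sup>2 \<partial>S n m) \<longlongrightarrow> 0) (sequentially \<times>\<^sub>F sequentially)"
    proof (rule hit_frac_tendsto_L2[OF k density_atomless[OF p]])
      show "AE x in density lborel p. (\<lambda>n. real n *
          M.prob (cball x (rad TYPE('a) (real i / real j) (n - 2)))) \<longlonglongrightarrow> p x * (real i / real j)"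
        by (intro density_AE_of_lborel p ball_mass_rate t)
      show "AE x in density lborel p. (\<lambda>m. real m *
          N.prob (cball x (rad TYPE('a) (real i' / real j) (m - 1)))) \<longlonglongrightarrow> q x * (real i' / real j)"
        by (intro density_AE_of_lborel p q ball_mass_rate t)
    qed (use pos t in \<open>auto intro: rad_shift_eventually_less\<close>)
    then show ?thesis by (simp add: split_beta')
  qed
  show ?thesis
    unfolding step_lim_eq_sum[OF k p q] step_est_def sample_space_def split_beta
    by (rule linear_combination_L2[where B = 1])
      (use lim in \<open>auto simp: prob_space_S hit_frac_bounds abs_of_nonneg\<close>)
qed

text \<open>\<open>epow\<close> is infinite at base 0 with a negative exponent, so for
  \<open>b < 0\<close> finiteness forces \<open>q\<close> to be positive almost everywhere under
  \<open>p\<close>. Off that null set \<open>epow\<close> agrees with \<open>pw\<close>, and the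
  extended integral becomes a Bochner integral.\<close>

lemma Dab_finite:
  fixes p q :: "'a::euclidean_space \<Rightarrow> real"
  assumes p: "is_density p" and q: "is_density q" and fin: "Dab a b p q < \<infinity>"
  shows "AE x in density lborel p. 0 < p x \<and> (0 < q x \<or> q x = 0 \<and> 0 \<le> b)"
    and "integrable (density lborel p) (\<lambda>x. pw a (p x) * pw b (q x))"
    and "(\<integral>x. pw a (p x) * pw b (q x) \<partial>density lborel p) = enn2real (Dab a b p q)"
proof -
  let ?M = "density lborel p"
  have [measurable]: "p \<in> borel_measurable borel" "q \<in> borel_measurable borel"
    and pos: "\<And>x. 0 \<le> p x" "\<And>x. 0 \<le> q x" using p q by (auto simp: is_density_def)
  have [measurable]: "(\<lambda>x. epow (p x) e) \<in> borel_measurable borel"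
    "(\<lambda>x. epow (q x) e) \<in> borel_measurable borel" for e
    unfolding epow_def by measurable
  have "Dab a b p q = (\<integral>\<^sup>+ x. ennreal (p x) * (epow (p x) a * epow (q x) b) \<partial>lborel)"
    unfolding Dab_def using pos
    by (intro nn_integral_cong) (auto simp: dsupp_def mult_ac less_le split: split_indicator)
  also have "\<dots> = (\<integral>\<^sup>+ x. epow (p x) a * epow (q x) b \<partial>?M)"
    by (subst nn_integral_density) auto
  finally have D: "Dab a b p q = (\<integral>\<^sup>+ x. epow (p x) a * epow (q x) b \<partial>?M)" .
  have "AE x in ?M. epow (p x) a * epow (q x) b \<noteq> \<infinity>"
    using fin by (intro nn_integral_noteq_infinite) (auto simp: D)
  moreover have "AE x in ?M. 0 < p x"
    using pos by (subst AE_density) (auto simp: less_le)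
  ultimately show AE: "AE x in ?M. 0 < p x \<and> (0 < q x \<or> q x = 0 \<and> 0 \<le> b)"
  proof eventually_elim
    case (elim x)
    have "\<not> (q x = 0 \<and> b < 0)"
    proof
      assume "q x = 0 \<and> b < 0"
      then have "epow (p x) a * epow (q x) b = \<infinity>"
        using elim by (simp add: epow_def ennreal_mult_eq_top_iff)
      with elim show False by simp
    qed
    then show ?case using elim pos(2)[of x] by auto
  qed
  have "AE x in ?M. epow (p x) a * epow (q x) b = ennreal (pw a (p x) * pw b (q x))"
    using AE
  proof eventually_elim
    case (elim x)
    then show ?case
      by (cases "b = 0"; cases "a = 0") (auto simp: epow_def pw_def ennreal_mult)
  qed
  then have D': "Dab a b p q = (\<integral>\<^sup>+ x. ennreal (pw a (p x) * pw b (q x)) \<partial>?M)"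
    unfolding D by (rule nn_integral_cong_AE)
  show "integrable ?M (\<lambda>x. pw a (p x) * pw b (q x))"
    using fin by (intro integrableI_nonneg) (auto simp: D')
  show "(\<integral>x. pw a (p x) * pw b (q x) \<partial>?M) = enn2real (Dab a b p q)"
    unfolding D' by (rule integral_eq_nn_integral) auto
qed

text \<open>Dominated convergence under the density \<open>p\<close>: the bounds of
  \<open>step_hat_bounds\<close> multiply to a constant times the integrand of \<open>Dab\<close>,
  which is integrable because \<open>Dab\<close> is finite.\<close>

lemma step_lim_tendsto:
  fixes p q :: "'a::euclidean_space \<Rightarrow> real"
  assumes k: "0 < k" and p: "is_density p" and q: "is_density q" and fin: "Dab a b p q < \<infinity>"
    and a: "a < real k" and b: "b < real k"
  shows "(\<lambda>j. step_lim k a b j p q) \<longlonglongrightarrow> enn2real (Dab a b p q) *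
    ((Gamma (real k - a) / Gamma (real k)) * (Gamma (real k - b) / Gamma (real k)))"
proof -
  have [measurable]: "p \<in> borel_measurable borel" "q \<in> borel_measurable borel"
    using p q by (auto simp: is_density_def)
  let ?A = "Gamma (real k - a) / Gamma (real k)" and ?B = "Gamma (real k - b) / Gamma (real k)"
  let ?f = "\<lambda>x. (pw a (p x) * ?A) * (pw b (q x) * ?B)"
  note AE = Dab_finite(1)[OF p q fin]
  have f: "?f x = pw a (p x) * pw b (q x) * (?A * ?B)" for x by (simp add: mult_ac)
  have "(\<lambda>j. step_lim k a b (Suc j) p q) \<longlonglongrightarrow> (\<integral>x. ?f x \<partial>density lborel p)"
    unfolding step_lim_def
  proof (rule integral_dominated_convergence[where w = ?f])
    show "integrable (density lborel p) ?f"
      unfolding f using Dab_finite(2)[OF p q fin] by (rule integrable_mult_left)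
    show "AE x in density lborel p. (\<lambda>j. step_hat k a (Suc j) (p x) * step_hat k b (Suc j) (q x)) \<longlonglongrightarrow> ?f x"
      using AE
    proof eventually_elim
      case (elim x)
      then show ?case
        by (intro tendsto_mult LIMSEQ_Suc step_hat_tendsto[OF k zero_less_one a] step_hat_tendsto[OF k zero_less_one b]) auto
    qed
    show "AE x in density lborel p. norm (step_hat k a (Suc j) (p x) * step_hat k b (Suc j) (q x)) \<le> ?f x" for j
      using AE
    proof eventually_elim
      case (elim x)
      then have 1: "0 < p x \<or> p x = 0 \<and> 0 \<le> a" and 2: "0 < q x \<or> q x = 0 \<and> 0 \<le> b" by auto
      note A = step_hat_bounds[OF k zero_less_Suc[of j] a 1] and B = step_hat_bounds[OF k zero_less_Suc[of j] b 2]
      have "step_hat k a (Suc j) (p x) * step_hat k b (Suc j) (q x) \<le> ?f x"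
        by (rule mult_mono[OF A(2) B(2) order_trans[OF A(1,2)] B(1)])
      then show ?case using A(1) B(1) by (simp only: real_norm_def abs_of_nonneg mult_nonneg_nonneg)
    qed
  qed auto
  then have "(\<lambda>j. step_lim k a b j p q) \<longlonglongrightarrow> (\<integral>x. ?f x \<partial>density lborel p)"
    by (rule LIMSEQ_imp_Suc)
  also have "(\<integral>x. ?f x \<partial>density lborel p) = enn2real (Dab a b p q) * (?A * ?B)"
    unfolding f integral_mult_left_zero Dab_finite(3)[OF p q fin] ..
  finally show ?thesis .
qed

text \<open>The normalising constant is the reciprocal of the product of the two Erlang
  moments.\<close>

lemma K_const_Gamma:
  assumes "0 < k" "a < real k" "b < real k"
  shows "0 < K_const k a b"
    "K_const k a b * ((Gamma (real k - a) / Gamma (real k)) * (Gamma (real k - b) / Gamma (real k))) = 1"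
proof -
  have "0 < Gamma (real k)" "0 < Gamma (real k - a)" "0 < Gamma (real k - b)"
    using assms by (auto intro!: Gamma_real_pos)
  then show "0 < K_const k a b"
    "K_const k a b * ((Gamma (real k - a) / Gamma (real k)) * (Gamma (real k - b) / Gamma (real k))) = 1"
    by (simp_all add: K_const_def power2_eq_square)
qed

lemma square_sum_le: "(x + y)\<^sup>2 \<le> 2 * x\<^sup>2 + 2 * (y::real)\<^sup>2"
  using zero_le_power2[of "x - y"] by (simp add: power2_eq_square algebra_simps)

theorem theorem3:
  fixes p q :: "'a::euclidean_space \<Rightarrow> real"
    and k :: nat and \<alpha> \<beta> :: real
  assumes k: "k \<ge> 2"
    and dens_p: "is_density p" and dens_q: "is_density q"
    and interior_ae: "AE x in lborel. x \<in> dsupp p \<longrightarrow> x \<in> interior (dsupp p)"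
    and rM: "\<exists>r>0. \<forall>\<delta>\<in>{0<..<1}. \<forall>x\<in>dsupp p.
               measure lborel (cball x \<delta> \<inter> dsupp p) \<ge> r * measure lborel (cball x \<delta>)"
    and alpha: "\<bar>\<alpha>\<bar> < (real k - 1) / 2" and beta: "\<bar>\<beta>\<bar> < (real k - 1) / 2"
    and p_pos: "0 < \<alpha> \<Longrightarrow> (\<exists>c>0. \<forall>x\<in>dsupp p. c \<le> p x) \<and> uniformly_continuous_on (dsupp p) p"
    and p_neg: "\<alpha> < 0 \<Longrightarrow> (\<exists>C. \<forall>x. p x \<le> C)"
    and q_pos: "0 < \<beta> \<Longrightarrow> (\<exists>c>0. \<forall>x\<in>dsupp p. c \<le> q x) \<and> uniformly_continuous_on (dsupp p) q"
    and q_neg: "\<beta> < 0 \<Longrightarrow> (\<exists>C. \<forall>x. q x \<le> C)"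
    and D1_fin: "Dab \<alpha> \<beta> p q < \<infinity>"
    and D2_fin: "Dab (2 * \<alpha>) (2 * \<beta>) p q < \<infinity>"
    and unbiased: "\<And>a b. (a, b) \<in> {(\<alpha>, \<beta>), (2 * \<alpha>, 2 * \<beta>)} \<Longrightarrow>
         (\<forall>\<^sub>F (n, m) in sequentially \<times>\<^sub>F sequentially.
             integrable (sample_space p q n m) (\<lambda>(X, Y). D_est k a b n m X Y)) \<and>
         ((\<lambda>(n, m). \<integral>(X, Y). D_est k a b n m X Y \<partial>sample_space p q n m)
            \<longlongrightarrow> enn2real (Dab a b p q)) (sequentially \<times>\<^sub>F sequentially)"
  shows "((\<lambda>(n, m). \<integral>\<^sup>+ (X, Y). ennreal ((D_est k \<alpha> \<beta> n m X Y - enn2real (Dab \<alpha> \<beta> p q))\<^sup>2)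
             \<partial>sample_space p q n m) \<longlongrightarrow> 0) (sequentially \<times>\<^sub>F sequentially)"
proof -
  let ?F = "sequentially \<times>\<^sub>F sequentially :: (nat \<times> nat) filter"
  let ?R = "\<lambda>z. sample_space p q (fst z) (snd z)"
  define D where "D = enn2real (Dab \<alpha> \<beta> p q)"
  define D2 where "D2 = enn2real (Dab (2 * \<alpha>) (2 * \<beta>) p q)"
  define K where "K = K_const k \<alpha> \<beta>"
  define K2 where "K2 = K_const k (2 * \<alpha>) (2 * \<beta>)"
  define est2 where "est2 z = (\<lambda>(X, Y). D_est k (2 * \<alpha>) (2 * \<beta>) (fst z) (snd z) X (Y :: nat \<Rightarrow> 'a))" for z
  define W :: "nat \<Rightarrow> nat \<times> nat \<Rightarrow> (nat \<Rightarrow> 'a) \<times> (nat \<Rightarrow> 'a) \<Rightarrow> real"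
    where "W j z = step_est k \<alpha> \<beta> j (fst z) (snd z)" for j z
  define V :: "nat \<Rightarrow> nat \<times> nat \<Rightarrow> (nat \<Rightarrow> 'a) \<times> (nat \<Rightarrow> 'a) \<Rightarrow> real"
    where "V j z = step_est k (2 * \<alpha>) (2 * \<beta>) j (fst z) (snd z)" for j z
  define w where "w j = step_lim k \<alpha> \<beta> j p q" for j
  define v where "v j = step_lim k (2 * \<alpha>) (2 * \<beta>) j p q" for j
  have k0: "0 < k" "1 \<le> k" using k by auto
  \<comment> \<open>The bound (k - 1) / 2 keeps even the doubled exponents below \<open>k\<close>,
    so all Gamma arguments are positive.\<close>
  have small: "\<alpha> < real k" "\<beta> < real k" "2 * \<alpha> < real k" "2 * \<beta> < real k"
    using alpha beta by (auto simp: abs_less_iff)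
  note K = K_const_Gamma[OF k0(1) small(1,2), folded K_def]
  note K2 = K_const_Gamma[OF k0(1) small(3,4), folded K2_def]
  have w_lim: "(\<lambda>j. K * w j) \<longlonglongrightarrow> D"
  proof -
    have "(\<lambda>j. K * w j) \<longlonglongrightarrow> K * (D * ((Gamma (real k - \<alpha>) / Gamma (real k)) * (Gamma (real k - \<beta>) / Gamma (real k))))"
      unfolding w_def D_def using D1_fin
      by (intro tendsto_mult tendsto_const step_lim_tendsto k0 dens_p dens_q small)
    then show ?thesis using K(2) by (metis mult.left_commute mult.right_neutral)
  qed
  have v_lim: "(\<lambda>j. K2 * v j) \<longlonglongrightarrow> D2"
  proof -
    have "(\<lambda>j. K2 * v j) \<longlonglongrightarrow> K2 * (D2 * ((Gamma (real k - 2 * \<alpha>) / Gamma (real k)) * (Gamma (real k - 2 * \<beta>) / Gamma (real k))))"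
      unfolding v_def D2_def using D2_fin
      by (intro tendsto_mult tendsto_const step_lim_tendsto k0 dens_p dens_q small)
    then show ?thesis using K2(2) by (metis mult.left_commute mult.right_neutral)
  qed
  \<comment> \<open>Asymptotic unbiasedness at the doubled exponents enters here, as control of the
    second moment.\<close>
  have est2_int: "\<forall>\<^sub>F z in ?F. integrable (?R z) (est2 z)"
    and est2_lim: "((\<lambda>z. \<integral>u. est2 z u \<partial>?R z) \<longlongrightarrow> D2) ?F"
    using unbiased[of "2 * \<alpha>" "2 * \<beta>"] by (simp_all add: est2_def D2_def split_beta')
  \<comment> \<open>The estimator is compared with \<open>K * W\<close>, that with
    \<open>K * w j\<close>, and that with \<open>D\<close>; two uses of \<open>square_sum_le\<close>
    produce the factors 2 and 4.\<close>
  define bnd where "bnd j z = 2 * (K\<^sup>2 / K2 * (\<integral>u. est2 z u \<partial>?R z) - K\<^sup>2 * (\<integral>u. V j z u \<partial>?R z))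
      + 4 * (K\<^sup>2 * (\<integral>u. (W j z u - w j)\<^sup>2 \<partial>?R z)) + 4 * (K * w j - D)\<^sup>2" for j z
  define lim where "lim j = 2 * (K\<^sup>2 / K2 * D2 - K\<^sup>2 * v j) + 4 * (K * w j - D)\<^sup>2" for j
  have bnd_lim: "(bnd j \<longlongrightarrow> lim j) ?F" if j: "0 < j" for j
  proof -
    obtain B where B: "\<And>n m u. \<bar>step_est k (2 * \<alpha>) (2 * \<beta>) j n m (u :: (nat \<Rightarrow> 'a) \<times> (nat \<Rightarrow> 'a))\<bar> \<le> B"
      using step_est_bounded[where 'a = 'a] by blast
    have "((\<lambda>z. \<integral>u. V j z u \<partial>?R z) \<longlongrightarrow> v j) ?F"
      unfolding V_def v_def
      by (rule mean_tendsto_of_L2[OF prob_space_sample[OF dens_p dens_q]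
            step_est_measurable[OF dens_p dens_q] B step_est_tendsto_L2[OF k0(1) dens_p dens_q j]])
    moreover have "((\<lambda>z. \<integral>u. (W j z u - w j)\<^sup>2 \<partial>?R z) \<longlongrightarrow> 0) ?F"
      unfolding W_def w_def by (rule step_est_tendsto_L2[OF k0(1) dens_p dens_q j])
    ultimately have "(bnd j \<longlongrightarrow> 2 * (K\<^sup>2 / K2 * D2 - K\<^sup>2 * v j) + 4 * (K\<^sup>2 * 0) + 4 * (K * w j - D)\<^sup>2) ?F"
      unfolding bnd_def[abs_def] by (intro tendsto_intros est2_lim)
    then show ?thesis by (simp add: lim_def)
  qed
  have lim_lim: "lim \<longlonglongrightarrow> 0"
  proof -
    \<comment> \<open>Writing \<open>K\<^sup>2 * v j\<close> as
      \<open>K\<^sup>2 / K2 * (K2 * v j)\<close> shows that it tends to the second-moment term, so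
      the two cancel.\<close>
    have "(\<lambda>j. 2 * (K\<^sup>2 / K2 * D2 - K\<^sup>2 / K2 * (K2 * v j)) + 4 * (K * w j - D)\<^sup>2)
        \<longlonglongrightarrow> 2 * (K\<^sup>2 / K2 * D2 - K\<^sup>2 / K2 * D2) + 4 * (D - D)\<^sup>2"
      by (intro tendsto_intros w_lim v_lim)
    then show ?thesis using K2(1) by (simp add: lim_def[abs_def])
  qed
  define err where "err z = (\<integral>\<^sup>+ (X, Y). ennreal ((D_est k \<alpha> \<beta> (fst z) (snd z) X Y - D)\<^sup>2) \<partial>?R z)" for z
  have err_le: "\<forall>\<^sub>F z in ?F. err z \<le> ennreal (bnd j z)" if j: "0 < j" for j
  proof -
    have "\<forall>\<^sub>F z in ?F. k < fst z" "\<forall>\<^sub>F z in ?F. k \<le> snd z"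
      using filterlim_fst[of sequentially sequentially] filterlim_snd[of sequentially sequentially]
      by (auto simp: filterlim_at_top Suc_le_eq dest: spec[of _ "Suc k"])
    with est2_int show ?thesis
    proof eventually_elim
      case (elim z)
      interpret prob_space "sample_space p q (fst z) (snd z)" by (rule prob_space_sample[OF dens_p dens_q])
      obtain B where B: "\<And>n m u. \<bar>step_est k (2 * \<alpha>) (2 * \<beta>) j n m (u :: (nat \<Rightarrow> 'a) \<times> (nat \<Rightarrow> 'a))\<bar> \<le> B"
        using step_est_bounded[where 'a = 'a] by blast
      obtain B' where B': "\<And>n m u. \<bar>step_est k \<alpha> \<beta> j n m (u :: (nat \<Rightarrow> 'a) \<times> (nat \<Rightarrow> 'a))\<bar> \<le> B'"
        using step_est_bounded[where 'a = 'a] by blast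
      have WV[measurable]: "W j z \<in> borel_measurable (?R z)" "V j z \<in> borel_measurable (?R z)"
        unfolding W_def V_def by (rule step_est_measurable[OF dens_p dens_q])+
      have iV: "integrable (?R z) (V j z)"
        using B by (intro integrable_const_bound[where B = B] AE_I2 WV) (simp add: V_def)
      have iW: "integrable (?R z) (\<lambda>u. (W j z u - w j)\<^sup>2)"
      proof (intro integrable_const_bound[where B = "(B' + \<bar>w j\<bar>)\<^sup>2"] AE_I2)
        fix u
        have "\<bar>W j z u\<bar> \<le> B'" unfolding W_def by (rule B')
        then have "\<bar>W j z u - w j\<bar> \<le> B' + \<bar>w j\<bar>" by linarith
        then show "norm ((W j z u - w j)\<^sup>2) \<le> (B' + \<bar>w j\<bar>)\<^sup>2"
          using power_mono[of "\<bar>W j z u - w j\<bar>" "B' + \<bar>w j\<bar>" 2] by simp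
      qed simp
      let ?h = "\<lambda>u. 2 * (K\<^sup>2 / K2 * est2 z u - K\<^sup>2 * V j z u) + 4 * (K\<^sup>2 * (W j z u - w j)\<^sup>2) + 4 * (K * w j - D)\<^sup>2"
      have h: "(D_est k \<alpha> \<beta> (fst z) (snd z) X Y - D)\<^sup>2 \<le> ?h (X, Y)" for X Y
      proof -
        let ?E = "D_est k \<alpha> \<beta> (fst z) (snd z) X Y" and ?W = "K * W j z (X, Y)"
        have 1: "(?E - D)\<^sup>2 \<le> 2 * (?E - ?W)\<^sup>2 + 2 * (?W - D)\<^sup>2"
          using square_sum_le[of "?E - ?W" "?W - D"] by simp
        have 2: "(?W - D)\<^sup>2 \<le> 2 * (K * W j z (X, Y) - K * w j)\<^sup>2 + 2 * (K * w j - D)\<^sup>2"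
          using square_sum_le[of "?W - K * w j" "K * w j - D"] by simp
        have 3: "(K * W j z (X, Y) - K * w j)\<^sup>2 = K\<^sup>2 * (W j z (X, Y) - w j)\<^sup>2"
          by (simp add: power_mult_distrib[symmetric] right_diff_distrib)
        have 4: "(?E - ?W)\<^sup>2 \<le> K\<^sup>2 / K2 * est2 z (X, Y) - K\<^sup>2 * V j z (X, Y)"
          using step_est_error[OF k0(2) elim(2,3) j, of \<alpha> \<beta> X Y] K(1) K2(1)
          by (simp add: K_def K2_def est2_def V_def W_def)
        have "a \<le> 2 * g + 4 * f + 4 * e"
          if "a \<le> 2 * b + 2 * c" "c \<le> 2 * d + 2 * e" "d = f" "b \<le> g" for a b c d e f g :: real
          using that by linarith
        from this[OF 1 2 3 4] show ?thesis .
      qed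
      have ih: "integrable (?R z) ?h" using elim(1) iV iW by simp
      have "err z \<le> (\<integral>\<^sup>+ u. ennreal (?h u) \<partial>?R z)"
        unfolding err_def using h by (intro nn_integral_mono) (auto intro!: ennreal_leI)
      also have "\<dots> = ennreal (\<integral>u. ?h u \<partial>?R z)"
      \<comment> \<open>The majorant dominates a square and is therefore nonnegative, so its
        extended integral is its Bochner integral; finiteness of the squared error comes out as a
        consequence.\<close>
      proof (rule nn_integral_eq_integral[OF ih], rule AE_I2)
        fix u show "0 \<le> ?h u" using h[of "fst u" "snd u"] by (simp add: order_trans[OF zero_le_power2])
      qed
      also have "(\<integral>u. ?h u \<partial>?R z) = bnd j z"
        using elim(1) iV iW by (simp add: bnd_def prob_space)
      finally show ?case .
    qed
  qed
  have "(err \<longlongrightarrow> 0) ?F"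
  proof (rule order_tendstoI)
    fix e :: ennreal assume "0 < e"
    \<comment> \<open>The tolerance may be \<open>top\<close>, so a finite one is chosen strictly
      below it.\<close>
    then obtain y where y: "0 < y" "y < e" using dense by blast
    then obtain e' where "y = ennreal e'" by (cases y) auto
    with y have e': "0 < ennreal e'" "ennreal e' < e" by simp_all
    then have "0 < e'" by simp
    \<comment> \<open>One grid fine enough for the tolerance is selected before the sample sizes are
      made large.\<close>
    from order_tendstoD(2)[OF lim_lim this] eventually_gt_at_top[of 0]
    have "\<forall>\<^sub>F j in sequentially. lim j < e' \<and> 0 < j" by eventually_elim simp
    then obtain j where j: "lim j < e'" "0 < j"
      using eventually_happens'[OF sequentially_bot] by blast
    show "\<forall>\<^sub>F z in ?F. err z < e"
      using order_tendstoD(2)[OF bnd_lim[OF j(2)] j(1)] err_le[OF j(2)]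
    proof eventually_elim
      case (elim z)
      have "err z \<le> ennreal e'"
        using elim by (intro order_trans[OF elim(2)] ennreal_leI) simp
      then show ?case using e'(2) by simp
    qed
  qed simp
  then show ?thesis by (simp add: err_def[abs_def] D_def split_beta')
qed

end
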